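(* Let $d>0$. The octonionic slice monogenic Szeg\"o kernel of the strip domain $T=\{x\in\mathbb{O}:0<x_0<d\}$ has the explicit form $$K_T(y,x)=\sum_{n=-\infty}^{\infty}(-1)^nk(y+2dn,x),\qquad k(x,y)=\frac{1}{2\pi}(\bar x+\bar y)(|x|^2+2{\rm Re}(x)\bar y+\bar y^2)^{-1}.$$ This kernel is left slice monogenic in $y$ and right slice monogenic in $\bar x$, and it satisfies the Hermitian property $\overline{K_T(y,x)}=K_T(x,y)$.
   Context: $\mathbb{O}\cong\mathbb{R}^8$ denotes the (non-associative) octonions $x=x_0+\sum_{i=1}^7x_ie_i$ with conjugation $x\mapsto\bar{x}$, ${\rm Re}(x)=x_0$, norm $|x|=\sqrt{x\bar{x}}$. $\mathbb{S}$ is the sphere of purely imaginary unit octonions and $\mathbb{C}_I=\mathbb{R}+\mathbb{R}I$ for $I\in\mathbb{S}$. A real differentiable function $f$ is left slice monogenic if for every $I\in\mathbb{S}$ its restriction $f_I$ to $\mathbb{C}_I$ satisfies $\frac12(\frac{\partial}{\partial u}+I\frac{\partial}{\partial v})f_I(u+Iv)=0$; right slice monogenic is defined in the same way with $I$ multiplying on the right. The Hardy space $\mathbf{H}^2(T,\mathbb{O})$ is the closure of the set of slice monogenic functions on $T$ belonging to $L^2(\partial T\cap\mathbb{C}_I)$ for all $I\in\mathbb{S}$, equipped, for an arbitrary fixed $I\in\mathbb{S}$, with $[f,g]_I=\int_{\partial T\cap\mathbb{C}_I}\overline{(t(z)g(z))}\,|ds(z)|\,(t(z)f(z))$, where $t(z)$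 is the normalized $\mathbb{C}_I$-valued tangential field on $\partial T\cap\mathbb{C}_I$ and $|ds(z)|$ the scalar arc element. That $K_T$ is the slice monogenic Szeg\"o kernel means that it is reproducing on each slice: $[f,K_T(\cdot,x)]_I=f(x)$ for $x\in T\cap\mathbb{C}_I$; the values of $f$ off $\mathbb{C}_I$ are then determined by those on $\mathbb{C}_I$ through the Representation Formula $f(u+Jv)=\frac12[f(u+Iv)+f(u-Iv)]+\frac12J[I(f(u-Iv)-f(u+Iv))]$, $J\in\mathbb{S}$.
   Formalization: Slice monogenic functions on T in L² of the boundary are taken in the Hardy sense: L² norms on parallel lines in T are bounded and boundary values are attained in L²; otherwise exp(sin(πz/d))/(z+1) is in L² on the boundary but is not reproduced by the kernel. *)

theory Defs
  imports "HOL-Analysis.Analysis"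
begin

(* The coordinates of an octonion are x $ 0, ..., x $ 7.  The componentwise product and
   unit that the library puts on vectors play no role: the octonionic product is omult, and
   the real number r is the octonion oreal r (in particular 1 is oreal 1). *)
type_synonym octonion = "real ^ 8"

definition oreal :: "real \<Rightarrow> octonion" where
  "oreal r = axis 0 r"

definition oRe :: "octonion \<Rightarrow> real" where
  "oRe x = x $ 0"

definition ocnj :: "octonion \<Rightarrow> octonion" where
  "ocnj x = (\<chi> i. if i = 0 then x $ 0 else - x $ i)"

(* Generated by e1, e2, e3 with e4 = e1 e2, e5 = e1 e3, e6 = e2 e3, e7 = e4 e3; the oriented
   lines of the Fano plane are 124, 135, 236, 437, 176, 257, 465. *)
definition omult :: "octonion \<Rightarrow> octonion \<Rightarrow> octonion" (infixl "\<odot>" 70) where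
  "x \<odot> y = (\<chi> i.
     if i = 0 then x$0 * y$0 - x$1 * y$1 - x$2 * y$2 - x$3 * y$3
                   - x$4 * y$4 - x$5 * y$5 - x$6 * y$6 - x$7 * y$7
     else x$0 * y$i + x$i * y$0 +
      (if i = 1 then (x$2 * y$4 - x$4 * y$2) + (x$3 * y$5 - x$5 * y$3) + (x$7 * y$6 - x$6 * y$7)
       else if i = 2 then (x$4 * y$1 - x$1 * y$4) + (x$3 * y$6 - x$6 * y$3) + (x$5 * y$7 - x$7 * y$5)
       else if i = 3 then (x$5 * y$1 - x$1 * y$5) + (x$6 * y$2 - x$2 * y$6) + (x$7 * y$4 - x$4 * y$7)
       else if i = 4 then (x$1 * y$2 - x$2 * y$1) + (x$3 * y$7 - x$7 * y$3) + (x$6 * y$5 - x$5 * y$6)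
       else if i = 5 then (x$1 * y$3 - x$3 * y$1) + (x$7 * y$2 - x$2 * y$7) + (x$4 * y$6 - x$6 * y$4)
       else if i = 6 then (x$2 * y$3 - x$3 * y$2) + (x$1 * y$7 - x$7 * y$1) + (x$5 * y$4 - x$4 * y$5)
       else (x$4 * y$3 - x$3 * y$4) + (x$6 * y$1 - x$1 * y$6) + (x$2 * y$5 - x$5 * y$2)))"

definition oinv :: "octonion \<Rightarrow> octonion" where
  "oinv x = (1 / (norm x)\<^sup>2) *\<^sub>R ocnj x"

lemma UNIV_8: "(UNIV :: 8 set) = {0, 1, 2, 3, 4, 5, 6, 7}"
  by (rule sym, rule card_subset_eq) auto

lemma sum_8: "sum f (UNIV :: 8 set) = f 0 + f 1 + f 2 + f 3 + f 4 + f 5 + f 6 + f 7"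
  unfolding UNIV_8 by (simp add: add.assoc)

lemma forall_8:
  "(\<forall>i::8. P i) \<longleftrightarrow> P 0 \<and> P 1 \<and> P 2 \<and> P 3 \<and> P 4 \<and> P 5 \<and> P 6 \<and> P 7"
  by (metis UNIV_8 UNIV_I insertE emptyE)

lemma octonion_norm_sq:
  "(norm (x :: octonion))\<^sup>2 =
     (x$0)\<^sup>2 + (x$1)\<^sup>2 + (x$2)\<^sup>2 + (x$3)\<^sup>2 + (x$4)\<^sup>2 + (x$5)\<^sup>2 + (x$6)\<^sup>2 + (x$7)\<^sup>2"
  unfolding power2_norm_eq_inner inner_vec_def sum_8
  by (simp only: inner_real_def power2_eq_square)

lemma omult_nth:
  "(x \<odot> y) $ 0 = x$0 * y$0 - x$1 * y$1 - x$2 * y$2 - x$3 * y$3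
                - x$4 * y$4 - x$5 * y$5 - x$6 * y$6 - x$7 * y$7"
  "(x \<odot> y) $ 1 = x$0 * y$1 + x$1 * y$0
     + ((x$2 * y$4 - x$4 * y$2) + (x$3 * y$5 - x$5 * y$3) + (x$7 * y$6 - x$6 * y$7))"
  "(x \<odot> y) $ 2 = x$0 * y$2 + x$2 * y$0
     + ((x$4 * y$1 - x$1 * y$4) + (x$3 * y$6 - x$6 * y$3) + (x$5 * y$7 - x$7 * y$5))"
  "(x \<odot> y) $ 3 = x$0 * y$3 + x$3 * y$0
     + ((x$5 * y$1 - x$1 * y$5) + (x$6 * y$2 - x$2 * y$6) + (x$7 * y$4 - x$4 * y$7))"
  "(x \<odot> y) $ 4 = x$0 * y$4 + x$4 * y$0
     + ((x$1 * y$2 - x$2 * y$1) + (x$3 * y$7 - x$7 * y$3) + (x$6 * y$5 - x$5 * y$6))"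
  "(x \<odot> y) $ 5 = x$0 * y$5 + x$5 * y$0
     + ((x$1 * y$3 - x$3 * y$1) + (x$7 * y$2 - x$2 * y$7) + (x$4 * y$6 - x$6 * y$4))"
  "(x \<odot> y) $ 6 = x$0 * y$6 + x$6 * y$0
     + ((x$2 * y$3 - x$3 * y$2) + (x$1 * y$7 - x$7 * y$1) + (x$5 * y$4 - x$4 * y$5))"
  "(x \<odot> y) $ 7 = x$0 * y$7 + x$7 * y$0
     + ((x$4 * y$3 - x$3 * y$4) + (x$6 * y$1 - x$1 * y$6) + (x$2 * y$5 - x$5 * y$2))"
  by (simp_all add: omult_def)

(* The Euclidean norm is the octonionic one, and the table above does define a composition
   algebra. *)
lemma omult_ocnj: "x \<odot> ocnj x = oreal ((norm x)\<^sup>2)"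
  unfolding vec_eq_iff forall_8 omult_nth octonion_norm_sq
  by (simp add: ocnj_def oreal_def axis_def power2_eq_square)

lemma norm_omult: "norm (x \<odot> y) = norm x * norm y"
proof -
  have "(norm (x \<odot> y))\<^sup>2 = (norm x)\<^sup>2 * (norm y)\<^sup>2"
    unfolding octonion_norm_sq omult_nth by algebra
  then show ?thesis
    by (metis norm_ge_zero mult_nonneg_nonneg power_mult_distrib power2_eq_iff_nonneg)
qed

definition imag_sphere :: "octonion set" where
  "imag_sphere = {I. oRe I = 0 \<and> norm I = 1}"

definition slice_pt :: "octonion \<Rightarrow> real \<Rightarrow> real \<Rightarrow> octonion" where
  "slice_pt I u v = oreal u + v *\<^sub>R I"

definition slice_plane :: "octonion \<Rightarrow> octonion set" where
  "slice_plane I = {slice_pt I u v | u v. True}"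

definition left_slice_monogenic_on :: "octonion set \<Rightarrow> (octonion \<Rightarrow> octonion) \<Rightarrow> bool" where
  "left_slice_monogenic_on U f \<longleftrightarrow> f differentiable_on U \<and>
     (\<forall>I\<in>imag_sphere. \<forall>u v. slice_pt I u v \<in> U \<longrightarrow>
        (1/2) *\<^sub>R (vector_derivative (\<lambda>s. f (slice_pt I s v)) (at u)
                 + I \<odot> vector_derivative (\<lambda>t. f (slice_pt I u t)) (at v)) = 0)"

definition right_slice_monogenic_on :: "octonion set \<Rightarrow> (octonion \<Rightarrow> octonion) \<Rightarrow> bool" where
  "right_slice_monogenic_on U f \<longleftrightarrow> f differentiable_on U \<and>
     (\<forall>I\<in>imag_sphere. \<forall>u v. slice_pt I u v \<in> U \<longrightarrow>
        (1/2) *\<^sub>R (vector_derivative (\<lambda>s. f (slice_pt I s v)) (at u)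
                 + vector_derivative (\<lambda>t. f (slice_pt I u t)) (at v) \<odot> I) = 0)"

definition octo_strip :: "real \<Rightarrow> octonion set" where
  "octo_strip d = {x. 0 < oRe x \<and> oRe x < d}"

definition L2_line :: "(real \<Rightarrow> octonion) \<Rightarrow> bool" where
  "L2_line g \<longleftrightarrow> g \<in> borel_measurable lborel \<and> integrable lborel (\<lambda>v. (norm (g v))\<^sup>2)"

definition L2_sq :: "(real \<Rightarrow> octonion) \<Rightarrow> real" where
  "L2_sq g = (LINT v|lborel. (norm (g v))\<^sup>2)"

(* The boundary of the strip meets a slice plane in the two lines u = 0 and u = d, which
   v \<mapsto> slice_pt I u v parametrises by arc length.

   Functions are given on the closed strip, their values on the two lines being their boundary
   values.  That a slice monogenic function on the strip belongs to L2 of the boundary is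
   understood in the sense of Hardy spaces: its L2 norms on the parallel lines inside the strip
   are bounded, and it attains its boundary values as L2 limits.  The bound on the inner lines
   cannot be dropped: with i replaced by I and a small c > 0, the function
   exp (sin (pi (z - c) / (d - 2c))) / (z + 1) converges in L2 to its boundary values on both
   lines but is not reproduced by any Cauchy integral over them. *)
definition hardy_core :: "real \<Rightarrow> (octonion \<Rightarrow> octonion) set" where
  "hardy_core d = {f. left_slice_monogenic_on (octo_strip d) f \<and>
     (\<forall>I\<in>imag_sphere.
        (\<forall>u\<in>{0..d}. L2_line (\<lambda>v. f (slice_pt I u v))) \<and>
        (\<exists>C. \<forall>u\<in>{0<..<d}. L2_sq (\<lambda>v. f (slice_pt I u v)) \<le> C) \<and>
        ((\<lambda>u. L2_sq (\<lambda>v. f (slice_pt I u v) - f (slice_pt I 0 v))) \<longlongrightarrow> 0) (at_right 0) \<and>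
        ((\<lambda>u. L2_sq (\<lambda>v. f (slice_pt I u v) - f (slice_pt I d v))) \<longlongrightarrow> 0) (at_left d))}"

(* The closure of hardy_core with respect to L2 convergence of the boundary values on every
   slice; a limit is identified with a function on the strip through the values inside, which
   converge as well. *)
definition hardy2 :: "real \<Rightarrow> (octonion \<Rightarrow> octonion) set" where
  "hardy2 d = {f.
     (\<forall>I\<in>imag_sphere. \<forall>u\<in>{0, d}. L2_line (\<lambda>v. f (slice_pt I u v))) \<and>
     (\<exists>F :: nat \<Rightarrow> octonion \<Rightarrow> octonion.
        (\<forall>n. F n \<in> hardy_core d) \<and>
        (\<forall>x\<in>octo_strip d. (\<lambda>n. F n x) \<longlonglongrightarrow> f x) \<and>
        (\<forall>I\<in>imag_sphere. \<forall>u\<in>{0, d}.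
           (\<lambda>n. L2_sq (\<lambda>v. F n (slice_pt I u v) - f (slice_pt I u v))) \<longlonglongrightarrow> 0))}"

(* Unit tangent of the positively oriented boundary of the strip in the slice plane of I. *)
definition strip_tangent :: "octonion \<Rightarrow> octonion \<Rightarrow> octonion" where
  "strip_tangent I z = (if oRe z = 0 then - I else I)"

definition hardy_inner ::
  "real \<Rightarrow> octonion \<Rightarrow> (octonion \<Rightarrow> octonion) \<Rightarrow> (octonion \<Rightarrow> octonion) \<Rightarrow> octonion" where
  "hardy_inner d I f g = (\<Sum>u\<in>{0, d}. LINT v|lborel.
     (let z = slice_pt I u v; t = strip_tangent I z in ocnj (t \<odot> g z) \<odot> (t \<odot> f z)))"

definition is_slice_szego_kernel ::
  "real \<Rightarrow> (octonion \<Rightarrow> octonion \<Rightarrow> octonion) \<Rightarrow> bool" where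
  "is_slice_szego_kernel d K \<longleftrightarrow>
     (\<forall>x\<in>octo_strip d. (\<lambda>y. K y x) \<in> hardy2 d) \<and>
     (\<forall>f\<in>hardy2 d. \<forall>I\<in>imag_sphere. \<forall>x\<in>octo_strip d \<inter> slice_plane I.
        hardy_inner d I f (\<lambda>y. K y x) = f x)"

definition szego_k :: "octonion \<Rightarrow> octonion \<Rightarrow> octonion" where
  "szego_k x y = (1 / (2 * pi)) *\<^sub>R ((ocnj x + ocnj y) \<odot>
     oinv (oreal ((norm x)\<^sup>2) + (2 * oRe x) *\<^sub>R ocnj y + ocnj y \<odot> ocnj y))"

(* The series below converges only conditionally; both tails are allowed to tend to infinity
   independently. *)
definition bisums :: "(int \<Rightarrow> octonion) \<Rightarrow> octonion \<Rightarrow> bool" where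
  "bisums a s \<longleftrightarrow>
     ((\<lambda>(M, N). \<Sum>n\<in>{- int M..int N}. a n) \<longlongrightarrow> s) (sequentially \<times>\<^sub>F sequentially)"

definition szego_term :: "real \<Rightarrow> octonion \<Rightarrow> octonion \<Rightarrow> int \<Rightarrow> octonion" where
  "szego_term d y x n = ((-1) powi n) *\<^sub>R szego_k (y + oreal (2 * d * of_int n)) x"

definition szego_strip :: "real \<Rightarrow> octonion \<Rightarrow> octonion \<Rightarrow> octonion" where
  "szego_strip d y x = (THE s. bisums (szego_term d y x) s)"

end

theory Submission
  imports Defs "HOL-Complex_Analysis.Complex_Analysis" "HOL-Probability.Sinc_Integral"
begin

text \<open>Let \<open>x\<close> lie on the slice \<open>\<complex>\<^sub>I\<close>. For \<open>y\<close> on the same slice everything commutes, the terms of the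
series are \<open>(-1)\<^sup>n / (2\<pi> (y + cnj x + 2dn))\<close>, and the partial fraction expansion of the cosecant
sums them to \<open>G(y + cnj x)\<close> with \<open>G(\<zeta>) = 1 / (4d sin(\<pi>\<zeta> / (2d)))\<close> (\<open>csc_bisums\<close>). For \<open>y\<close> on
another slice each term is the extension, by the Representation Formula, of its values on \<open>\<complex>\<^sub>I\<close>
(\<open>szego_k_slice\<close>), and therefore so is the sum (\<open>szego_strip_bisums\<close>, \<open>szego_strip_slice\<close>). All
claims are read off from this closed form.

Slice extensions of holomorphic functions are slice monogenic; the point to check is real
differentiability on the real axis (\<open>left_slice_monogenic_on_slice_ext\<close>). The Hermitian property
is a computation with two scalar values of \<open>G\<close> (\<open>szego_strip_hermitian\<close>), and it turns left
monogenicity in \<open>y\<close> into right monogenicity in \<open>cnj x\<close>. As \<open>G\<close> decays on vertical lines, uniformly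
away from its poles, the kernel belongs to the Hardy space (\<open>szego_strip_in_hardy_core\<close>).

For the reproducing property, left multiplication by \<open>I\<close> is a complex structure on the octonions, so
complex linear functionals reduce the claim to scalar functions \<open>h\<close> on a complex strip. Conjugation
and the symmetries \<open>G(-\<zeta>) = -G(\<zeta>)\<close> and \<open>G(2d - \<zeta>) = G(\<zeta>)\<close> turn the inner product into the
contour integral of \<open>G(z - x) h(z)\<close> over the boundary of the strip, up to the factor \<open>1/i\<close>. The only
pole inside is \<open>z = x\<close>, with residue \<open>1 / (2\<pi>)\<close>, whence the value \<open>h(x)\<close>
(\<open>csc_cauchy_formula_boundary\<close>). Some care is needed because \<open>h\<close> is only in a Hardy class: the
rectangles are cut off at heights where \<open>h\<close> is bounded in quadratic mean, and the vertical edges move to the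
boundary by \<open>L\<^sup>2\<close> convergence.

Uniqueness is the standard argument for reproducing kernels on the slice of \<open>x\<close>, followed by the
Representation Formula (\<open>slice_szego_kernel_unique\<close>).\<close>

\<comment> \<open>In what follows \<open>$\<close> always selects a component of a vector.\<close>
no_notation fps_nth (infixl "$" 75)

section \<open>Octonion algebra\<close>

lemma bounded_bilinear_omult: "bounded_bilinear (\<odot>)"
proof
  show "(a + a') \<odot> b = a \<odot> b + a' \<odot> b" for a a' b
    unfolding vec_eq_iff forall_8 by (simp add: omult_nth algebra_simps)
  show "a \<odot> (b + b') = a \<odot> b + a \<odot> b'" for a b b'
    unfolding vec_eq_iff forall_8 by (simp add: omult_nth algebra_simps)
  show "(r *\<^sub>R a) \<odot> b = r *\<^sub>R (a \<odot> b)" for r a b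
    unfolding vec_eq_iff forall_8 by (simp add: omult_nth algebra_simps)
  show "a \<odot> (r *\<^sub>R b) = r *\<^sub>R (a \<odot> b)" for r a b
    unfolding vec_eq_iff forall_8 by (simp add: omult_nth algebra_simps)
  show "\<exists>K. \<forall>a b. norm (a \<odot> b) \<le> norm a * norm b * K"
    by (intro exI[of _ 1]) (simp add: norm_omult)
qed

interpretation omult: bounded_bilinear "(\<odot>)"
  by (rule bounded_bilinear_omult)

lemma oreal_omult [simp]: "oreal r \<odot> x = r *\<^sub>R x" "x \<odot> oreal r = r *\<^sub>R x"
  unfolding vec_eq_iff forall_8 omult_nth
  by (simp_all add: oreal_def axis_def)

lemma ocnj_nth: "ocnj x $ 0 = x $ 0" "i \<noteq> 0 \<Longrightarrow> ocnj x $ i = - x $ i"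
  by (simp_all add: ocnj_def)

lemma bounded_linear_ocnj: "bounded_linear ocnj"
proof
  show "ocnj (a + b) = ocnj a + ocnj b" for a b
    by (simp add: vec_eq_iff ocnj_def)
  show "ocnj (r *\<^sub>R a) = r *\<^sub>R ocnj a" for r a
    by (simp add: vec_eq_iff ocnj_def)
  show "\<exists>K. \<forall>x. norm (ocnj x) \<le> norm x * K"
  proof (intro exI[of _ 1] allI)
    fix x
    have "(norm (ocnj x))\<^sup>2 = (norm x)\<^sup>2"
      unfolding octonion_norm_sq by (simp add: ocnj_nth)
    then show "norm (ocnj x) \<le> norm x * 1"
      by simp
  qed
qed

lemmas ocnj_linear_simps = linear_simps[OF bounded_linear_ocnj]

lemma ocnj_ocnj [simp]: "ocnj (ocnj x) = x"
  by (simp add: vec_eq_iff ocnj_def)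

lemma ocnj_omult: "ocnj (x \<odot> y) = ocnj y \<odot> ocnj x"
  unfolding vec_eq_iff forall_8 omult_nth
  by (simp add: ocnj_nth omult_nth algebra_simps)

lemma imag_sphere_nth_0: "I \<in> imag_sphere \<Longrightarrow> I $ 0 = 0"
  by (simp add: imag_sphere_def oRe_def)

lemma norm_imag_sphere: "I \<in> imag_sphere \<Longrightarrow> norm I = 1"
  by (simp add: imag_sphere_def)

lemma imag_sphere_nonempty: "\<exists>I. I \<in> imag_sphere"
proof
  show "axis 1 1 \<in> imag_sphere"
    by (simp add: imag_sphere_def oRe_def axis_def)
       (metis norm_axis_1 axis_def)
qed

declare norm_imag_sphere [simp]

text \<open>The product is not associative, but this instance of the alternative law is all the associativity
that the slice-wise arguments use: left multiplication by a unit \<open>I \<in> \<S>\<close> is a complex structure on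
the eight-dimensional real space.\<close>

lemma imag_omult_imag_omult:
  assumes "I $ 0 = 0"
  shows "I \<odot> (I \<odot> x) = - ((norm I)\<^sup>2 *\<^sub>R x)"
  unfolding octonion_norm_sq vec_eq_iff forall_8 omult_nth using assms
  by (simp add: omult_nth power2_eq_square algebra_simps)

lemma imag_sphere_omult_omult:
  "I \<in> imag_sphere \<Longrightarrow> I \<odot> (I \<odot> x) = - x"
  using imag_omult_imag_omult[OF imag_sphere_nth_0] by simp

lemma ocnj_imag_sphere: "I \<in> imag_sphere \<Longrightarrow> ocnj I = - I"
  by (simp add: vec_eq_iff ocnj_def imag_sphere_nth_0)

section \<open>Slices as complex planes\<close>

text \<open>The parametrisation of \<open>\<complex>\<^sub>I\<close> by the library's complex numbers. It is an isometric algebra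
embedding, and \<open>c \<cdot> x = slice_emb I c \<odot> x\<close> makes all octonions a complex vector space; complex
analysis enters through this scalar multiplication.\<close>

definition slice_emb :: "octonion \<Rightarrow> complex \<Rightarrow> octonion" where
  "slice_emb I z = slice_pt I (Re z) (Im z)"

lemma slice_emb_eq: "slice_emb I z = Re z *\<^sub>R oreal 1 + Im z *\<^sub>R I"
  by (simp add: slice_emb_def slice_pt_def oreal_def vec_eq_iff axis_def)

lemma slice_pt_eq_slice_emb: "slice_pt I u v = slice_emb I (Complex u v)"
  by (simp add: slice_emb_def)

lemma oreal_eq: "oreal r = r *\<^sub>R oreal 1"
  by (simp add: oreal_def vec_eq_iff axis_def)

lemma norm_slice_emb [simp]:
  assumes "I \<in> imag_sphere"
  shows "norm (slice_emb I z) = norm z"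
proof -
  have "inner (oreal 1) I = 0"
    using assms by (simp add: oreal_def inner_axis' imag_sphere_nth_0)
  moreover have "norm (oreal 1) = 1"
    by (simp add: oreal_def norm_axis_1)
  ultimately have "(norm (slice_emb I z))\<^sup>2 = (norm z)\<^sup>2"
    using assms unfolding slice_emb_eq cmod_power2
    by (simp add: power2_norm_eq_inner inner_add inner_commute)
       (simp add: power2_norm_eq_inner[symmetric] power2_eq_square)
  then show ?thesis
    by simp
qed

lemma bounded_linear_slice_emb: "bounded_linear (slice_emb I)"
  unfolding slice_emb_eq[abs_def]
  by (intro bounded_linear_add bounded_linear_scaleR_const bounded_linear_Re bounded_linear_Im)

lemmas slice_emb_linear_simps = linear_simps[OF bounded_linear_slice_emb]

lemma slice_emb_of_real: "slice_emb I (of_real r) = oreal r"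
  by (simp add: slice_emb_def slice_pt_def)

lemma slice_emb_1 [simp]: "slice_emb I 1 = oreal 1"
  using slice_emb_of_real[of I 1] by simp

lemma slice_emb_ii [simp]: "slice_emb I \<i> = I"
  by (simp add: slice_emb_eq)

lemma ocnj_slice_emb: "I \<in> imag_sphere \<Longrightarrow> ocnj (slice_emb I z) = slice_emb I (cnj z)"
proof -
  assume "I \<in> imag_sphere"
  moreover have "ocnj (oreal 1) = oreal 1"
    by (simp add: oreal_def ocnj_def axis_def vec_eq_iff)
  ultimately show ?thesis
    by (simp add: slice_emb_eq ocnj_linear_simps ocnj_imag_sphere)
qed

lemma slice_emb_omult_eq: "slice_emb I z \<odot> x = Re z *\<^sub>R x + Im z *\<^sub>R (I \<odot> x)"
  by (simp add: slice_emb_eq omult.add_left omult.scaleR_left)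

lemma slice_emb_mult_omult:
  assumes "I \<in> imag_sphere"
  shows "slice_emb I z \<odot> (slice_emb I w \<odot> x) = slice_emb I (z * w) \<odot> x"
  using assms
  by (simp add: slice_emb_omult_eq omult.add_right omult.scaleR_right imag_sphere_omult_omult
      algebra_simps)

lemma slice_emb_mult:
  assumes "I \<in> imag_sphere"
  shows "slice_emb I z \<odot> slice_emb I w = slice_emb I (z * w)"
  using slice_emb_mult_omult[OF assms, of z w "oreal 1"] by simp

lemma oinv_slice_emb:
  assumes "I \<in> imag_sphere"
  shows "oinv (slice_emb I z) = slice_emb I (inverse z)"
proof -
  have "inverse z = (1 / (norm z)\<^sup>2) *\<^sub>R cnj z"
    by (simp add: complex_eq_iff cmod_power2)
  then show ?thesis
    using assms by (simp add: oinv_def ocnj_slice_emb slice_emb_linear_simps)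
qed

lemma oRe_slice_emb: "I \<in> imag_sphere \<Longrightarrow> oRe (slice_emb I z) = Re z"
  by (simp add: slice_emb_eq oRe_def imag_sphere_nth_0 oreal_def axis_def)

text \<open>Asking for a point of the closed upper half plane makes \<open>z\<close> a function of \<open>x\<close>. The unit \<open>J\<close> is
unique except on the real axis, which is common to all slices.\<close>

lemma slice_emb_cases:
  obtains J z where "J \<in> imag_sphere" "x = slice_emb J z" "Im z = norm (x - oreal (oRe x))"
    "Re z = oRe x"
proof -
  define p where "p = x - oreal (oRe x)"
  have p0: "p $ 0 = 0"
    by (simp add: p_def oreal_def oRe_def axis_def)
  obtain I where I: "I \<in> imag_sphere"
    using imag_sphere_nonempty by blast
  define J where "J = (if p = 0 then I else p /\<^sub>R norm p)"
  have "J \<in> imag_sphere"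
    using I p0 by (auto simp: J_def imag_sphere_def oRe_def simp del: norm_imag_sphere)
  moreover have "x = slice_emb J (Complex (oRe x) (norm p))"
  proof -
    have "norm p *\<^sub>R J = p"
      by (auto simp: J_def)
    then show ?thesis
      by (simp add: slice_emb_def slice_pt_def p_def)
  qed
  ultimately show ?thesis
    using that[of J "Complex (oRe x) (norm p)"] by (simp add: p_def)
qed

section \<open>Slice derivatives\<close>

text \<open>Complex differentiability of an octonion-valued function on \<open>\<complex>\<^sub>I\<close>: the real differential is left
multiplication by the increment. This says the Cauchy-Riemann equation \<open>\<partial>\<^sub>u F + I \<partial>\<^sub>v F = 0\<close>
together with real differentiability.\<close>

definition has_slice_derivative ::
  "octonion \<Rightarrow> (complex \<Rightarrow> octonion) \<Rightarrow> octonion \<Rightarrow> complex \<Rightarrow> bool" where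
  "has_slice_derivative I F D z \<longleftrightarrow> (F has_derivative (\<lambda>h. slice_emb I h \<odot> D)) (at z)"

text \<open>The right-hand side of the Representation Formula: the only candidate for the value at \<open>u + Jv\<close> of
a slice monogenic function that equals \<open>F\<close> on \<open>\<complex>\<^sub>I\<close>.\<close>

definition slice_ext ::
  "octonion \<Rightarrow> (complex \<Rightarrow> octonion) \<Rightarrow> octonion \<Rightarrow> complex \<Rightarrow> octonion" where
  "slice_ext I F J z =
     (1/2) *\<^sub>R (F z + F (cnj z)) + (1/2) *\<^sub>R (J \<odot> (I \<odot> (F (cnj z) - F z)))"

lemma slice_ext_self: "I \<in> imag_sphere \<Longrightarrow> slice_ext I F I z = F z"
  by (simp add: slice_ext_def imag_sphere_omult_omult algebra_simps scaleR_half_double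
      flip: scaleR_add_left)

lemma slice_ext_of_real: "slice_ext I F J (of_real u) = F (of_real u)"
  by (simp add: slice_ext_def omult.zero_right flip: scaleR_2)

lemma slice_ext_diff:
  "slice_ext I (\<lambda>z. F z - G z) J z = slice_ext I F J z - slice_ext I G J z"
  by (simp add: slice_ext_def omult.add_right omult.diff_right algebra_simps)

lemma slice_ext_const: "slice_ext I (\<lambda>z. c) J z = c"
  by (simp add: slice_ext_def omult.zero_right flip: scaleR_2)

text \<open>The linear functions \<open>\<zeta> \<mapsto> \<zeta> D\<close> have the expected extension \<open>h \<mapsto> h \<odot> D\<close>. This identifies the
differential of an extended function at a real point.\<close>

lemma slice_ext_emb:
  assumes "I \<in> imag_sphere" "J \<in> imag_sphere"
  shows "slice_ext I (\<lambda>z. slice_emb I z \<odot> D) J z = slice_emb J z \<odot> D"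
proof -
  have "slice_emb I z \<odot> D + slice_emb I (cnj z) \<odot> D = (2 * Re z) *\<^sub>R D"
    "slice_emb I (cnj z) \<odot> D - slice_emb I z \<odot> D = (- 2 * Im z) *\<^sub>R (I \<odot> D)"
    by (simp_all add: slice_emb_omult_eq vec_eq_iff)
  then show ?thesis
    unfolding slice_ext_def using assms
    by (simp add: omult.scaleR_right omult.minus_right imag_sphere_omult_omult slice_emb_omult_eq)
qed

lemma norm_slice_ext_le:
  assumes "I \<in> imag_sphere" "J \<in> imag_sphere"
  shows "norm (slice_ext I F J z) \<le> norm (F z) + norm (F (cnj z))"
proof -
  have "norm (slice_ext I F J z) \<le> 1/2 * norm (F z + F (cnj z)) + 1/2 * norm (F (cnj z) - F z)"
    unfolding slice_ext_def using assms
    by (intro norm_triangle_le) (simp add: norm_omult)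
  also have "\<dots> \<le> norm (F z) + norm (F (cnj z))"
    using norm_triangle_ineq[of "F z" "F (cnj z)"] norm_triangle_ineq4[of "F (cnj z)" "F z"]
    by simp
  finally show ?thesis .
qed

text \<open>The extension turns complex differentiability with respect to \<open>I\<close> into complex differentiability
with respect to \<open>J\<close>. Both conjugate points enter, because the value at \<open>u + Jv\<close> mixes the values
at \<open>u + Iv\<close> and \<open>u - Iv\<close>.\<close>

lemma has_slice_derivative_slice_ext:
  assumes "I \<in> imag_sphere" "J \<in> imag_sphere"
    and D: "has_slice_derivative I F D z" and D': "has_slice_derivative I F D' (cnj z)"
  shows "has_slice_derivative J (slice_ext I F J)
           ((1/2) *\<^sub>R (D + D') + (1/2) *\<^sub>R (J \<odot> (I \<odot> (D' - D)))) z"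
proof -
  have cnj: "((\<lambda>z. F (cnj z)) has_derivative (\<lambda>h. slice_emb I (cnj h) \<odot> D')) (at z)"
    using has_derivative_compose[OF bounded_linear_imp_has_derivative[OF bounded_linear_cnj]
        D'[unfolded has_slice_derivative_def]] .
  note der = D[unfolded has_slice_derivative_def]
  have "(slice_ext I F J has_derivative
      (\<lambda>h. (1/2) *\<^sub>R (slice_emb I h \<odot> D + slice_emb I (cnj h) \<odot> D')
         + (1/2) *\<^sub>R (J \<odot> (I \<odot> (slice_emb I (cnj h) \<odot> D' - slice_emb I h \<odot> D))))) (at z)"
    unfolding slice_ext_def[abs_def]
    by (intro has_derivative_add has_derivative_scaleR_right has_derivative_diff der cnj
        bounded_linear.has_derivative[OF omult.bounded_linear_right])
  also have "(\<lambda>h. (1/2) *\<^sub>R (slice_emb I h \<odot> D + slice_emb I (cnj h) \<odot> D')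
         + (1/2) *\<^sub>R (J \<odot> (I \<odot> (slice_emb I (cnj h) \<odot> D' - slice_emb I h \<odot> D))))
     = (\<lambda>h. slice_emb J h \<odot> ((1/2) *\<^sub>R (D + D') + (1/2) *\<^sub>R (J \<odot> (I \<odot> (D' - D)))))"
    using assms(1,2)
    by (auto simp: fun_eq_iff slice_emb_omult_eq omult.scaleR_right omult.add_right
        omult.diff_right omult.minus_right imag_sphere_omult_omult algebra_simps)
  finally show ?thesis
    unfolding has_slice_derivative_def .
qed

lemma has_slice_derivative_slice_emb:
  assumes "I \<in> imag_sphere" "(g has_field_derivative g') (at z)"
  shows "has_slice_derivative I (\<lambda>z. slice_emb I (g z)) (slice_emb I g') z"
proof -
  have "((\<lambda>z. slice_emb I (g z)) has_derivative (\<lambda>h. slice_emb I (g' * h))) (at z)"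
    using assms(2) unfolding has_field_derivative_def
    by (rule bounded_linear.has_derivative[OF bounded_linear_slice_emb])
  then show ?thesis
    using assms(1) unfolding has_slice_derivative_def by (simp add: slice_emb_mult mult.commute)
qed

lemma has_vector_derivative_Complex:
  "((\<lambda>s. Complex s v) has_vector_derivative 1) (at u)"
  "((\<lambda>t. Complex u t) has_vector_derivative \<i>) (at v)"
  unfolding Complex_eq
  by (auto intro!: derivative_eq_intros simp: scaleR_conv_of_real[symmetric])

lemma has_derivative_imp_vector_derivatives:
  assumes "(F has_derivative F') (at (Complex u v))"
  shows "((\<lambda>s. F (Complex s v)) has_vector_derivative F' 1) (at u)"
    "((\<lambda>t. F (Complex u t)) has_vector_derivative F' \<i>) (at v)"
proof -
  interpret F': bounded_linear F'
    using assms by (rule has_derivative_bounded_linear)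
  show "((\<lambda>s. F (Complex s v)) has_vector_derivative F' 1) (at u)"
    using has_derivative_compose[of "\<lambda>s. Complex s v" "\<lambda>h. h *\<^sub>R 1" u UNIV F F'] assms
      has_vector_derivative_Complex(1)[of v u]
    by (simp add: has_vector_derivative_def F'.scaleR)
  show "((\<lambda>t. F (Complex u t)) has_vector_derivative F' \<i>) (at v)"
    using has_derivative_compose[of "\<lambda>t. Complex u t" "\<lambda>h. h *\<^sub>R \<i>" v UNIV F F'] assms
      has_vector_derivative_Complex(2)[of u v]
    by (simp add: has_vector_derivative_def F'.scaleR)
qed

lemma left_slice_monogenic_onI:
  assumes "f differentiable_on U"
    and "\<And>J z. J \<in> imag_sphere \<Longrightarrow> slice_emb J z \<in> U \<Longrightarrow>
           \<exists>D. has_slice_derivative J (\<lambda>z. f (slice_emb J z)) D z"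
  shows "left_slice_monogenic_on U f"
  unfolding left_slice_monogenic_on_def
proof (intro conjI ballI allI impI)
  fix J u v assume J: "J \<in> imag_sphere" and "slice_pt J u v \<in> U"
  then obtain D where "has_slice_derivative J (\<lambda>z. f (slice_emb J z)) D (Complex u v)"
    using assms(2)[of J "Complex u v"] by (auto simp: slice_pt_eq_slice_emb)
  then have "((\<lambda>z. f (slice_emb J z)) has_derivative (\<lambda>h. slice_emb J h \<odot> D)) (at (Complex u v))"
    by (simp add: has_slice_derivative_def)
  from has_derivative_imp_vector_derivatives[OF this, THEN vector_derivative_at]
  have "vector_derivative (\<lambda>s. f (slice_pt J s v)) (at u) = D"
    "vector_derivative (\<lambda>t. f (slice_pt J u t)) (at v) = J \<odot> D"
    by (simp_all add: slice_pt_eq_slice_emb)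
  then show "(1/2) *\<^sub>R (vector_derivative (\<lambda>s. f (slice_pt J s v)) (at u)
                 + J \<odot> vector_derivative (\<lambda>t. f (slice_pt J u t)) (at v)) = 0"
    using J by (simp add: imag_sphere_omult_omult)
qed (fact assms)

text \<open>The hypothesis speaks of two partial derivatives only; real differentiability on the open set makes
them determine the whole differential along the slice.\<close>

lemma left_slice_monogenic_onD:
  assumes "left_slice_monogenic_on U f" "open U" "J \<in> imag_sphere" "slice_emb J z \<in> U"
  shows "\<exists>D. has_slice_derivative J (\<lambda>z. f (slice_emb J z)) D z"
proof -
  obtain f' where f': "(f has_derivative f') (at (slice_emb J z))"
    using assms unfolding left_slice_monogenic_on_def differentiable_on_def differentiable_def
    by (metis at_within_open)
  define L where "L = (\<lambda>h. f' (slice_emb J h))"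
  have der: "((\<lambda>z. f (slice_emb J z)) has_derivative L) (at z)"
    using has_derivative_compose[of "slice_emb J" "slice_emb J" z UNIV f f'] f'
      bounded_linear_imp_has_derivative[OF bounded_linear_slice_emb, of J "at z"]
    by (simp add: L_def)
  then interpret L: bounded_linear L
    by (rule has_derivative_bounded_linear)
  obtain u v where z: "z = Complex u v"
    by (cases z)
  from has_derivative_imp_vector_derivatives[OF der[unfolded z], THEN vector_derivative_at]
  have "vector_derivative (\<lambda>s. f (slice_pt J s v)) (at u) = L 1"
    "vector_derivative (\<lambda>t. f (slice_pt J u t)) (at v) = L \<i>"
    by (simp_all add: slice_pt_eq_slice_emb)
  moreover have "(1/2) *\<^sub>R (vector_derivative (\<lambda>s. f (slice_pt J s v)) (at u)
                 + J \<odot> vector_derivative (\<lambda>t. f (slice_pt J u t)) (at v)) = 0"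
    using assms by (auto simp: left_slice_monogenic_on_def slice_pt_eq_slice_emb z)
  ultimately have "L 1 = - (J \<odot> L \<i>)"
    by (simp add: eq_neg_iff_add_eq_0)
  then have L_ii: "L \<i> = J \<odot> L 1"
    using assms(3) by (simp add: omult.minus_right imag_sphere_omult_omult)
  have "L h = slice_emb J h \<odot> L 1" for h
  proof -
    have "h = Re h *\<^sub>R 1 + Im h *\<^sub>R \<i>"
      by (simp add: complex_eq_iff)
    then have "L h = Re h *\<^sub>R L 1 + Im h *\<^sub>R L \<i>"
      by (metis L.add L.scaleR)
    then show ?thesis
      by (simp add: slice_emb_omult_eq L_ii)
  qed
  then have "L = (\<lambda>h. slice_emb J h \<odot> L 1)"
    by (rule ext)
  with der have "((\<lambda>z. f (slice_emb J z)) has_derivative (\<lambda>h. slice_emb J h \<odot> L 1)) (at z)"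
    by metis
  then show ?thesis
    unfolding has_slice_derivative_def ..
qed

section \<open>Slice extensions are slice monogenic\<close>

definition imag_part :: "octonion \<Rightarrow> octonion" where
  "imag_part y = y - oreal (oRe y)"

definition half_plane_pt :: "octonion \<Rightarrow> complex" where
  "half_plane_pt y = Complex (oRe y) (norm (imag_part y))"

lemma bounded_linear_oRe: "bounded_linear oRe"
  unfolding oRe_def[abs_def] by (rule bounded_linear_vec_nth)

lemma bounded_linear_imag_part: "bounded_linear imag_part"
  unfolding imag_part_def[abs_def] oreal_eq[of "oRe _"]
  by (intro bounded_linear_sub bounded_linear_ident
      bounded_linear_compose[OF bounded_linear_scaleR_left bounded_linear_oRe])

text \<open>At a real point the formula for the extension through \<open>J = Im y / |Im y|\<close> breaks down, but the
first order remainder of the extension is the extension of the remainder of \<open>F\<close>, whose norm is at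
most the sum of the two remainders at \<open>z\<close> and \<open>cnj z\<close>, uniformly in \<open>J\<close>.\<close>

lemma differentiable_at_real_axis:
  assumes I: "I \<in> imag_sphere" and W: "open W" "of_real u \<in> W" "\<And>z. z \<in> W \<Longrightarrow> cnj z \<in> W"
    and D: "has_slice_derivative I F D (of_real u)"
    and f: "\<And>J z. J \<in> imag_sphere \<Longrightarrow> z \<in> W \<Longrightarrow> f (slice_emb J z) = slice_ext I F J z"
  shows "(f has_derivative (\<lambda>h. h \<odot> D)) (at (oreal u))"
  unfolding has_derivative_at_alt
proof (intro conjI allI impI)
  show "bounded_linear (\<lambda>h. h \<odot> D)"
    by (rule omult.bounded_linear_left)
  fix e :: real assume "e > 0"
  define R where "R = (\<lambda>w. F w - F (of_real u) - slice_emb I (w - of_real u) \<odot> D)"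
  obtain r where r: "r > 0" "\<And>w. norm (w - of_real u) < r \<Longrightarrow> norm (R w) \<le> e/2 * norm (w - of_real u)"
    using D \<open>e > 0\<close> unfolding has_slice_derivative_def has_derivative_at_alt R_def
    by (meson half_gt_zero)
  obtain r' where r': "r' > 0" "ball (of_real u) r' \<subseteq> W"
    using W by (meson open_contains_ball)
  have "norm (f y - f (oreal u) - (y - oreal u) \<odot> D) \<le> e * norm (y - oreal u)"
    if y: "norm (y - oreal u) < min r r'" for y
  proof -
    obtain J z where J: "J \<in> imag_sphere" "y = slice_emb J z"
      using slice_emb_cases by blast
    have yu: "y - oreal u = slice_emb J (z - of_real u)"
      by (simp add: J slice_emb_linear_simps slice_emb_of_real)
    then have nz: "norm (y - oreal u) = norm (z - of_real u)"
      using J by simp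
    have nz': "norm (cnj z - of_real u) = norm (z - of_real u)"
      by (metis complex_cnj_complex_of_real complex_cnj_diff complex_mod_cnj)
    have "z \<in> W"
      using r' y nz by (auto simp: dist_norm norm_minus_commute)
    then have fy: "f y = slice_ext I F J z"
      using f J by simp
    have fu: "f (oreal u) = F (of_real u)"
      using f[of J "of_real u"] J W by (simp add: slice_emb_of_real slice_ext_of_real)
    have "f y - f (oreal u) - (y - oreal u) \<odot> D = slice_ext I R J z"
      unfolding R_def slice_emb_linear_simps omult.diff_left slice_ext_diff slice_ext_const
        slice_ext_emb[OF I J(1)] fy fu by (simp add: J slice_emb_of_real)
    also have "norm \<dots> \<le> norm (R z) + norm (R (cnj z))"
      using norm_slice_ext_le[OF I J(1)] .
    also have "\<dots> \<le> e/2 * norm (z - of_real u) + e/2 * norm (z - of_real u)"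
      using r(2)[of z] r(2)[of "cnj z"] y nz nz' by (intro add_mono) auto
    finally show ?thesis
      using nz by simp
  qed
  then show "\<exists>r>0. \<forall>y. norm (y - oreal u) < r \<longrightarrow>
      norm (f y - f (oreal u) - (y - oreal u) \<odot> D) \<le> e * norm (y - oreal u)"
    using r(1) r'(1) by (intro exI[of _ "min r r'"]) auto
qed

text \<open>Away from the real axis the slice coordinates of a point depend smoothly on it, and the chain rule
applies.\<close>

lemma differentiable_off_real_axis:
  assumes I: "I \<in> imag_sphere" and W: "open W" "half_plane_pt y \<in> W"
    and y: "imag_part y \<noteq> 0"
    and F: "F differentiable (at (half_plane_pt y))" "F differentiable (at (cnj (half_plane_pt y)))"
    and f: "\<And>J z. J \<in> imag_sphere \<Longrightarrow> z \<in> W \<Longrightarrow> f (slice_emb J z) = slice_ext I F J z"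
  shows "f differentiable (at y)"
proof -
  let ?g = "\<lambda>x. (1/2) *\<^sub>R (F (half_plane_pt x) + F (cnj (half_plane_pt x))) +
     (1/2) *\<^sub>R ((imag_part x /\<^sub>R norm (imag_part x)) \<odot>
       (I \<odot> (F (cnj (half_plane_pt x)) - F (half_plane_pt x))))"
  let ?V = "{x. half_plane_pt x \<in> W \<and> imag_part x \<noteq> 0}"
  have lin: "imag_part differentiable (at y)" "oRe differentiable (at y)"
    using bounded_linear_imag_part bounded_linear_oRe
    by (auto intro: bounded_linear_imp_differentiable)
  have nrm: "(\<lambda>x. norm (imag_part x)) differentiable (at y)"
    using differentiable_compose[OF differentiable_norm_at[OF y] lin(1)] .
  have hp: "half_plane_pt differentiable (at y)"
    unfolding half_plane_pt_def[abs_def] Complex_eq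
    by (intro derivative_intros lin nrm
        differentiable_compose[OF bounded_linear_imp_differentiable[OF bounded_linear_of_real]])
  have hp': "(\<lambda>x. cnj (half_plane_pt x)) differentiable (at y)"
    by (rule differentiable_compose[OF bounded_linear_imp_differentiable[OF bounded_linear_cnj] hp])
  have bil: "(\<lambda>x. p x \<odot> q x) differentiable (at y)"
    if "p differentiable (at y)" "q differentiable (at y)" for p q
    using that omult.FDERIV unfolding differentiable_def by blast
  have diff: "?g differentiable (at y)"
    using y by (intro derivative_intros bil lin nrm differentiable_compose[OF F(1) hp]
        differentiable_compose[OF F(2) hp']) auto
  have cont: "continuous_on UNIV half_plane_pt" "continuous_on UNIV imag_part"
    unfolding half_plane_pt_def[abs_def] Complex_eq
    by (intro continuous_intros linear_continuous_on bounded_linear_imag_part bounded_linear_oRe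
        continuous_on_compose2[OF linear_continuous_on[OF bounded_linear_imag_part]])+ auto
  have "open (half_plane_pt -` W)" "open (imag_part -` (- {0}))"
    using cont W(1) by (auto simp: continuous_on_open_vimage open_Compl intro!: open_vimage)
  then have "open (half_plane_pt -` W \<inter> imag_part -` (- {0}))"
    by (rule open_Int)
  also have "half_plane_pt -` W \<inter> imag_part -` (- {0}) = ?V"
    by auto
  finally have "open ?V" .
  have eq: "f x = ?g x" if "x \<in> ?V" for x
  proof -
    let ?J = "imag_part x /\<^sub>R norm (imag_part x)"
    have "?J \<in> imag_sphere"
      using that by (auto simp: imag_sphere_def imag_part_def oRe_def oreal_def axis_def
          simp del: norm_imag_sphere)
    moreover have "x = slice_emb ?J (half_plane_pt x)"
      using that by (auto simp: slice_emb_def slice_pt_def half_plane_pt_def imag_part_def)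
    ultimately have "f x = slice_ext I F ?J (half_plane_pt x)"
      using f that by (metis (no_types, lifting) mem_Collect_eq)
    then show ?thesis
      by (simp add: slice_ext_def)
  qed
  from diff obtain g' where "(?g has_derivative g') (at y)"
    by (auto simp: differentiable_def)
  then have "(f has_derivative g') (at y)"
    by (rule has_derivative_transform_within_open[of _ _ _ UNIV ?V])
       (use \<open>open ?V\<close> W y eq in auto)
  then show ?thesis
    by (auto simp: differentiable_def)
qed

lemma left_slice_monogenic_on_slice_ext:
  assumes I: "I \<in> imag_sphere" and W: "open W" "\<And>z. z \<in> W \<Longrightarrow> cnj z \<in> W"
    and U: "\<And>J z. J \<in> imag_sphere \<Longrightarrow> slice_emb J z \<in> U \<Longrightarrow> z \<in> W"
    and F: "\<And>z. z \<in> W \<Longrightarrow> \<exists>D. has_slice_derivative I F D z"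
    and f: "\<And>J z. J \<in> imag_sphere \<Longrightarrow> z \<in> W \<Longrightarrow> f (slice_emb J z) = slice_ext I F J z"
  shows "left_slice_monogenic_on U f"
proof (rule left_slice_monogenic_onI)
  have Fd: "F differentiable (at z)" if "z \<in> W" for z
    using F[OF that] unfolding has_slice_derivative_def differentiable_def by blast
  have "f differentiable (at y)" if y: "y \<in> U" for y
  proof (cases "imag_part y = 0")
    case True
    then have yu: "y = oreal (oRe y)"
      by (simp add: imag_part_def)
    then have "of_real (oRe y) \<in> W"
      using U[OF I, of "of_real (oRe y)"] y by (simp add: slice_emb_of_real)
    then show ?thesis
      using differentiable_at_real_axis[OF I W(1) _ W(2) _ f] F yu
      by (metis differentiable_def)
  next
    case False
    obtain J z where J: "J \<in> imag_sphere" "y = slice_emb J z" "Im z = norm (imag_part y)" "Re z = oRe y"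
      using slice_emb_cases[of y] unfolding imag_part_def by metis
    then have "z = half_plane_pt y"
      by (simp add: half_plane_pt_def complex_eq_iff)
    then have "half_plane_pt y \<in> W"
      using U J y by auto
    then show ?thesis
      using differentiable_off_real_axis[OF I W(1) _ False _ _ f] Fd W(2) by blast
  qed
  then show "f differentiable_on U"
    by (simp add: differentiable_at_imp_differentiable_on)
next
  fix J z assume J: "J \<in> imag_sphere" "slice_emb J z \<in> U"
  then have z: "z \<in> W"
    using U by blast
  obtain D D' where "has_slice_derivative I F D z" "has_slice_derivative I F D' (cnj z)"
    using F z W(2) by meson
  from has_slice_derivative_slice_ext[OF I J(1) this]
  have "\<exists>D. has_slice_derivative J (slice_ext I F J) D z" ..
  then obtain D where "(slice_ext I F J has_derivative (\<lambda>h. slice_emb J h \<odot> D)) (at z)"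
    by (auto simp: has_slice_derivative_def)
  then have "((\<lambda>z. f (slice_emb J z)) has_derivative (\<lambda>h. slice_emb J h \<odot> D)) (at z)"
    by (rule has_derivative_transform_within_open[of _ _ _ UNIV W]) (use W(1) z f J in auto)
  then show "\<exists>D. has_slice_derivative J (\<lambda>z. f (slice_emb J z)) D z"
    by (auto simp: has_slice_derivative_def)
qed

section \<open>The Representation Formula\<close>

text \<open>The complex linear functional, for the complex structure given by \<open>I\<close>, with real part
\<open>x \<mapsto> x \<bullet> w\<close>. Composition with it reduces statements on octonion-valued functions on \<open>\<complex>\<^sub>I\<close> to
scalar complex analysis, and since \<open>w\<close> is free nothing is lost.\<close>

definition slice_functional :: "octonion \<Rightarrow> octonion \<Rightarrow> octonion \<Rightarrow> complex" where
  "slice_functional I w x = Complex (inner x w) (- inner (I \<odot> x) w)"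

lemma Re_slice_functional [simp]: "Re (slice_functional I w x) = inner x w"
  by (simp add: slice_functional_def)

lemma bounded_linear_slice_functional: "bounded_linear (slice_functional I w)"
proof -
  have "bounded_linear (\<lambda>x. inner x w *\<^sub>R 1 + (- inner (I \<odot> x) w) *\<^sub>R \<i>)"
    by (intro bounded_linear_add bounded_linear_scaleR_const bounded_linear_minus
        bounded_linear_inner_left bounded_linear_compose[OF bounded_linear_inner_left]
        omult.bounded_linear_right)
  moreover have "slice_functional I w = (\<lambda>x. inner x w *\<^sub>R 1 + (- inner (I \<odot> x) w) *\<^sub>R \<i>)"
    by (auto simp: slice_functional_def complex_eq_iff)
  ultimately show ?thesis
    by simp
qed

lemma slice_functional_omult:
  assumes "I \<in> imag_sphere"
  shows "slice_functional I w (slice_emb I c \<odot> x) = c * slice_functional I w x"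
  using assms
  by (simp add: slice_functional_def complex_eq_iff slice_emb_omult_eq inner_add omult.add_right
      omult.scaleR_right imag_sphere_omult_omult algebra_simps)

lemma has_slice_derivative_functional:
  assumes "I \<in> imag_sphere" "has_slice_derivative I F D z"
  shows "((\<lambda>z. slice_functional I w (F z)) has_field_derivative slice_functional I w D) (at z)"
  using bounded_linear.has_derivative[OF bounded_linear_slice_functional
      assms(2)[unfolded has_slice_derivative_def], of I w] assms(1)
  by (simp add: slice_functional_omult has_field_derivative_def mult.commute[of _ "slice_functional I w D"])

lemma open_octo_strip: "open (octo_strip d)"
proof -
  have "octo_strip d = oRe -` {0<..<d}"
    by (auto simp: octo_strip_def)
  then show ?thesis
    using linear_continuous_on[OF bounded_linear_oRe] by (simp add: open_vimage)
qed

lemma slice_emb_in_octo_strip_iff: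
  "I \<in> imag_sphere \<Longrightarrow> slice_emb I z \<in> octo_strip d \<longleftrightarrow> 0 < Re z \<and> Re z < d"
  by (simp add: octo_strip_def oRe_slice_emb)

lemma open_complex_strip: "open {z. a < Re z \<and> Re z < b}"
  by (simp add: Collect_conj_eq open_Int open_halfspace_Re_gt open_halfspace_Re_lt)

lemma convex_complex_strip: "convex {z. a < Re z \<and> Re z < b}"
  by (simp add: Collect_conj_eq convex_Int convex_halfspace_Re_gt convex_halfspace_Re_lt)

text \<open>On \<open>\<complex>\<^sub>J\<close> both sides are holomorphic for the complex structure of \<open>J\<close>, and they agree on the real
interval, which has limit points; so the identity theorem applies to their difference.\<close>

lemma representation_formula:
  assumes f: "left_slice_monogenic_on (octo_strip d) f"
    and IJ: "I \<in> imag_sphere" "J \<in> imag_sphere" and z: "0 < Re z" "Re z < d"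
  shows "f (slice_emb J z) = slice_ext I (\<lambda>z. f (slice_emb I z)) J z"
proof -
  let ?S = "{z. 0 < Re z \<and> Re z < d}"
  let ?F = "\<lambda>z. f (slice_emb I z)"
  define E where "E = (\<lambda>z. f (slice_emb J z) - slice_ext I ?F J z)"
  \<comment> \<open>Testing with the functional of \<open>w = E z\<close> itself: it vanishes at \<open>E z\<close> only if \<open>E z = 0\<close>.\<close>
  define w where "w = E z"
  define h where "h = (\<lambda>z. slice_functional J w (E z))"
  note der = left_slice_monogenic_onD[OF f open_octo_strip]
  have "h field_differentiable (at \<zeta>)" if \<zeta>: "\<zeta> \<in> ?S" for \<zeta>
  proof -
    obtain D where D: "has_slice_derivative J (\<lambda>z. f (slice_emb J z)) D \<zeta>"
      using der[of J \<zeta>] IJ \<zeta> by (auto simp: slice_emb_in_octo_strip_iff)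
    obtain D1 where D1: "has_slice_derivative I ?F D1 \<zeta>"
      using der[of I \<zeta>] IJ \<zeta> by (auto simp: slice_emb_in_octo_strip_iff)
    obtain D2 where D2: "has_slice_derivative I ?F D2 (cnj \<zeta>)"
      using der[of I "cnj \<zeta>"] IJ \<zeta> by (auto simp: slice_emb_in_octo_strip_iff)
    from has_slice_derivative_slice_ext[OF IJ D1 D2]
    obtain D3 where "has_slice_derivative J (slice_ext I ?F J) D3 \<zeta>" ..
    then have "has_slice_derivative J E (D - D3) \<zeta>"
      using D unfolding has_slice_derivative_def E_def omult.diff_right
      by (intro has_derivative_diff)
    from has_slice_derivative_functional[OF IJ(2) this] show ?thesis
      unfolding h_def field_differentiable_def by blast
  qed
  then have hol: "h holomorphic_on ?S"
    by (auto simp: holomorphic_on_def intro: field_differentiable_at_within)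
  have "h z = 0"
  proof (rule analytic_continuation[OF hol open_complex_strip])
    show "connected ?S"
      by (simp add: convex_complex_strip convex_connected)
    show "complex_of_real ` {0<..<d} \<subseteq> ?S"
      by auto
    show "of_real (d/2) \<in> ?S" "z \<in> ?S"
      using z by auto
    show "of_real (d/2) islimpt complex_of_real ` {0<..<d}"
      unfolding islimpt_approachable
    proof (intro allI impI)
      fix e :: real assume "e > 0"
      define r where "r = min (e/2) (d/4)"
      have r: "r > 0" "r < e" "d/2 + r \<in> {0<..<d}"
        using z \<open>e > 0\<close> by (auto simp: r_def)
      show "\<exists>x'\<in>complex_of_real ` {0<..<d}. x' \<noteq> of_real (d/2) \<and> dist x' (of_real (d/2)) < e"
      proof (intro bexI conjI)
        show "complex_of_real (d/2 + r) \<noteq> of_real (d/2)"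
          unfolding of_real_eq_iff using r by simp
        show "dist (complex_of_real (d/2 + r)) (of_real (d/2)) < e"
          unfolding dist_of_real using r by (simp add: dist_real_def)
      qed (use r in \<open>intro imageI\<close>)
    qed
    show "h \<zeta> = 0" if "\<zeta> \<in> complex_of_real ` {0<..<d}" for \<zeta>
    proof -
      from that obtain u where \<zeta>: "\<zeta> = of_real u"
        by auto
      then show ?thesis
        unfolding h_def E_def \<zeta> slice_ext_of_real slice_emb_of_real
        using linear_simps[OF bounded_linear_slice_functional] by simp
    qed
  qed
  then have "inner (E z) (E z) = 0"
    by (metis Re_slice_functional h_def w_def zero_complex.sel(1))
  then show ?thesis
    by (simp add: E_def)
qed

section \<open>Partial fractions of the cosecant\<close>

lemma sums_of_pair_sums:
  fixes a :: "nat \<Rightarrow> 'a::real_normed_vector"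
  assumes s: "(\<lambda>n. a (2 * n) + a (2 * n + 1)) sums s" and a: "a \<longlonglongrightarrow> 0"
  shows "a sums s"
proof -
  define T where "T = (\<lambda>k. \<Sum>n<k. a (2 * n) + a (2 * n + 1))"
  define r where "r = (\<lambda>n. if odd n then a (2 * (n div 2)) else 0)"
  have even: "(\<Sum>n<2 * k. a n) = T k" for k
    by (induction k) (simp_all add: T_def add.assoc)
  have "(\<Sum>n<m. a n) = T (m div 2) + r m" for m
  proof (cases "even m")
    case True
    then show ?thesis
      using even[of "m div 2"] by (simp add: r_def)
  next
    case False
    then have "m = Suc (2 * (m div 2))"
      by presburger
    then have "(\<Sum>n<m. a n) = (\<Sum>n<2 * (m div 2). a n) + a (2 * (m div 2))"
      by (metis sum.lessThan_Suc)
    then show ?thesis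
      using False even[of "m div 2"] by (simp add: r_def)
  qed
  moreover have half: "filterlim (\<lambda>n::nat. n div 2) at_top sequentially"
    unfolding filterlim_at_top
  proof
    fix Z :: nat
    show "eventually (\<lambda>n. Z \<le> n div 2) sequentially"
      using eventually_ge_at_top[of "2 * Z"] by eventually_elim auto
  qed
  have "(\<lambda>m. T (m div 2)) \<longlonglongrightarrow> s"
    using filterlim_compose[OF s[unfolded sums_def] half] by (simp add: T_def)
  moreover have "r \<longlonglongrightarrow> 0"
  proof (rule tendsto_norm_zero_cancel, rule tendsto_sandwich[of "\<lambda>_. 0"])
    have "filterlim (\<lambda>n::nat. 2 * n) at_top sequentially"
      by (rule filterlim_at_top_mono[OF filterlim_ident]) auto
    then have "filterlim (\<lambda>n::nat. 2 * (n div 2)) at_top sequentially"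
      using half by (rule filterlim_compose)
    then show "(\<lambda>n. norm (a (2 * (n div 2)))) \<longlonglongrightarrow> 0"
      using filterlim_compose[OF a] by (intro tendsto_norm_zero)
  qed (auto simp: r_def)
  ultimately show ?thesis
    unfolding sums_def using tendsto_add[of "\<lambda>m. T (m div 2)" s sequentially r 0] by simp
qed

lemma tendsto_inverse_add_of_nat:
  "(\<lambda>n. 1 / (z + of_nat n) :: complex) \<longlonglongrightarrow> 0"
  by (intro tendsto_divide_0[OF tendsto_const] tendsto_add_filterlim_at_infinity[OF tendsto_const]
      tendsto_of_nat)

text \<open>Two consecutive terms of the alternating series form one term of the difference of the series for
the digamma function at \<open>z/2\<close> and at \<open>(z+1)/2\<close>.\<close>

lemma alternating_sums_Digamma:
  assumes z: "z \<notin> \<int>\<^sub>\<le>\<^sub>0"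
  shows "(\<lambda>k. (- 1) ^ k / (z + of_nat k)) sums ((Digamma ((z + 1) / 2) - Digamma (z / 2)) / 2 :: complex)"
proof (rule sums_of_pair_sums)
  have nz: "z + of_nat k \<noteq> 0" for k
    using z by (metis add.commute add_eq_0_iff minus_of_nat_in_nonpos_Ints)
  have w: "(\<lambda>n. inverse (of_nat (Suc n)) - inverse (w + of_nat n)) sums (Digamma w + euler_mascheroni)"
    if "w \<noteq> 0" for w :: complex
    using summable_Digamma[OF that] by (simp add: Digamma_def summable_sums)
  have "z / 2 \<noteq> 0" "(z + 1) / 2 \<noteq> 0"
    using nz[of 0] nz[of 1] by auto
  from sums_diff[OF w[OF this(2)] w[OF this(1)]]
  have "(\<lambda>n. inverse (z / 2 + of_nat n) - inverse ((z + 1) / 2 + of_nat n)) sums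
      (Digamma ((z + 1) / 2) - Digamma (z / 2))"
    by simp
  from sums_divide[OF this, of 2]
  have "(\<lambda>n. (inverse (z / 2 + of_nat n) - inverse ((z + 1) / 2 + of_nat n)) / 2) sums
      ((Digamma ((z + 1) / 2) - Digamma (z / 2)) / 2)" .
  also have "(\<lambda>n. (inverse (z / 2 + of_nat n) - inverse ((z + 1) / 2 + of_nat n)) / 2) =
      (\<lambda>n. (- 1) ^ (2 * n) / (z + of_nat (2 * n)) + (- 1) ^ (2 * n + 1) / (z + of_nat (2 * n + 1)))"
  proof
    fix n
    have e: "z / 2 + of_nat n = (z + of_nat (2 * n)) / 2"
      "(z + 1) / 2 + of_nat n = (z + of_nat (2 * n + 1)) / 2"
      by (simp_all add: field_simps)
    show "(inverse (z / 2 + of_nat n) - inverse ((z + 1) / 2 + of_nat n)) / 2 =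
      (- 1) ^ (2 * n) / (z + of_nat (2 * n)) + (- 1) ^ (2 * n + 1) / (z + of_nat (2 * n + 1))"
    proof -
      have "(inverse (p / 2) - inverse (q / 2)) / 2 = 1 / p + (- 1) / q" for p q :: complex
        by (simp add: inverse_eq_divide diff_divide_distrib)
      then show ?thesis
        unfolding e by (simp only: power_mult power_add) simp
    qed
  qed
  finally show "(\<lambda>n. (- 1) ^ (2 * n) / (z + of_nat (2 * n)) +
      (- 1) ^ (2 * n + 1) / (z + of_nat (2 * n + 1))) sums
      ((Digamma ((z + 1) / 2) - Digamma (z / 2)) / 2)" .
  show "(\<lambda>k. (- 1) ^ k / (z + of_nat k)) \<longlonglongrightarrow> 0"
    by (rule Lim_null_comparison[OF _ tendsto_norm_zero[OF tendsto_inverse_add_of_nat[of z]]])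
       (simp add: norm_divide norm_power)
qed

lemma sin_pi_nonzero:
  assumes "z \<notin> \<int>"
  shows "sin (of_real pi * z :: complex) \<noteq> 0"
proof
  assume "sin (of_real pi * z) = 0"
  then obtain n :: int where "of_real pi * z = of_real (of_int n * pi)"
    by (auto simp: sin_eq_0)
  then have "of_real pi * z = of_real pi * of_int n"
    by simp
  then have "z = of_int n"
    by (subst (asm) mult_cancel_left) simp
  with assms show False
    by simp
qed

text \<open>The logarithmic derivative of the reflection formula \<open>\<Gamma>(z) \<Gamma>(1-z) = \<pi> / sin(\<pi>z)\<close>.\<close>

lemma Digamma_reflection_complex:
  assumes z: "z \<notin> \<int>"
  shows "Digamma z - Digamma (1 - z) = - of_real pi * cot (of_real pi * z :: complex)"
proof -
  have s: "sin (of_real pi * z) \<noteq> 0"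
    using z by (rule sin_pi_nonzero)
  have "1 - z \<notin> \<int>"
    using z by (metis Ints_1 Ints_diff diff_diff_eq2 add_diff_cancel_left')
  then have n: "z \<notin> \<int>\<^sub>\<le>\<^sub>0" "1 - z \<notin> \<int>\<^sub>\<le>\<^sub>0"
    using z nonpos_Ints_Int by blast+
  have "((\<lambda>z. Gamma z * Gamma (1 - z)) has_field_derivative
      Gamma z * Gamma (1 - z) * (Digamma z - Digamma (1 - z))) (at z)"
    using n by (auto intro!: derivative_eq_intros simp: algebra_simps)
  moreover have "((\<lambda>z. of_real pi / sin (of_real pi * z)) has_field_derivative
      - (of_real pi * of_real pi * cos (of_real pi * z)) / (sin (of_real pi * z))\<^sup>2) (at z)"
    using s by (auto intro!: derivative_eq_intros simp: power2_eq_square)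
  ultimately have "Gamma z * Gamma (1 - z) * (Digamma z - Digamma (1 - z)) =
      - (of_real pi * of_real pi * cos (of_real pi * z)) / (sin (of_real pi * z))\<^sup>2"
    unfolding Gamma_reflection_complex by (rule DERIV_unique)
  then have "of_real pi / sin (of_real pi * z) * (Digamma z - Digamma (1 - z)) =
      of_real pi / sin (of_real pi * z) * (- of_real pi * cot (of_real pi * z))"
    unfolding Gamma_reflection_complex by (simp add: cot_def power2_eq_square)
  moreover have "of_real pi / sin (of_real pi * z) \<noteq> 0"
    using s by simp
  ultimately show ?thesis
    using mult_left_cancel by blast
qed

text \<open>The two one-sided series converge separately, which is why the two tails of the octonionic series
may tend to infinity independently. By the digamma reflection at \<open>z/2\<close> and \<open>(z+1)/2\<close>, their sum is
\<open>\<pi> (cot t + tan t) / 2\<close> with \<open>t = \<pi>z/2\<close>.\<close>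

lemma csc_partial_fractions:
  fixes z :: complex
  assumes z: "z \<notin> \<int>"
  obtains P Q where "(\<lambda>N. \<Sum>k\<le>N. (- 1) ^ k / (z + of_nat k)) \<longlonglongrightarrow> P"
    "(\<lambda>M. \<Sum>k<M. (- 1) ^ Suc k / (z - of_nat (Suc k))) \<longlonglongrightarrow> Q"
    "P + Q = of_real pi / sin (of_real pi * z)"
proof
  define P where "P = (Digamma ((z + 1) / 2) - Digamma (z / 2)) / 2"
  define Q where "Q = (Digamma ((1 - z + 1) / 2) - Digamma ((1 - z) / 2)) / 2"
  have "1 - z \<notin> \<int>"
    using z by (metis Ints_1 Ints_diff diff_diff_eq2 add_diff_cancel_left')
  then have n: "z \<notin> \<int>\<^sub>\<le>\<^sub>0" "1 - z \<notin> \<int>\<^sub>\<le>\<^sub>0"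
    using z nonpos_Ints_Int by blast+
  show "(\<lambda>N. \<Sum>k\<le>N. (- 1) ^ k / (z + of_nat k)) \<longlonglongrightarrow> P"
    using alternating_sums_Digamma[OF n(1)] unfolding P_def sums_def_le .
  have "(- 1) ^ k / (1 - z + of_nat k) = (- 1) ^ Suc k / (z - of_nat (Suc k))" for k
  proof -
    have "1 - z + of_nat k = - (z - of_nat (Suc k))"
      by simp
    then show ?thesis
      by (metis minus_divide_right minus_divide_left mult_minus1 power_Suc)
  qed
  then show "(\<lambda>M. \<Sum>k<M. (- 1) ^ Suc k / (z - of_nat (Suc k))) \<longlonglongrightarrow> Q"
    using alternating_sums_Digamma[OF n(2)] unfolding Q_def sums_def by simp
  have half: "z / 2 \<notin> \<int>" "(z + 1) / 2 \<notin> \<int>"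
  proof -
    show "z / 2 \<notin> \<int>"
    proof
      assume "z / 2 \<in> \<int>"
      then have "2 * (z / 2) \<in> \<int>"
        by (intro Ints_mult) auto
      then show False
        using z by simp
    qed
    show "(z + 1) / 2 \<notin> \<int>"
    proof
      assume "(z + 1) / 2 \<in> \<int>"
      then have "2 * ((z + 1) / 2) - 1 \<in> \<int>"
        by (intro Ints_diff Ints_mult) auto
      moreover have "2 * ((z + 1) / 2) - 1 = z"
        by (simp add: field_simps)
      ultimately show False
        using z by metis
    qed
  qed
  define t where "t = of_real pi * (z / 2)"
  have e: "1 - z / 2 = (1 - z + 1) / 2" "1 - (z + 1) / 2 = (1 - z) / 2"
    by (simp_all add: field_simps)
  have "P + Q = ((Digamma ((z + 1) / 2) - Digamma (1 - (z + 1) / 2)) -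
      (Digamma (z / 2) - Digamma (1 - z / 2))) / 2"
    unfolding P_def Q_def e by (simp add: field_simps)
  also have "\<dots> = of_real pi * (cot t - cot (of_real pi * ((z + 1) / 2))) / 2"
    unfolding Digamma_reflection_complex[OF half(1)] Digamma_reflection_complex[OF half(2)] t_def
    by (simp add: algebra_simps)
  also have "cot (of_real pi * ((z + 1) / 2)) = - (sin t / cos t)"
  proof -
    have e: "of_real pi * ((z + 1) / 2) = t + of_real pi / 2"
      by (simp add: t_def field_simps)
    have "cos (t + of_real pi / 2) = - sin t" "sin (t + of_real pi / 2) = cos t"
      by (simp_all add: cos_add sin_add)
    then show ?thesis
      unfolding e by (simp add: cot_def)
  qed
  also have "of_real pi * (cot t - - (sin t / cos t)) / 2 = of_real pi / (2 * sin t * cos t)"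
  proof -
    have s2: "sin (of_real pi * z) = 2 * sin t * cos t"
      using sin_double[of t] by (simp add: t_def)
    have "sin (of_real pi * z) \<noteq> 0"
      using z by (rule sin_pi_nonzero)
    then have "sin t \<noteq> 0" "cos t \<noteq> 0"
      by (auto simp: s2)
    then have "cot t + sin t / cos t = ((cos t)\<^sup>2 + (sin t)\<^sup>2) / (sin t * cos t)"
      unfolding cot_def by (subst add_frac_eq) (auto simp: power2_eq_square)
    then show ?thesis
      by simp
  qed
  also have "2 * sin t * cos t = sin (of_real pi * z)"
    using sin_double[of t] by (simp add: t_def)
  finally show "P + Q = of_real pi / sin (of_real pi * z)" .
qed

section \<open>The cosecant kernel\<close>

text \<open>The sum of the series restricted to one slice, as a function of \<open>y + cnj x\<close>.\<close>

definition csc_kernel :: "real \<Rightarrow> complex \<Rightarrow> complex" where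
  "csc_kernel d z = 1 / (4 * of_real d * sin (of_real (pi / (2 * d)) * z))"

lemma csc_kernel_minus: "csc_kernel d (- z) = - csc_kernel d z"
  by (simp add: csc_kernel_def)

lemma cnj_csc_kernel: "cnj (csc_kernel d z) = csc_kernel d (cnj z)"
  by (simp add: csc_kernel_def cnj_sin)

text \<open>This symmetry about \<open>Re z = d\<close> converts the conjugated kernel on the right boundary line into the
Cauchy-type kernel with its pole at \<open>x\<close>.\<close>

lemma csc_kernel_reflect: "d \<noteq> 0 \<Longrightarrow> csc_kernel d (of_real (2 * d) - z) = csc_kernel d z"
proof -
  assume "d \<noteq> 0"
  then have "pi / (2 * d) * (2 * d) = pi"
    by simp
  then have "of_real (pi / (2 * d)) * (of_real (2 * d) - z) = of_real pi - of_real (pi / (2 * d)) * z"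
    by (simp only: right_diff_distrib of_real_mult[symmetric])
  then show ?thesis
    by (simp add: csc_kernel_def sin_diff)
qed

text \<open>Since \<open>|sin(a + ib)|\<^sup>2 = sin\<^sup>2 a + sinh\<^sup>2 b\<close>. The true growth in \<open>b\<close> is exponential, but
quadratic growth suffices for square integrability on vertical lines.\<close>

lemma norm_sin_squared_ge: "(norm (sin z))\<^sup>2 \<ge> (sin (Re z))\<^sup>2 + (Im z)\<^sup>2 / 2"
proof -
  define t where "t = \<bar>2 * Im z\<bar>"
  have "exp t \<ge> 1 + t + t\<^sup>2 / 2"
    by (rule exp_lower_Taylor_quadratic) (simp add: t_def)
  moreover have "exp (- t) \<ge> 1 + (- t)"
    by (rule exp_ge_add_one_self)
  moreover have "exp (2 * Im z) + inverse (exp (2 * Im z)) = exp t + exp (- t)"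
    by (cases "Im z \<ge> 0") (simp_all add: t_def exp_minus)
  ultimately have "exp (2 * Im z) + inverse (exp (2 * Im z)) \<ge> 2 + t\<^sup>2 / 2"
    by linarith
  moreover have "t\<^sup>2 = 4 * (Im z)\<^sup>2"
    by (simp add: t_def power_mult_distrib)
  moreover have "cos (2 * Re z) = 1 - 2 * (sin (Re z))\<^sup>2"
    by (rule cos_double_sin)
  ultimately show ?thesis
    unfolding norm_sin_squared by simp
qed

lemma sin_strip_nonzero:
  assumes "0 < d" "0 < Re z" "Re z < 2 * d"
  shows "sin (of_real (pi / (2 * d)) * z) \<noteq> 0"
proof -
  have "0 < pi / (2 * d) * Re z" "pi / (2 * d) * Re z < pi"
    using assms by (auto simp: field_simps)
  then have "sin (pi / (2 * d) * Re z) > 0"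
    by (rule sin_gt_zero)
  moreover have "Re (of_real (pi / (2 * d)) * z) = pi / (2 * d) * Re z"
    by simp
  ultimately show ?thesis
    using norm_sin_squared_ge[of "of_real (pi / (2 * d)) * z"]
    by (metis norm_zero power_zero_numeral zero_less_power add_pos_nonneg zero_le_power2
        half_gt_zero_iff divide_nonneg_pos zero_less_numeral not_less)
qed

lemma csc_kernel_holomorphic:
  assumes "0 < d"
  shows "csc_kernel d holomorphic_on {z. 0 < Re z \<and> Re z < 2 * d}"
  unfolding csc_kernel_def[abs_def]
  using assms sin_strip_nonzero[OF assms]
  by (intro holomorphic_intros) auto

text \<open>The decay is uniform on closed vertical strips that avoid the poles at \<open>0\<close> and \<open>2d\<close>; this gives one
integrable majorant for all vertical lines in such a strip.\<close>

lemma csc_kernel_bound: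
  assumes "0 < d" "0 < p" "q < 2 * d"
  obtains C where "C > 0"
    "\<And>z. p \<le> Re z \<Longrightarrow> Re z \<le> q \<Longrightarrow> (norm (csc_kernel d z))\<^sup>2 \<le> C / (1 + (Im z)\<^sup>2)"
proof -
  define s where "s = pi / (2 * d)"
  have s: "s > 0"
    using assms by (simp add: s_def)
  have "\<exists>m>0. \<forall>x\<in>{p..q}. m \<le> (sin (s * x))\<^sup>2"
  proof (cases "p \<le> q")
    case True
    have "continuous_on {p..q} (\<lambda>x. (sin (s * x))\<^sup>2)"
      by (intro continuous_intros)
    then obtain x0 where x0: "x0 \<in> {p..q}" "\<forall>x\<in>{p..q}. (sin (s * x0))\<^sup>2 \<le> (sin (s * x))\<^sup>2"
      using continuous_attains_inf[of "{p..q}" "\<lambda>x. (sin (s * x))\<^sup>2"] True by auto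
    have "0 < s * x0" "s * x0 < pi"
      using x0 assms s by (auto simp: s_def field_simps)
    then have "sin (s * x0) > 0"
      by (rule sin_gt_zero)
    then show ?thesis
      using x0 by (intro exI[of _ "(sin (s * x0))\<^sup>2"]) auto
  qed (auto intro: exI[of _ 1])
  then obtain m where m: "m > 0" "\<And>x. p \<le> x \<Longrightarrow> x \<le> q \<Longrightarrow> m \<le> (sin (s * x))\<^sup>2"
    by auto
  define c where "c = min m (s\<^sup>2 / 2)"
  have c: "c > 0"
    using m s by (simp add: c_def)
  show ?thesis
  proof
    show "1 / (16 * d\<^sup>2 * c) > 0"
      using c assms by simp
    fix z :: complex assume z: "p \<le> Re z" "Re z \<le> q"
    let ?S = "sin (of_real s * z)"
    have "c * (1 + (Im z)\<^sup>2) \<le> m + s\<^sup>2 / 2 * (Im z)\<^sup>2"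
      unfolding distrib_left c_def by (intro add_mono mult_right_mono) auto
    also have "\<dots> \<le> (sin (s * Re z))\<^sup>2 + (s * Im z)\<^sup>2 / 2"
      using m(2)[OF z] by (simp add: power_mult_distrib)
    also have "\<dots> \<le> (norm ?S)\<^sup>2"
      using norm_sin_squared_ge[of "of_real s * z"] by simp
    finally have le: "c * (1 + (Im z)\<^sup>2) \<le> (norm ?S)\<^sup>2" .
    have pos: "c * (1 + (Im z)\<^sup>2) > 0"
      using c by (intro mult_pos_pos) (auto intro: add_pos_nonneg)
    have "(norm (csc_kernel d z))\<^sup>2 = 1 / (16 * d\<^sup>2 * (norm ?S)\<^sup>2)"
      by (simp add: csc_kernel_def s_def norm_divide norm_mult power_divide power_mult_distrib)
    also have "\<dots> \<le> 1 / (16 * d\<^sup>2 * (c * (1 + (Im z)\<^sup>2)))"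
      using le pos assms by (intro frac_le mult_left_mono) (auto simp del: mult_pos_pos simp: zero_less_mult_iff[of "16 * _"])
    finally show "(norm (csc_kernel d z))\<^sup>2 \<le> 1 / (16 * d\<^sup>2 * c) / (1 + (Im z)\<^sup>2)"
      by (simp add: mult.assoc)
  qed
qed

lemma norm_csc_kernel_le:
  assumes "0 < d" "Im z \<noteq> 0"
  shows "norm (csc_kernel d z) \<le> 1 / \<bar>Im z\<bar>"
proof -
  define s where "s = pi / (2 * d)"
  have s: "s > 0"
    using assms by (simp add: s_def)
  let ?S = "sin (of_real s * z)"
  have "(s * Im z)\<^sup>2 / 2 \<le> (norm ?S)\<^sup>2"
  proof -
    have "(s * Im z)\<^sup>2 / 2 \<le> (sin (s * Re z))\<^sup>2 + (s * Im z)\<^sup>2 / 2"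
      by simp
    also have "\<dots> \<le> (norm ?S)\<^sup>2"
      using norm_sin_squared_ge[of "of_real s * z"] by simp
    finally show ?thesis .
  qed
  then have "(s * \<bar>Im z\<bar>)\<^sup>2 \<le> (2 * norm ?S)\<^sup>2"
  proof -
    have "0 \<le> (norm ?S)\<^sup>2" "(2 * norm ?S)\<^sup>2 = 4 * (norm ?S)\<^sup>2"
      "(s * \<bar>Im z\<bar>)\<^sup>2 = (s * Im z)\<^sup>2"
      by (simp_all add: power_mult_distrib)
    with \<open>(s * Im z)\<^sup>2 / 2 \<le> (norm ?S)\<^sup>2\<close> show ?thesis
      by linarith
  qed
  then have le: "s * \<bar>Im z\<bar> \<le> 2 * norm ?S"
    by (rule power2_le_imp_le) simp
  then have pos: "norm ?S > 0"
    using s assms by (smt (verit) mult_pos_pos zero_less_abs_iff)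
  have "\<bar>Im z\<bar> \<le> pi * \<bar>Im z\<bar>"
    using pi_ge_two by (simp add: mult_le_cancel_right1)
  also have "\<dots> = 2 * d * (s * \<bar>Im z\<bar>)"
    using assms by (simp add: s_def)
  also have "\<dots> \<le> 2 * d * (2 * norm ?S)"
    using le assms by (intro mult_left_mono) auto
  finally have "\<bar>Im z\<bar> \<le> 4 * d * norm ?S"
    by simp
  then have "1 / (4 * d * norm ?S) \<le> 1 / \<bar>Im z\<bar>"
    using assms pos by (intro divide_left_mono) auto
  then show ?thesis
    using assms by (simp add: csc_kernel_def s_def norm_divide norm_mult)
qed

section \<open>Square integrable functions on a line\<close>

lemma integrable_cauchy_density: "integrable lborel (\<lambda>v. C / (1 + (v - b)\<^sup>2) :: real)"
proof -
  have "integrable lborel (\<lambda>x::real. inverse (1 + x\<^sup>2))"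
    using integrable_inverse_1_plus_square
    by (simp add: set_integrable_def einterval_def)
  then have "integrable lborel (\<lambda>x::real. inverse (1 + (- b + 1 * x)\<^sup>2))"
    by (rule lborel_integrable_real_affine) simp
  then have "integrable lborel (\<lambda>x::real. C * inverse (1 + (- b + 1 * x)\<^sup>2))"
    by (rule integrable_mult_right)
  then show ?thesis
    by (simp add: divide_inverse)
qed

lemma integrable_square_diff:
  fixes f g :: "real \<Rightarrow> 'a::{banach, second_countable_topology}"
  assumes [measurable]: "f \<in> borel_measurable lborel" "g \<in> borel_measurable lborel"
    and f: "integrable lborel (\<lambda>v. (norm (f v))\<^sup>2)" and g: "integrable lborel (\<lambda>v. (norm (g v))\<^sup>2)"
  shows "integrable lborel (\<lambda>v. (norm (f v - g v))\<^sup>2)"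
proof (rule Bochner_Integration.integrable_bound)
  show "integrable lborel (\<lambda>v. 2 * (norm (f v))\<^sup>2 + 2 * (norm (g v))\<^sup>2)"
    using f g by simp
  have "(norm (f v - g v))\<^sup>2 \<le> 2 * (norm (f v))\<^sup>2 + 2 * (norm (g v))\<^sup>2" for v
  proof -
    have "(norm (f v - g v))\<^sup>2 \<le> (norm (f v) + norm (g v))\<^sup>2"
      by (intro power_mono norm_triangle_ineq4) simp
    also have "\<dots> \<le> 2 * (norm (f v))\<^sup>2 + 2 * (norm (g v))\<^sup>2"
      using sum_squares_bound[of "norm (f v)" "norm (g v)"] by (simp add: power2_sum)
    finally show ?thesis .
  qed
  then show "AE v in lborel. norm ((norm (f v - g v))\<^sup>2) \<le>
      norm (2 * (norm (f v))\<^sup>2 + 2 * (norm (g v))\<^sup>2)"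
    by (auto intro!: AE_I2)
qed measurable

lemma mult_le_half_squares: "(a::real) * b \<le> (a\<^sup>2 + b\<^sup>2) / 2"
  using sum_squares_bound[of a b] by simp

lemma integrable_L2_product:
  fixes f g :: "real \<Rightarrow> complex"
  assumes [measurable]: "f \<in> borel_measurable lborel" "g \<in> borel_measurable lborel"
    and f: "integrable lborel (\<lambda>v. (norm (f v))\<^sup>2)" and g: "integrable lborel (\<lambda>v. (norm (g v))\<^sup>2)"
  shows "integrable lborel (\<lambda>v. f v * g v)"
proof (rule Bochner_Integration.integrable_bound)
  show "integrable lborel (\<lambda>v. ((norm (f v))\<^sup>2 + (norm (g v))\<^sup>2) / 2)"
    using f g by simp
  show "AE v in lborel. norm (f v * g v) \<le> norm (((norm (f v))\<^sup>2 + (norm (g v))\<^sup>2) / 2)"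
    using mult_le_half_squares by (intro AE_I2) (simp add: norm_mult)
qed measurable

lemma integrable_dominated_square:
  fixes c :: "real \<Rightarrow> 'a::{banach, second_countable_topology}"
  assumes [measurable]: "c \<in> borel_measurable lborel" and "integrable lborel D"
    and "\<And>v. (norm (c v))\<^sup>2 \<le> D v"
  shows "integrable lborel (\<lambda>v. (norm (c v))\<^sup>2)"
  by (rule Bochner_Integration.integrable_bound[OF assms(2)])
     (use assms(3) in \<open>auto intro!: AE_I2 order_trans[OF _ abs_ge_self]\<close>)

text \<open>Continuity of the pairing of \<open>L\<^sup>2\<close> functions when one factor converges in norm and the other one
converges pointwise under an \<open>L\<^sup>2\<close> majorant.\<close>

lemma L2_pairing_tendsto:
  fixes c h :: "nat \<Rightarrow> real \<Rightarrow> complex" and c0 h0 :: "real \<Rightarrow> complex"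
  assumes [measurable]: "\<And>n. c n \<in> borel_measurable lborel" "c0 \<in> borel_measurable lborel"
      "\<And>n. h n \<in> borel_measurable lborel" "h0 \<in> borel_measurable lborel"
    and D: "integrable lborel D" "\<And>n v. (norm (c n v))\<^sup>2 \<le> D v"
    and c: "\<And>v. (\<lambda>n. c n v) \<longlonglongrightarrow> c0 v"
    and h: "\<And>n. integrable lborel (\<lambda>v. (norm (h n v))\<^sup>2)"
    and h0: "integrable lborel (\<lambda>v. (norm (h0 v))\<^sup>2)"
    and lim: "(\<lambda>n. LINT v|lborel. (norm (h n v - h0 v))\<^sup>2) \<longlonglongrightarrow> 0"
  shows "(\<lambda>n. LINT v|lborel. c n v * h n v) \<longlonglongrightarrow> (LINT v|lborel. c0 v * h0 v)"
proof -
  define e where "e = (\<lambda>n. LINT v|lborel. (norm (h n v - h0 v))\<^sup>2)"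
  have e0: "e n \<ge> 0" for n
    unfolding e_def by (rule integral_nonneg_AE) simp
  define M where "M = (LINT v|lborel. D v)"
  have hd: "integrable lborel (\<lambda>v. (norm (h n v - h0 v))\<^sup>2)" for n
    by (intro integrable_square_diff h h0) measurable
  have c2: "integrable lborel (\<lambda>v. (norm (c n v))\<^sup>2)" for n
    by (rule integrable_dominated_square[OF _ D]) measurable
  have split: "(LINT v|lborel. c n v * h n v) =
      (LINT v|lborel. c n v * (h n v - h0 v)) + (LINT v|lborel. c n v * h0 v)" for n
  proof -
    have "integrable lborel (\<lambda>v. c n v * (h n v - h0 v))" "integrable lborel (\<lambda>v. c n v * h0 v)"
      by (intro integrable_L2_product c2 hd h0; measurable)+
    then show ?thesis
      by (subst Bochner_Integration.integral_add[symmetric]) (simp_all add: algebra_simps)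
  qed
  have "(\<lambda>n. LINT v|lborel. c n v * (h n v - h0 v)) \<longlonglongrightarrow> 0"
  proof (rule Lim_null_comparison)
    \<comment> \<open>The weight in \<open>2ab \<le> \<delta>a\<^sup>2 + b\<^sup>2/\<delta>\<close>, close to the \<open>L\<^sup>2\<close> distance; the term \<open>1/(n+1)\<close> keeps it positive.\<close>
    define \<delta> where "\<delta> = (\<lambda>n. sqrt (e n + 1 / (real n + 1)))"
    have \<delta>: "\<delta> n > 0" for n
      using e0[of n] by (auto simp: \<delta>_def intro!: add_nonneg_pos)
    have \<delta>2: "(\<delta> n)\<^sup>2 = e n + 1 / (real n + 1)" for n
      using e0[of n] by (simp add: \<delta>_def)
    show "\<forall>\<^sub>F n in sequentially. norm (LINT v|lborel. c n v * (h n v - h0 v)) \<le> (M * \<delta> n + \<delta> n) / 2"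
    proof (rule always_eventually, rule allI)
      fix n
      have "norm (LINT v|lborel. c n v * (h n v - h0 v)) \<le>
          (LINT v|lborel. (\<delta> n * D v + (norm (h n v - h0 v))\<^sup>2 / \<delta> n) / 2)"
      proof (rule order_trans[OF integral_norm_bound integral_mono])
        show "integrable lborel (\<lambda>v. norm (c n v * (h n v - h0 v)))"
          by (intro integrable_norm integrable_L2_product c2 hd; measurable)
        show "integrable lborel (\<lambda>v. (\<delta> n * D v + (norm (h n v - h0 v))\<^sup>2 / \<delta> n) / 2)"
          using hd D by simp
        fix v
        define s where "s = sqrt (\<delta> n)"
        have s: "s > 0" "s\<^sup>2 = \<delta> n"
          using \<delta>[of n] by (simp_all add: s_def)
        have "norm (c n v * (h n v - h0 v)) = (s * norm (c n v)) * (norm (h n v - h0 v) / s)"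
          using s by (simp add: norm_mult)
        also have "\<dots> \<le> ((s * norm (c n v))\<^sup>2 + (norm (h n v - h0 v) / s)\<^sup>2) / 2"
          by (rule mult_le_half_squares)
        also have "\<dots> = (\<delta> n * (norm (c n v))\<^sup>2 + (norm (h n v - h0 v))\<^sup>2 / \<delta> n) / 2"
          by (simp add: power_mult_distrib power_divide s)
        also have "\<dots> \<le> (\<delta> n * D v + (norm (h n v - h0 v))\<^sup>2 / \<delta> n) / 2"
          using D(2)[of n v] \<delta>[of n] by (simp add: mult_left_mono less_imp_le)
        finally show "norm (c n v * (h n v - h0 v)) \<le>
            (\<delta> n * D v + (norm (h n v - h0 v))\<^sup>2 / \<delta> n) / 2" .
      qed
      also have "\<dots> = (\<delta> n * M + e n / \<delta> n) / 2"
        using D(1) hd by (simp add: M_def e_def)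
      also have "\<dots> \<le> (M * \<delta> n + \<delta> n) / 2"
      proof -
        have "e n \<le> \<delta> n * \<delta> n"
          using \<delta>2[of n] by (simp add: power2_eq_square)
        then have "e n / \<delta> n \<le> \<delta> n"
          using \<delta>[of n] by (simp add: divide_le_eq)
        then show ?thesis
          by (intro divide_right_mono add_mono) (auto simp: mult.commute)
      qed
      finally show "norm (LINT v|lborel. c n v * (h n v - h0 v)) \<le> (M * \<delta> n + \<delta> n) / 2" .
    qed
    have "(\<lambda>n. 1 / (real n + 1)) \<longlonglongrightarrow> 0"
      using LIMSEQ_inverse_real_of_nat by (simp add: inverse_eq_divide add.commute)
    then have "\<delta> \<longlonglongrightarrow> sqrt (0 + 0)"
      unfolding \<delta>_def e_def by (intro tendsto_intros lim)
    then have "(\<lambda>n. (M * \<delta> n + \<delta> n) / 2) \<longlonglongrightarrow> (M * sqrt (0 + 0) + sqrt (0 + 0)) / 2"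
      by (intro tendsto_intros) auto
    then show "(\<lambda>n. (M * \<delta> n + \<delta> n) / 2) \<longlonglongrightarrow> 0"
      by simp
  qed
  moreover have "(\<lambda>n. LINT v|lborel. c n v * h0 v) \<longlonglongrightarrow> (LINT v|lborel. c0 v * h0 v)"
  proof (rule integral_dominated_convergence)
    show "integrable lborel (\<lambda>v. (D v + (norm (h0 v))\<^sup>2) / 2)"
      using D h0 by simp
    show "AE v in lborel. (\<lambda>n. c n v * h0 v) \<longlonglongrightarrow> c0 v * h0 v"
      by (intro AE_I2 tendsto_intros c)
    show "AE v in lborel. norm (c n v * h0 v) \<le> (D v + (norm (h0 v))\<^sup>2) / 2" for n
    proof (rule AE_I2)
      fix v
      have "norm (c n v) * norm (h0 v) \<le> ((norm (c n v))\<^sup>2 + (norm (h0 v))\<^sup>2) / 2"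
        by (rule mult_le_half_squares)
      then show "norm (c n v * h0 v) \<le> (D v + (norm (h0 v))\<^sup>2) / 2"
        using D(2)[of n v] by (simp add: norm_mult)
    qed
  qed measurable
  ultimately have "(\<lambda>n. (LINT v|lborel. c n v * (h n v - h0 v)) + (LINT v|lborel. c n v * h0 v))
      \<longlonglongrightarrow> 0 + (LINT v|lborel. c0 v * h0 v)"
    by (rule tendsto_add)
  then show ?thesis
    by (simp add: split)
qed

section \<open>Cauchy's formula with the cosecant kernel\<close>

lemma has_contour_integral_linepath_same_Im:
  assumes "a < b" and f: "(f has_contour_integral I) (linepath (Complex a t) (Complex b t))"
  shows "((\<lambda>u. f (Complex u t)) has_integral I) {a..b}"
proof -
  have "((\<lambda>x. f (Complex (a + (b - a) * x) t) * of_real (b - a)) has_integral I) {0..1}"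
  proof -
    have "linepath (Complex a t) (Complex b t) x = Complex (a + (b - a) * x) t" for x
      by (simp add: linepath_def complex_eq_iff algebra_simps)
    moreover have "Complex b t - Complex a t = of_real (b - a)"
      by (simp add: complex_eq_iff)
    ultimately show ?thesis
      using f unfolding has_contour_integral_linepath by simp
  qed
  define m where "m = b - a"
  have m: "m > 0"
    using assms(1) by (simp add: m_def)
  have "((\<lambda>x. f (Complex (m * x + a) t) * of_real m) has_integral I) (cbox 0 1)"
    using \<open>((\<lambda>x. f (Complex (a + (b - a) * x) t) * of_real (b - a)) has_integral I) {0..1}\<close>
    by (simp add: m_def add.commute)
  have e: "m * (a * inverse m) = a"
    using m by simp
  note has_int = \<open>((\<lambda>x. f (Complex (m * x + a) t) * of_real m) has_integral I) (cbox 0 1)\<close>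
  from has_integral_affinity[OF has_int, of "inverse m" "- a * inverse m"] m
  have "((\<lambda>x. f (Complex (m * (inverse m * x + - a * inverse m) + a) t) * of_real m) has_integral m *\<^sub>R I)
      ((\<lambda>x. m * x + a) ` {0..1})"
    by (simp add: divide_inverse mult.commute e)
  moreover have "m * (inverse m * x + - a * inverse m) + a = x" for x
    using m by (simp add: field_simps)
  moreover have "(\<lambda>x. m * x + a) ` {0..1} = {a..b}"
    using m image_affinity_atLeastAtMost[of m a 0 1] by (simp add: m_def)
  ultimately have "((\<lambda>x. f (Complex x t) * of_real m) has_integral I * of_real m) {a..b}"
    by (simp add: scaleR_conv_of_real mult.commute)
  moreover have "of_real m \<noteq> (0 :: complex)"
    using m by simp
  ultimately show ?thesis
    using has_integral_mult_left[of _ "I * of_real m" "{a..b}" "inverse (of_real m)"]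
    by (fastforce simp: mult.assoc)
qed

lemma csc_kernel_sin_nonzero:
  assumes "0 < d" "\<bar>Re z\<bar> < 2 * d" "z \<noteq> 0"
  shows "sin (of_real (pi / (2 * d)) * z) \<noteq> 0"
proof (cases "Re z = 0")
  case False
  then consider "0 < Re z" | "0 < Re (- z)"
    by fastforce
  then show ?thesis
  proof cases
    case 1
    then show ?thesis
      using sin_strip_nonzero[of d z] assms by simp
  next
    case 2
    then show ?thesis
      using sin_strip_nonzero[of d "- z"] assms by simp
  qed
next
  case True
  then have "Im z \<noteq> 0"
    using assms(3) by (simp add: complex_eq_iff)
  then have "(Im (of_real (pi / (2 * d)) * z))\<^sup>2 > 0"
    using assms(1) by simp
  then show ?thesis
    using norm_sin_squared_ge[of "of_real (pi / (2 * d)) * z"]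
    by (smt (verit) half_gt_zero_iff norm_zero power_zero_numeral zero_le_power2)
qed

text \<open>In the difference \<open>w - x\<close> of two points of the strip the kernel has just one pole, at \<open>w = x\<close>, with
residue \<open>1 / (2\<pi>)\<close>. Dividing out the zero of the sine turns the claim into the ordinary Cauchy
formula.\<close>

lemma csc_cauchy_rectangle:
  assumes d: "0 < d" and hol: "h holomorphic_on {z. 0 < Re z \<and> Re z < d}"
    and u: "0 < u1" "u1 < Re x" "Re x < u2" "u2 < d" and R: "\<bar>Im x\<bar> < R"
  shows "((\<lambda>w. csc_kernel d (w - x) * h w) has_contour_integral (\<i> * h x))
           (rectpath (Complex u1 (- R)) (Complex u2 R))"
proof -
  let ?S = "{z. 0 < Re z \<and> Re z < d}"
  define s where "s = complex_of_real (pi / (2 * d))"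
  have s: "s \<noteq> 0" "4 * of_real d * s = 2 * of_real pi"
    using d by (simp_all add: s_def)
  define sn where "sn = (\<lambda>w. sin (s * (w - x)))"
  define q where "q = (\<lambda>w. if w = x then deriv sn x else (sn w - sn x) / (w - x))"
  define Q where "Q = (\<lambda>w. h w / (4 * of_real d * q w))"
  have der: "deriv sn x = s"
    unfolding sn_def by (rule DERIV_imp_deriv) (auto intro!: derivative_eq_intros)
  have sn0: "sn x = 0"
    by (simp add: sn_def)
  have "sn holomorphic_on ?S"
    unfolding sn_def by (intro holomorphic_intros)
  then have q_hol: "q holomorphic_on ?S"
    unfolding q_def by (rule pole_lemma_open[OF _ open_complex_strip])
  have q_nz: "q w \<noteq> 0" if "w \<in> ?S" for w
  proof (cases "w = x")
    case False
    then have "sn w \<noteq> 0"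
      unfolding sn_def s_def using d that u by (intro csc_kernel_sin_nonzero) auto
    then show ?thesis
      using False by (simp add: q_def sn0)
  qed (simp add: q_def der s)
  have Q_hol: "Q holomorphic_on ?S"
    unfolding Q_def using q_nz d by (intro holomorphic_intros hol q_hol) auto
  have img: "path_image (rectpath (Complex u1 (- R)) (Complex u2 R)) \<subseteq> ?S - {x}"
    using u R by (subst path_image_rectpath) auto
  have wn: "winding_number (rectpath (Complex u1 (- R)) (Complex u2 R)) x = 1"
    using u R by (intro winding_number_rectpath) (auto simp: in_box_complex_iff)
  have "x \<in> interior ?S"
    using u by (simp add: interior_open[OF open_complex_strip])
  from Cauchy_integral_formula_convex_simple[OF convex_complex_strip Q_hol this _ img]
  have "((\<lambda>w. Q w / (w - x)) has_contour_integral (2 * pi * \<i> * 1 * Q x))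
      (rectpath (Complex u1 (- R)) (Complex u2 R))"
    by (simp add: wn)
  moreover have "2 * pi * \<i> * 1 * Q x = \<i> * h x"
    by (simp add: Q_def q_def der s)
  ultimately have "((\<lambda>w. Q w / (w - x)) has_contour_integral (\<i> * h x))
      (rectpath (Complex u1 (- R)) (Complex u2 R))"
    by (simp only:)
  then show ?thesis
  proof (rule has_contour_integral_eq)
    fix w assume "w \<in> path_image (rectpath (Complex u1 (- R)) (Complex u2 R))"
    then have "w \<noteq> x"
      using img by auto
    then show "Q w / (w - x) = csc_kernel d (w - x) * h w"
      by (simp add: Q_def q_def sn0 csc_kernel_def sn_def s_def)
  qed
qed

lemma csc_cauchy_edges:
  assumes d: "0 < d" and hol: "h holomorphic_on {z. 0 < Re z \<and> Re z < d}"
    and u: "0 < u1" "u1 < Re x" "Re x < u2" "u2 < d" and R: "\<bar>Im x\<bar> < R"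
  defines "k \<equiv> \<lambda>w. csc_kernel d (w - x) * h w"
  shows "\<i> * h x = integral {u1..u2} (\<lambda>u. k (Complex u (- R)))
      + \<i> * integral {- R..R} (\<lambda>v. k (Complex u2 v))
      - integral {u1..u2} (\<lambda>u. k (Complex u R))
      - \<i> * integral {- R..R} (\<lambda>v. k (Complex u1 v))"
proof -
  let ?S = "{z. 0 < Re z \<and> Re z < d}"
  let ?a1 = "Complex u1 (- R)" let ?a2 = "Complex u2 (- R)"
  let ?a3 = "Complex u2 R" let ?a4 = "Complex u1 R"
  let ?P = "{z. Re z \<in> {u1, u2} \<and> Im z \<in> {- R..R}} \<union> {z. Im z \<in> {- R, R} \<and> Re z \<in> {u1..u2}}"
  have cont: "continuous_on ?P k"
  proof -
    have "?P \<subseteq> ?S"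
      using u by auto
    then have "continuous_on ?P h"
      using holomorphic_on_imp_continuous_on[OF hol] continuous_on_subset by blast
    moreover have "sin (of_real (pi / (2 * d)) * (w - x)) \<noteq> 0" if "w \<in> ?P" for w
      using that u R d by (intro csc_kernel_sin_nonzero) auto
    ultimately show ?thesis
      unfolding k_def csc_kernel_def using d by (intro continuous_intros) auto
  qed
  have seg: "closed_segment ?a1 ?a2 \<subseteq> ?P" "closed_segment ?a2 ?a3 \<subseteq> ?P"
    "closed_segment ?a4 ?a3 \<subseteq> ?P" "closed_segment ?a1 ?a4 \<subseteq> ?P"
    using u R by (auto simp: closed_segment_same_Re closed_segment_same_Im closed_segment_eq_real_ivl)
  have ex: "\<exists>I. (k has_contour_integral I) (linepath a b)" if "closed_segment a b \<subseteq> ?P" for a b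
    using contour_integrable_continuous_linepath[OF continuous_on_subset[OF cont that]]
    by (simp add: contour_integrable_on_def)
  obtain B where B: "(k has_contour_integral B) (linepath ?a1 ?a2)"
    using ex[OF seg(1)] ..
  obtain V2 where V2: "(k has_contour_integral V2) (linepath ?a2 ?a3)"
    using ex[OF seg(2)] ..
  obtain T where T: "(k has_contour_integral T) (linepath ?a4 ?a3)"
    using ex[OF seg(3)] ..
  obtain V1 where V1: "(k has_contour_integral V1) (linepath ?a1 ?a4)"
    using ex[OF seg(4)] ..
  have "(k has_contour_integral (B + (V2 + (- T + - V1)))) (rectpath ?a1 ?a3)"
    unfolding rectpath_def Let_def complex.sel
    by (intro has_contour_integral_join B V2 has_contour_integral_reverse_linepath T V1
        valid_path_join valid_path_linepath) auto
  with csc_cauchy_rectangle[OF d hol u R] have sum: "\<i> * h x = B + (V2 + (- T + - V1))"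
    unfolding k_def by (rule has_contour_integral_unique)
  have "integral {u1..u2} (\<lambda>u. k (Complex u (- R))) = B"
    using has_contour_integral_linepath_same_Im[OF _ B] u by (simp add: integral_unique)
  moreover have "integral {u1..u2} (\<lambda>u. k (Complex u R)) = T"
    using has_contour_integral_linepath_same_Im[OF _ T] u by (simp add: integral_unique)
  moreover have "integral {- R..R} (\<lambda>v. k (Complex u2 v)) = - \<i> * V2"
    using V2 R by (subst (asm) has_contour_integral_linepath_same_Re_iff[of _ u2 _ "- R" R])
       (auto simp: integral_unique)
  moreover have "integral {- R..R} (\<lambda>v. k (Complex u1 v)) = - \<i> * V1"
    using V1 R by (subst (asm) has_contour_integral_linepath_same_Re_iff[of _ u1 _ "- R" R])
       (auto simp: integral_unique)
  ultimately show ?thesis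
    by (simp add: sum)
qed

lemma continuous_on_Complex_horizontal: "continuous_on A (\<lambda>u. Complex u t)"
  unfolding Complex_eq by (intro continuous_intros)

lemma continuous_on_Complex_vertical: "continuous_on A (\<lambda>v. Complex u v)"
  unfolding Complex_eq by (intro continuous_intros)

lemma csc_horizontal_edge_bound:
  assumes d: "0 < d" and hol: "h holomorphic_on {z. 0 < Re z \<and> Re z < d}"
    and u: "0 < u1" "u1 < Re x" "Re x < u2" "u2 < d" and t: "t \<noteq> Im x"
  shows "norm (integral {u1..u2} (\<lambda>u. csc_kernel d (Complex u t - x) * h (Complex u t)))
    \<le> (u2 - u1 + integral {u1..u2} (\<lambda>u. (norm (h (Complex u t)))\<^sup>2)) / \<bar>t - Im x\<bar>"
proof -
  let ?S = "{z. 0 < Re z \<and> Re z < d}"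
  have sub: "(\<lambda>u. Complex u t) ` {u1..u2} \<subseteq> ?S"
    using u by auto
  have ch: "continuous_on {u1..u2} (\<lambda>u. h (Complex u t))"
    using continuous_on_compose2[OF holomorphic_on_imp_continuous_on[OF hol]
        continuous_on_Complex_horizontal sub] .
  have ck: "continuous_on {u1..u2} (\<lambda>u. csc_kernel d (Complex u t - x) * h (Complex u t))"
  proof -
    have "sin (of_real (pi / (2 * d)) * (Complex u t - x)) \<noteq> 0" if "u \<in> {u1..u2}" for u
      using that u t d by (intro csc_kernel_sin_nonzero) (auto simp: complex_eq_iff)
    then show ?thesis
      unfolding csc_kernel_def using d
      by (intro continuous_intros ch continuous_on_Complex_horizontal) auto
  qed
  have i1: "(\<lambda>u. (norm (h (Complex u t)))\<^sup>2) integrable_on {u1..u2}"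
    by (intro integrable_continuous_real continuous_intros ch)
  have "norm (integral {u1..u2} (\<lambda>u. csc_kernel d (Complex u t - x) * h (Complex u t)))
    \<le> integral {u1..u2} (\<lambda>u. (1 + (norm (h (Complex u t)))\<^sup>2) / \<bar>t - Im x\<bar>)"
  proof (rule integral_norm_bound_integral)
    show "(\<lambda>u. csc_kernel d (Complex u t - x) * h (Complex u t)) integrable_on {u1..u2}"
      by (rule integrable_continuous_real[OF ck])
    show "(\<lambda>u. (1 + (norm (h (Complex u t)))\<^sup>2) / \<bar>t - Im x\<bar>) integrable_on {u1..u2}"
      using t by (intro integrable_continuous_real continuous_intros ch) auto
    fix u
    let ?n = "norm (h (Complex u t))"
    have "?n \<le> 1 + ?n\<^sup>2"
    proof -
      have "n \<le> 1 + n\<^sup>2" for n :: real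
      proof (cases "n \<le> 1")
        case True
        then show ?thesis
          by (rule order_trans) simp
      next
        case False
        then have "n \<le> n\<^sup>2"
          by (simp add: power2_eq_square)
        then show ?thesis
          by simp
      qed
      then show ?thesis .
    qed
    moreover have "norm (csc_kernel d (Complex u t - x)) \<le> 1 / \<bar>t - Im x\<bar>"
      using norm_csc_kernel_le[OF d, of "Complex u t - x"] t by simp
    ultimately have "norm (csc_kernel d (Complex u t - x)) * ?n \<le> 1 / \<bar>t - Im x\<bar> * (1 + ?n\<^sup>2)"
      by (intro mult_mono) auto
    then show "norm (csc_kernel d (Complex u t - x) * h (Complex u t)) \<le> (1 + ?n\<^sup>2) / \<bar>t - Im x\<bar>"
      by (simp add: norm_mult)
  qed
  also have "\<dots> = (u2 - u1 + integral {u1..u2} (\<lambda>u. (norm (h (Complex u t)))\<^sup>2)) / \<bar>t - Im x\<bar>"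
    using i1 u by (simp add: Henstock_Kurzweil_Integration.integral_add integrable_const_ivl)
  finally show ?thesis .
qed

lemma integral_interval_le_LINT:
  fixes f :: "real \<Rightarrow> real"
  assumes f: "integrable lborel f" and nn: "\<And>v. f v \<ge> 0"
  shows "integral {a..b} f \<le> (LINT v|lborel. f v)"
proof -
  have set: "set_integrable lborel {a..b} f"
    unfolding set_integrable_def by (rule integrable_mult_indicator[OF _ f]) simp
  then have "integral {a..b} f = (LINT v:{a..b}|lborel. f v)"
    by (simp add: set_borel_integral_eq_integral)
  also have "\<dots> \<le> (LINT v|lborel. f v)"
    unfolding set_lebesgue_integral_def
    using set f nn by (intro integral_mono) (auto simp: set_integrable_def indicator_def)
  finally show ?thesis .
qed

lemma integral_symmetric_interval_tendsto:
  fixes f :: "real \<Rightarrow> complex"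
  assumes f: "integrable lborel f" and R: "filterlim R at_top sequentially"
  shows "(\<lambda>n. integral {- R n..R n} f) \<longlonglongrightarrow> (LINT v|lborel. f v)"
proof -
  have "integral {- R n..R n} f = (LINT v|lborel. indicat_real {- R n..R n} v *\<^sub>R f v)" for n
  proof -
    have "set_integrable lborel {- R n..R n} f"
      unfolding set_integrable_def by (rule integrable_mult_indicator[OF _ f]) simp
    then show ?thesis
      by (simp add: set_borel_integral_eq_integral flip: set_lebesgue_integral_def)
  qed
  moreover have "(\<lambda>n. LINT v|lborel. indicat_real {- R n..R n} v *\<^sub>R f v) \<longlonglongrightarrow> (LINT v|lborel. f v)"
  proof (rule integral_dominated_convergence)
    show "integrable lborel (\<lambda>v. norm (f v))"
      using f by simp
    show "AE v in lborel. (\<lambda>n. indicat_real {- R n..R n} v *\<^sub>R f v) \<longlonglongrightarrow> f v"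
    proof (rule AE_I2, rule tendsto_eventually)
      fix v
      have "eventually (\<lambda>n. \<bar>v\<bar> \<le> R n) sequentially"
        using R by (simp add: filterlim_at_top)
      then show "eventually (\<lambda>n. indicat_real {- R n..R n} v *\<^sub>R f v = f v) sequentially"
        by eventually_elim (auto simp: indicator_def)
    qed
    show "AE v in lborel. norm (indicat_real {- R n..R n} v *\<^sub>R f v) \<le> norm (f v)" for n
      by (rule AE_I2) (auto simp: indicator_def)
  qed (use f in auto)
  ultimately show ?thesis
    by simp
qed

text \<open>Square integrability on the vertical lines says nothing about single horizontal segments, but by
Fubini the segments of height between \<open>r\<close> and \<open>r + 1\<close> have bounded square integrals on average. So
there are arbitrarily high rectangles with controlled top and bottom edges.\<close>

lemma bounded_mean_height:
  assumes hol: "h holomorphic_on {z. 0 < Re z \<and> Re z < d}"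
    and u: "0 < u1" "u1 < u2" "u2 < d"
    and L2: "\<And>u. 0 < u \<Longrightarrow> u < d \<Longrightarrow> integrable lborel (\<lambda>v. (norm (h (Complex u v)))\<^sup>2)"
    and C: "\<And>u. 0 < u \<Longrightarrow> u < d \<Longrightarrow> (LINT v|lborel. (norm (h (Complex u v)))\<^sup>2) \<le> C"
  shows "\<exists>R\<ge>r. integral {u1..u2} (\<lambda>u. (norm (h (Complex u R)))\<^sup>2) +
           integral {u1..u2} (\<lambda>u. (norm (h (Complex u (- R))))\<^sup>2) \<le> 2 * C * (u2 - u1) + 1"
proof (rule ccontr)
  let ?S = "{z. 0 < Re z \<and> Re z < d}"
  \<comment> \<open>The mean is at most \<open>2C(u2 - u1)\<close>; the summand \<open>1\<close> makes exceeding it everywhere a contradiction.\<close>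
  let ?B = "2 * C * (u2 - u1) + 1"
  define g where "g = (\<lambda>R u. (norm (h (Complex u R)))\<^sup>2 + (norm (h (Complex u (- R))))\<^sup>2)"
  assume "\<not> ?thesis"
  then have big: "?B < integral {u1..u2} (\<lambda>u. (norm (h (Complex u R)))\<^sup>2) +
           integral {u1..u2} (\<lambda>u. (norm (h (Complex u (- R))))\<^sup>2)" if "R \<ge> r" for R
    using that by (meson not_le)
  have hc: "continuous_on A (\<lambda>p. h (f p))" if "continuous_on A f" "f ` A \<subseteq> ?S"
    for A and f :: "'a::topological_space \<Rightarrow> complex"
    using continuous_on_compose2[OF holomorphic_on_imp_continuous_on[OF hol] that] .
  have "continuous_on (cbox (r, u1) (r + 1, u2)) (\<lambda>(R, u). g R u)"
    unfolding g_def case_prod_unfold Complex_eq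
    using u by (intro continuous_intros hc) (auto simp: cbox_Pair_eq)
  note swap = integral_swap_continuous[OF this]
    and int = integral_integrable_2dim[OF this, simplified case_prod_conv]
  have "?B \<le> integral (cbox r (r + 1)) (\<lambda>R. integral (cbox u1 u2) (g R))"
  proof -
    have "integral (cbox r (r + 1)) (\<lambda>R. ?B) \<le> integral (cbox r (r + 1)) (\<lambda>R. integral (cbox u1 u2) (g R))"
    proof (rule integral_le)
      fix R assume "R \<in> cbox r (r + 1)"
      then have "R \<ge> r" by simp
      have "(\<lambda>u. (norm (h (Complex u t)))\<^sup>2) integrable_on {u1..u2}" for t
        unfolding Complex_eq using u by (intro integrable_continuous_real continuous_intros hc) auto
      then have "integral (cbox u1 u2) (g R) = integral {u1..u2} (\<lambda>u. (norm (h (Complex u R)))\<^sup>2) +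
           integral {u1..u2} (\<lambda>u. (norm (h (Complex u (- R))))\<^sup>2)"
        unfolding g_def by (simp add: Henstock_Kurzweil_Integration.integral_add)
      then show "?B \<le> integral (cbox u1 u2) (g R)"
        using big[OF \<open>R \<ge> r\<close>] by simp
    qed (use int in auto)
    then show ?thesis
      by simp
  qed
  also have "\<dots> = integral (cbox u1 u2) (\<lambda>u. integral (cbox r (r + 1)) (\<lambda>R. g R u))"
    by (rule swap)
  also have "\<dots> \<le> integral (cbox u1 u2) (\<lambda>u. 2 * C)"
  proof (rule integral_le)
    have "continuous_on (cbox (u1, r) (u2, r + 1)) (\<lambda>(u, R). g R u)"
      unfolding g_def case_prod_unfold Complex_eq
      using u by (intro continuous_intros hc) (auto simp: cbox_Pair_eq)
    from integral_integrable_2dim[OF this, simplified case_prod_conv]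
    show "(\<lambda>u. integral (cbox r (r + 1)) (\<lambda>R. g R u)) integrable_on cbox u1 u2" .
    fix u assume "u \<in> cbox u1 u2"
    then have uu: "0 < u" "u < d"
      using u by auto
    have i: "integrable lborel (\<lambda>R. (norm (h (Complex u (- R))))\<^sup>2)"
      using lborel_integrable_real_affine[OF L2[OF uu], of "-1" 0] by simp
    have e: "(LINT R|lborel. (norm (h (Complex u (- R))))\<^sup>2) = (LINT R|lborel. (norm (h (Complex u R)))\<^sup>2)"
      using lborel_integral_real_affine[of "-1" "\<lambda>R. (norm (h (Complex u R)))\<^sup>2" 0] by simp
    have "integral {r..r + 1} (\<lambda>R. g R u) \<le> (LINT R|lborel. g R u)"
      unfolding g_def using L2[OF uu] i
      by (intro integral_interval_le_LINT Bochner_Integration.integrable_add) auto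
    also have "\<dots> = (LINT R|lborel. (norm (h (Complex u R)))\<^sup>2) + (LINT R|lborel. (norm (h (Complex u R)))\<^sup>2)"
      unfolding g_def using L2[OF uu] i e by simp
    also have "\<dots> \<le> 2 * C"
      using C[OF uu] by simp
    finally show "integral (cbox r (r + 1)) (\<lambda>R. g R u) \<le> 2 * C"
      by simp
  qed auto
  also have "\<dots> = 2 * C * (u2 - u1)"
    using u by simp
  finally show False
    by simp
qed

lemma csc_line_L2:
  assumes d: "0 < d" and r: "0 < r" "r < 2 * d"
    and g: "continuous_on UNIV g" "\<And>v. Re (g v) = r" "\<And>v. (Im (g v))\<^sup>2 = (v - b)\<^sup>2"
  shows "(\<lambda>v. csc_kernel d (g v)) \<in> borel_measurable lborel"
    "integrable lborel (\<lambda>v. (norm (csc_kernel d (g v)))\<^sup>2)"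
proof -
  have "continuous_on UNIV (\<lambda>v. csc_kernel d (g v))"
    using g r by (intro continuous_on_compose2[OF holomorphic_on_imp_continuous_on[OF
          csc_kernel_holomorphic[OF d]] g(1)]) auto
  then show m: "(\<lambda>v. csc_kernel d (g v)) \<in> borel_measurable lborel"
    by (simp add: borel_measurable_continuous_onI)
  obtain C where "\<And>z. r \<le> Re z \<Longrightarrow> Re z \<le> r \<Longrightarrow> (norm (csc_kernel d z))\<^sup>2 \<le> C / (1 + (Im z)\<^sup>2)"
    using csc_kernel_bound[OF d r] by metis
  then have "(norm (csc_kernel d (g v)))\<^sup>2 \<le> C / (1 + (v - b)\<^sup>2)" for v
    by (metis g(2,3) order_refl)
  then show "integrable lborel (\<lambda>v. (norm (csc_kernel d (g v)))\<^sup>2)"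
    by (rule integrable_dominated_square[OF m integrable_cauchy_density])
qed

text \<open>Along rectangles with the heights of the previous lemmas the horizontal edges contribute \<open>O(1/R)\<close>,
because the kernel decays, and the vertical edges converge to the integrals over the full lines.\<close>

lemma csc_cauchy_formula_interior:
  assumes d: "0 < d" and hol: "h holomorphic_on {z. 0 < Re z \<and> Re z < d}"
    and L2: "\<And>u. 0 < u \<Longrightarrow> u < d \<Longrightarrow> integrable lborel (\<lambda>v. (norm (h (Complex u v)))\<^sup>2)"
    and C: "\<And>u. 0 < u \<Longrightarrow> u < d \<Longrightarrow> (LINT v|lborel. (norm (h (Complex u v)))\<^sup>2) \<le> C"
    and u: "0 < u1" "u1 < Re x" "Re x < u2" "u2 < d"
  shows "h x = (LINT v|lborel. csc_kernel d (x - Complex u1 v) * h (Complex u1 v)) +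
               (LINT v|lborel. csc_kernel d (Complex u2 v - x) * h (Complex u2 v))"
proof -
  let ?S = "{z. 0 < Re z \<and> Re z < d}"
  define k where "k = (\<lambda>w. csc_kernel d (w - x) * h w)"
  define \<Phi> where "\<Phi> = (\<lambda>t. integral {u1..u2} (\<lambda>u. (norm (h (Complex u t)))\<^sup>2))"
  define B where "B = 2 * C * (u2 - u1) + 1"
  define H where "H = (\<lambda>t. integral {u1..u2} (\<lambda>u. k (Complex u t)))"
  have "u1 < u2"
    using u by simp
  \<comment> \<open>The offset \<open>|Im x| + 1\<close> keeps \<open>x\<close> inside and both edges at distance at least \<open>n + 1\<close> from its height.\<close>
  have "\<exists>R. \<forall>n. R n \<ge> real n + \<bar>Im x\<bar> + 1 \<and> \<Phi> (R n) + \<Phi> (- R n) \<le> B"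
    unfolding \<Phi>_def B_def
    using bounded_mean_height[OF hol u(1) \<open>u1 < u2\<close> u(4) L2 C] by (intro choice) blast
  then obtain R where R: "\<And>n. R n \<ge> real n + \<bar>Im x\<bar> + 1" "\<And>n. \<Phi> (R n) + \<Phi> (- R n) \<le> B"
    by blast
  have R_lim: "filterlim R at_top sequentially"
  proof (rule filterlim_at_top_mono[OF filterlim_real_sequentially always_eventually], rule allI)
    show "real n \<le> R n" for n
      using R(1)[of n] by simp
  qed
  have \<Phi>_nn: "\<Phi> t \<ge> 0" for t
    unfolding \<Phi>_def
    by (cases "(\<lambda>u. (norm (h (Complex u t)))\<^sup>2) integrable_on {u1..u2}")
       (auto simp: Henstock_Kurzweil_Integration.integral_nonneg not_integrable_integral)
  have H_lim: "(\<lambda>n. H (t n)) \<longlonglongrightarrow> 0" if t: "\<And>n. t n = R n \<or> t n = - R n" for t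
  proof (rule Lim_null_comparison)
    show "\<forall>\<^sub>F n in sequentially. norm (H (t n)) \<le> (u2 - u1 + B) / (real n + 1)"
    proof (rule always_eventually, rule allI)
      fix n
      have tn: "\<bar>t n - Im x\<bar> \<ge> real n + 1"
        using t[of n] R(1)[of n] by (auto simp: abs_if split: if_splits)
      then have "t n \<noteq> Im x"
        by auto
      then have "norm (H (t n)) \<le> (u2 - u1 + \<Phi> (t n)) / \<bar>t n - Im x\<bar>"
        unfolding H_def k_def \<Phi>_def by (rule csc_horizontal_edge_bound[OF d hol u])
      also have "\<dots> \<le> (u2 - u1 + B) / (real n + 1)"
        using tn R(2)[of n] \<Phi>_nn[of "R n"] \<Phi>_nn[of "- R n"] t[of n] u by (intro frac_le) auto
      finally show "norm (H (t n)) \<le> (u2 - u1 + B) / (real n + 1)" .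
    qed
    have "(\<lambda>n. (u2 - u1 + B) * (1 / (real n + 1))) \<longlonglongrightarrow> (u2 - u1 + B) * 0"
      using LIMSEQ_inverse_real_of_nat
      by (intro tendsto_intros) (simp add: inverse_eq_divide add.commute)
    then show "(\<lambda>n. (u2 - u1 + B) / (real n + 1)) \<longlonglongrightarrow> 0"
      by simp
  qed
  have hm: "(\<lambda>v. h (Complex u v)) \<in> borel_measurable lborel" if "0 < u" "u < d" for u
  proof -
    have "continuous_on UNIV (\<lambda>v. h (Complex u v))"
      using that by (intro continuous_on_compose2[OF holomorphic_on_imp_continuous_on[OF hol]
            continuous_on_Complex_vertical]) auto
    then show ?thesis
      by (simp add: borel_measurable_continuous_onI)
  qed
  have i2: "integrable lborel (\<lambda>v. csc_kernel d (Complex u2 v - x) * h (Complex u2 v))"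
  proof (rule integrable_L2_product)
    have r: "0 < u2 - Re x" "u2 - Re x < 2 * d"
      using u d by auto
    have "continuous_on UNIV (\<lambda>v. Complex u2 v - x)"
      by (intro continuous_intros continuous_on_Complex_vertical)
    note line = csc_line_L2[OF d r this, of "Im x"]
    show "(\<lambda>v. csc_kernel d (Complex u2 v - x)) \<in> borel_measurable lborel"
      "integrable lborel (\<lambda>v. (norm (csc_kernel d (Complex u2 v - x)))\<^sup>2)"
      by (rule line; simp)+
  qed (use u hm L2 in auto)
  have i1: "integrable lborel (\<lambda>v. csc_kernel d (x - Complex u1 v) * h (Complex u1 v))"
  proof (rule integrable_L2_product)
    have r: "0 < Re x - u1" "Re x - u1 < 2 * d"
      using u d by auto
    have "continuous_on UNIV (\<lambda>v. x - Complex u1 v)"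
      by (intro continuous_intros continuous_on_Complex_vertical)
    note line = csc_line_L2[OF d r this, of "Im x"]
    show "(\<lambda>v. csc_kernel d (x - Complex u1 v)) \<in> borel_measurable lborel"
      "integrable lborel (\<lambda>v. (norm (csc_kernel d (x - Complex u1 v)))\<^sup>2)"
      by (rule line; simp add: power2_commute)+
  qed (use u hm L2 in auto)
  have k1: "k (Complex u1 v) = - (csc_kernel d (x - Complex u1 v) * h (Complex u1 v))" for v
    using csc_kernel_minus[of d "x - Complex u1 v"] by (simp add: k_def)
  define V1 where "V1 = (LINT v|lborel. k (Complex u1 v))"
  define V2 where "V2 = (LINT v|lborel. k (Complex u2 v))"
  have eq: "H (- R n) + \<i> * integral {- R n..R n} (\<lambda>v. k (Complex u2 v)) - H (R n)
      - \<i> * integral {- R n..R n} (\<lambda>v. k (Complex u1 v)) = \<i> * h x" for n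
    using csc_cauchy_edges[OF d hol u, of "R n"] R(1)[of n] unfolding k_def H_def by simp
  have int: "integrable lborel (\<lambda>v. k (Complex u1 v))" "integrable lborel (\<lambda>v. k (Complex u2 v))"
    using i2 unfolding k1 by (simp_all add: i1 k_def)
  have "(\<lambda>n. H (- R n) + \<i> * integral {- R n..R n} (\<lambda>v. k (Complex u2 v)) - H (R n)
      - \<i> * integral {- R n..R n} (\<lambda>v. k (Complex u1 v))) \<longlonglongrightarrow> 0 + \<i> * V2 - 0 - \<i> * V1"
    unfolding V1_def V2_def
    by (intro tendsto_add tendsto_diff tendsto_mult_left H_lim
        integral_symmetric_interval_tendsto[OF int(1) R_lim]
        integral_symmetric_interval_tendsto[OF int(2) R_lim]) auto
  then have "(\<lambda>n::nat. \<i> * h x) \<longlonglongrightarrow> 0 + \<i> * V2 - 0 - \<i> * V1"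
    unfolding eq .
  then have "\<i> * h x = 0 + \<i> * V2 - 0 - \<i> * V1"
    by (rule LIMSEQ_unique[OF tendsto_const])
  then have "\<i> * h x = \<i> * (V2 - V1)"
    by (simp add: right_diff_distrib)
  then have "h x = V2 - V1"
    by (subst (asm) mult_cancel_left) simp
  then show ?thesis
    unfolding V1_def V2_def k1 by (simp add: k_def)
qed

lemma csc_kernel_isCont:
  assumes "0 < d" "0 < Re z" "Re z < 2 * d"
  shows "isCont (csc_kernel d) z"
  using holomorphic_on_imp_continuous_on[OF csc_kernel_holomorphic[OF assms(1)]] assms
  by (simp add: continuous_on_eq_continuous_at open_complex_strip)

text \<open>The two lines move to the boundary. The distance of the line from \<open>x\<close> stays bounded below, so the
kernels have a common majorant, while the function converges in \<open>L\<^sup>2\<close>.\<close>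

lemma csc_cauchy_formula_boundary:
  assumes d: "0 < d" and hol: "h holomorphic_on {z. 0 < Re z \<and> Re z < d}"
    and L2: "\<And>u. 0 < u \<Longrightarrow> u < d \<Longrightarrow> integrable lborel (\<lambda>v. (norm (h (Complex u v)))\<^sup>2)"
    and C: "\<And>u. 0 < u \<Longrightarrow> u < d \<Longrightarrow> (LINT v|lborel. (norm (h (Complex u v)))\<^sup>2) \<le> C"
    and h0: "h0 \<in> borel_measurable lborel" "integrable lborel (\<lambda>v. (norm (h0 v))\<^sup>2)"
      "((\<lambda>u. LINT v|lborel. (norm (h (Complex u v) - h0 v))\<^sup>2) \<longlongrightarrow> 0) (at_right 0)"
    and hr: "hr \<in> borel_measurable lborel" "integrable lborel (\<lambda>v. (norm (hr v))\<^sup>2)"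
      "((\<lambda>u. LINT v|lborel. (norm (h (Complex u v) - hr v))\<^sup>2) \<longlongrightarrow> 0) (at_left d)"
    and x: "0 < Re x" "Re x < d"
  shows "h x = (LINT v|lborel. csc_kernel d (x - Complex 0 v) * h0 v) +
               (LINT v|lborel. csc_kernel d (Complex d v - x) * hr v)"
proof -
  let ?a = "Re x"
  \<comment> \<open>The factor \<open>1/(n+2) \<le> 1/2\<close> leaves at least half of the distance between \<open>x\<close> and the boundary.\<close>
  define u1 where "u1 = (\<lambda>n. ?a * inverse (real (Suc (Suc n))))"
  define u2 where "u2 = (\<lambda>n. d - (d - ?a) * inverse (real (Suc (Suc n))))"
  have inv: "0 < inverse (real (Suc (Suc n)))" "inverse (real (Suc (Suc n))) \<le> 1 / 2" for n
    by (auto simp: field_simps)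
  have inv_lim: "(\<lambda>n. inverse (real (Suc (Suc n)))) \<longlonglongrightarrow> 0"
    using LIMSEQ_inverse_real_of_nat by (rule LIMSEQ_Suc)
  have u1: "0 < u1 n" "u1 n \<le> ?a / 2" for n
    using x inv[of n] mult_left_mono[OF inv(2)[of n], of ?a] by (auto simp: u1_def)
  have u2: "d - (d - ?a) / 2 \<le> u2 n" "u2 n < d" for n
    using x inv[of n] mult_left_mono[OF inv(2)[of n], of "d - ?a"] by (auto simp: u2_def)
  have u1_lim: "u1 \<longlonglongrightarrow> 0"
    using tendsto_mult_left[OF inv_lim, of ?a] by (simp add: u1_def)
  have u2_lim: "u2 \<longlonglongrightarrow> d"
    using tendsto_diff[OF tendsto_const[of d] tendsto_mult_left[OF inv_lim, of "d - ?a"]]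
    by (simp add: u2_def)
  have at1: "filterlim u1 (at_right 0) sequentially"
    using u1 u1_lim by (auto simp: filterlim_at intro!: always_eventually less_imp_neq[THEN not_sym])
  have at2: "filterlim u2 (at_left d) sequentially"
    using u2 u2_lim by (auto simp: filterlim_at intro!: always_eventually less_imp_neq)
  have hm: "(\<lambda>v. h (Complex u v)) \<in> borel_measurable lborel" if "0 < u" "u < d" for u
  proof -
    have "continuous_on UNIV (\<lambda>v. h (Complex u v))"
      using that by (intro continuous_on_compose2[OF holomorphic_on_imp_continuous_on[OF hol]
            continuous_on_Complex_vertical]) auto
    then show ?thesis
      by (simp add: borel_measurable_continuous_onI)
  qed
  have km: "(\<lambda>v. csc_kernel d (g v)) \<in> borel_measurable lborel"
    if "continuous_on UNIV g" "\<And>v. 0 < Re (g v) \<and> Re (g v) < 2 * d" for g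
    using that by (simp add: borel_measurable_continuous_onI continuous_on_compose2[OF
          holomorphic_on_imp_continuous_on[OF csc_kernel_holomorphic[OF d]] that(1)] image_subset_iff)
  have Complex_lim: "(\<lambda>n. Complex (u n) v) \<longlonglongrightarrow> Complex l v" if "u \<longlonglongrightarrow> l" for u l v
    unfolding Complex_eq by (intro tendsto_intros that)
  have "(\<lambda>n. LINT v|lborel. csc_kernel d (x - Complex (u1 n) v) * h (Complex (u1 n) v))
      \<longlonglongrightarrow> (LINT v|lborel. csc_kernel d (x - Complex 0 v) * h0 v)"
  proof -
    have "0 < ?a / 2" "?a < 2 * d"
      using x by auto
    then obtain K where K: "\<And>z. ?a / 2 \<le> Re z \<Longrightarrow> Re z \<le> ?a \<Longrightarrow>
        (norm (csc_kernel d z))\<^sup>2 \<le> K / (1 + (Im z)\<^sup>2)"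
      using csc_kernel_bound[OF d] by metis
    show ?thesis
    proof (rule L2_pairing_tendsto[where D = "\<lambda>v. K / (1 + (v - Im x)\<^sup>2)"])
      show "(\<lambda>v. csc_kernel d (x - Complex (u1 n) v)) \<in> borel_measurable lborel"
        "(\<lambda>v. csc_kernel d (x - Complex 0 v)) \<in> borel_measurable lborel" for n
        using x u1[of n] by (auto intro!: km[simplified] continuous_intros continuous_on_Complex_vertical)
      show "(\<lambda>v. h (Complex (u1 n) v)) \<in> borel_measurable lborel" 
        "integrable lborel (\<lambda>v. (norm (h (Complex (u1 n) v)))\<^sup>2)" for n
        using u1[of n] x by (auto intro!: hm[simplified] L2)
      show "(norm (csc_kernel d (x - Complex (u1 n) v)))\<^sup>2 \<le> K / (1 + (v - Im x)\<^sup>2)" for n v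
        using K[of "x - Complex (u1 n) v"] u1[of n] x by (simp add: power2_commute)
      show "(\<lambda>n. csc_kernel d (x - Complex (u1 n) v)) \<longlonglongrightarrow> csc_kernel d (x - Complex 0 v)" for v
        using x d by (intro isCont_tendsto_compose[OF csc_kernel_isCont] tendsto_intros
            Complex_lim u1_lim) auto
      show "(\<lambda>n. LINT v|lborel. (norm (h (Complex (u1 n) v) - h0 v))\<^sup>2) \<longlonglongrightarrow> 0"
        by (rule filterlim_compose[OF h0(3) at1])
    qed (use h0 integrable_cauchy_density in auto)
  qed
  moreover have "(\<lambda>n. LINT v|lborel. csc_kernel d (Complex (u2 n) v - x) * h (Complex (u2 n) v))
      \<longlonglongrightarrow> (LINT v|lborel. csc_kernel d (Complex d v - x) * hr v)"
  proof -
    have "0 < (d - ?a) / 2" "d - ?a < 2 * d"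
      using x by auto
    then obtain K where K: "\<And>z. (d - ?a) / 2 \<le> Re z \<Longrightarrow> Re z \<le> d - ?a \<Longrightarrow>
        (norm (csc_kernel d z))\<^sup>2 \<le> K / (1 + (Im z)\<^sup>2)"
      using csc_kernel_bound[OF d] by metis
    have u2': "0 < u2 n - ?a" "u2 n - ?a < 2 * d" "0 < u2 n" for n
      using u2[of n] x by (auto simp: field_simps)
    show ?thesis
    proof (rule L2_pairing_tendsto[where D = "\<lambda>v. K / (1 + (v - Im x)\<^sup>2)"])
      show "(\<lambda>v. csc_kernel d (Complex (u2 n) v - x)) \<in> borel_measurable lborel"
        "(\<lambda>v. csc_kernel d (Complex d v - x)) \<in> borel_measurable lborel" for n
        using x u2'[of n] by (auto intro!: km[simplified] continuous_intros continuous_on_Complex_vertical)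
      show "(\<lambda>v. h (Complex (u2 n) v)) \<in> borel_measurable lborel" 
        "integrable lborel (\<lambda>v. (norm (h (Complex (u2 n) v)))\<^sup>2)" for n
        using u2[of n] u2'[of n] by (auto intro!: hm[simplified] L2)
      show "(norm (csc_kernel d (Complex (u2 n) v - x)))\<^sup>2 \<le> K / (1 + (v - Im x)\<^sup>2)" for n v
        using K[of "Complex (u2 n) v - x"] u2[of n] x by (simp add: field_simps)
      show "(\<lambda>n. csc_kernel d (Complex (u2 n) v - x)) \<longlonglongrightarrow> csc_kernel d (Complex d v - x)" for v
        using x d by (intro isCont_tendsto_compose[OF csc_kernel_isCont] tendsto_intros
            Complex_lim u2_lim) auto
      show "(\<lambda>n. LINT v|lborel. (norm (h (Complex (u2 n) v) - hr v))\<^sup>2) \<longlonglongrightarrow> 0"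
        by (rule filterlim_compose[OF hr(3) at2])
    qed (use hr integrable_cauchy_density in auto)
  qed
  ultimately have "(\<lambda>n. (LINT v|lborel. csc_kernel d (x - Complex (u1 n) v) * h (Complex (u1 n) v)) +
      (LINT v|lborel. csc_kernel d (Complex (u2 n) v - x) * h (Complex (u2 n) v)))
      \<longlonglongrightarrow> (LINT v|lborel. csc_kernel d (x - Complex 0 v) * h0 v) +
               (LINT v|lborel. csc_kernel d (Complex d v - x) * hr v)"
    by (rule tendsto_add)
  moreover have "(LINT v|lborel. csc_kernel d (x - Complex (u1 n) v) * h (Complex (u1 n) v)) +
      (LINT v|lborel. csc_kernel d (Complex (u2 n) v - x) * h (Complex (u2 n) v)) = h x" for n
  proof -
    have "u1 n < Re x" "Re x < u2 n"
      using u1[of n] u2[of n] x by (auto simp: field_simps)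
    then show ?thesis
      using csc_cauchy_formula_interior[OF d hol L2 C, of "u1 n" x "u2 n"] u1[of n] u2[of n] by simp
  qed
  ultimately have "(\<lambda>n::nat. h x) \<longlonglongrightarrow> (LINT v|lborel. csc_kernel d (x - Complex 0 v) * h0 v) +
               (LINT v|lborel. csc_kernel d (Complex d v - x) * hr v)"
    by (simp only:)
  then show ?thesis
    by (rule LIMSEQ_unique[OF tendsto_const])
qed

section \<open>The sum of the kernel series\<close>

lemma slice_ext_slice_emb:
  assumes "I \<in> imag_sphere"
  shows "slice_ext I (\<lambda>z. slice_emb I (g z)) J z =
    slice_emb I ((g z + g (cnj z)) / 2) + J \<odot> slice_emb I (\<i> * (g (cnj z) - g z) / 2)"
proof -
  have half: "slice_emb I (a / 2) = (1/2) *\<^sub>R slice_emb I a" for a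
  proof -
    have "a / 2 = (1/2) *\<^sub>R a"
      by (simp add: complex_eq_iff)
    then show ?thesis
      by (simp only: slice_emb_linear_simps)
  qed
  have "I \<odot> slice_emb I a = slice_emb I (\<i> * a)" for a
    using slice_emb_mult[OF assms, of \<i> a] by simp
  then show ?thesis
    by (simp add: slice_ext_def half omult.scaleR_right omult.diff_right right_diff_distrib
        slice_emb_linear_simps)
qed

text \<open>For \<open>y\<close> and \<open>x\<close> on one slice the denominator of \<open>k(y, x)\<close> is \<open>(cnj x + y) (cnj x + cnj y)\<close>, so that
\<open>k(y, x) = 1 / (2\<pi> (y + cnj x))\<close>. For \<open>y = u + Jv\<close> the denominator still depends on \<open>u\<close> and \<open>v\<^sup>2\<close>
only and lies in \<open>\<complex>\<^sub>I\<close>; the numerator is linear in \<open>Jv\<close>. Hence \<open>k(\<cdot>, x)\<close> is a slice extension.\<close>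

lemma szego_k_slice:
  assumes I: "I \<in> imag_sphere" and J: "J \<in> imag_sphere"
    and nz: "z + cnj w \<noteq> 0" "cnj z + cnj w \<noteq> 0"
  shows "szego_k (slice_emb J z) (slice_emb I w) =
    slice_ext I (\<lambda>z. slice_emb I (1 / (2 * of_real pi * (z + cnj w)))) J z"
proof -
  define c where "c = (z + cnj w) * (cnj z + cnj w)"
  have c: "c \<noteq> 0"
    using nz by (simp add: c_def)
  have den: "oreal ((norm (slice_emb J z))\<^sup>2) + (2 * oRe (slice_emb J z)) *\<^sub>R ocnj (slice_emb I w) +
      ocnj (slice_emb I w) \<odot> ocnj (slice_emb I w) = slice_emb I c"
  proof -
    have "c = of_real ((norm z)\<^sup>2) + of_real (2 * Re z) * cnj w + cnj w * cnj w"
      unfolding c_def complex_norm_square complex_add_cnj[symmetric] by (simp add: algebra_simps)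
    also have "slice_emb I \<dots> = oreal ((norm z)\<^sup>2) + (2 * Re z) *\<^sub>R slice_emb I (cnj w) +
        slice_emb I (cnj w * cnj w)"
      by (simp only: slice_emb_linear_simps slice_emb_of_real scaleR_conv_of_real[symmetric])
    finally show ?thesis
      using I J by (simp add: ocnj_slice_emb oRe_slice_emb slice_emb_mult)
  qed
  have "(ocnj (slice_emb J z) + ocnj (slice_emb I w)) \<odot> slice_emb I (inverse c) =
    (slice_emb I (of_real (Re z) + cnj w) - Im z *\<^sub>R J) \<odot> slice_emb I (inverse c)"
  proof -
    have "ocnj (slice_emb J z) + ocnj (slice_emb I w) = slice_emb I (of_real (Re z) + cnj w) - Im z *\<^sub>R J"
      using I J by (simp add: ocnj_slice_emb slice_emb_linear_simps slice_emb_of_real)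
        (simp add: slice_emb_def slice_pt_def)
    then show ?thesis
      by (simp only:)
  qed
  also have "\<dots> = slice_emb I ((of_real (Re z) + cnj w) / c) + J \<odot> slice_emb I (- of_real (Im z) / c)"
  proof -
    have "slice_emb I (- of_real (Im z) / c) = - (Im z *\<^sub>R slice_emb I (inverse c))"
      using slice_emb_linear_simps(5)[of I "- Im z" "inverse c"]
      by (simp add: scaleR_conv_of_real divide_inverse)
    then show ?thesis
      using I by (simp add: omult.diff_left omult.minus_right omult.scaleR_left omult.scaleR_right
          slice_emb_mult divide_inverse)
  qed
  also have "(of_real (Re z) + cnj w) / c = (1 / (z + cnj w) + 1 / (cnj z + cnj w)) / 2"
  proof -
    have "1 / (z + cnj w) + 1 / (cnj z + cnj w) = ((z + cnj z) + 2 * cnj w) / c"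
      using nz by (simp add: c_def field_simps)
    then show ?thesis
      by (simp add: complex_add_cnj algebra_simps add_divide_distrib)
  qed
  also have "- of_real (Im z) / c = \<i> * (1 / (cnj z + cnj w) - 1 / (z + cnj w)) / 2"
  proof -
    have "1 / (cnj z + cnj w) - 1 / (z + cnj w) = (z - cnj z) / c"
      using nz by (simp add: c_def field_simps)
    then show ?thesis
      by (simp add: complex_diff_cnj mult.commute mult.left_commute)
  qed
  finally have main: "(ocnj (slice_emb J z) + ocnj (slice_emb I w)) \<odot> slice_emb I (inverse c) =
    slice_ext I (\<lambda>z. slice_emb I (1 / (z + cnj w))) J z"
    unfolding slice_ext_slice_emb[OF I] .
  have "slice_ext I (\<lambda>z. slice_emb I (1 / (2 * of_real pi * (z + cnj w)))) J z =
      (1 / (2 * pi)) *\<^sub>R slice_ext I (\<lambda>z. slice_emb I (1 / (z + cnj w))) J z"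
  proof -
    have "slice_emb I (1 / (2 * of_real pi * \<zeta>)) = (1 / (2 * pi)) *\<^sub>R slice_emb I (1 / \<zeta>)" for \<zeta>
      using slice_emb_linear_simps(5)[of I "1 / (2 * pi)" "1 / \<zeta>"] by (simp add: scaleR_conv_of_real)
    then show ?thesis
      by (simp add: slice_ext_def omult.scaleR_right omult.diff_right scaleR_add_right scaleR_diff_right)
  qed
  then show ?thesis
    unfolding szego_k_def den oinv_slice_emb[OF I] main ..
qed

text \<open>The terms of the kernel series on one slice, with \<open>z\<close> in place of \<open>y + cnj x\<close>.\<close>

definition csc_term :: "real \<Rightarrow> complex \<Rightarrow> int \<Rightarrow> complex" where
  "csc_term d z n = (- 1) powi n / (2 * of_real pi * (z + of_real (2 * d * of_int n)))"

lemma sum_symmetric_int_interval: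
  fixes f :: "int \<Rightarrow> 'a::comm_monoid_add"
  shows "(\<Sum>n\<in>{- int M..int N}. f n) = (\<Sum>k\<le>N. f (int k)) + (\<Sum>k<M. f (- int (Suc k)))"
proof -
  have "{- int M..int N} = int ` {..N} \<union> (\<lambda>k. - int (Suc k)) ` {..<M}"
  proof (intro equalityI subsetI)
    fix n assume n: "n \<in> {- int M..int N}"
    show "n \<in> int ` {..N} \<union> (\<lambda>k. - int (Suc k)) ` {..<M}"
    proof (cases "n \<ge> 0")
      case True
      then have "n = int (nat n)" "nat n \<in> {..N}"
        using n by auto
      then show ?thesis
        by blast
    next
      case False
      then have "n = - int (Suc (nat (- n - 1)))" "nat (- n - 1) \<in> {..<M}"
        using n by auto
      then show ?thesis
        by blast
    qed
  qed auto
  then show ?thesis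
    by (simp only:) (subst sum.union_disjoint; auto simp: sum.reindex inj_on_def)
qed

lemma csc_bisums:
  assumes d: "0 < d" and z: "0 < Re z" "Re z < 2 * d"
  shows "((\<lambda>(M, N). \<Sum>n\<in>{- int M..int N}. csc_term d z n) \<longlongrightarrow> csc_kernel d z)
           (sequentially \<times>\<^sub>F sequentially)"
proof -
  define q where "q = z / of_real (2 * d)"
  have "Re q = Re z / (2 * d)"
    unfolding q_def by (rule Re_divide_of_real)
  then have Re_q: "0 < Re q" "Re q < 1"
    using d z by simp_all
  have "q \<notin> \<int>"
  proof
    assume "q \<in> \<int>"
    then obtain k :: int where "q = of_int k"
      by (auto elim: Ints_cases)
    then show False
      using Re_q by simp
  qed
  then obtain P Q where PQ: "(\<lambda>N. \<Sum>k\<le>N. (- 1) ^ k / (q + of_nat k)) \<longlonglongrightarrow> P"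
    "(\<lambda>M. \<Sum>k<M. (- 1) ^ Suc k / (q - of_nat (Suc k))) \<longlonglongrightarrow> Q"
    "P + Q = of_real pi / sin (of_real pi * q)"
    using csc_partial_fractions by blast
  let ?c = "1 / (4 * of_real pi * of_real d) :: complex"
  have cd: "complex_of_real d \<noteq> 0"
    using d by simp
  have z_eq: "z = q * of_real (2 * d)"
    using d by (simp add: q_def)
  have term_eq: "csc_term d z n = ?c * ((- 1) powi n / (q + of_int n))" for n
  proof -
    have "z + of_real (2 * d * of_int n) = of_real (2 * d) * (q + of_int n)"
      by (simp add: z_eq algebra_simps)
    then show ?thesis
      by (simp add: csc_term_def)
  qed
  have t1: "csc_term d z (int k) = ?c * ((- 1) ^ k / (q + of_nat k))" for k
    unfolding term_eq by simp
  have t2: "csc_term d z (- int (Suc k)) = ?c * ((- 1) ^ Suc k / (q - of_nat (Suc k)))" for k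
  proof -
    have "(- 1) powi (- int (Suc k)) = ((- 1) ^ Suc k :: complex)"
      by (simp only: power_int_minus power_int_of_nat power_inverse[symmetric]) simp
    then show ?thesis
      unfolding term_eq by (simp del: of_nat_Suc power_Suc)
  qed
  have sum_eq: "(\<lambda>(M, N). \<Sum>n\<in>{- int M..int N}. csc_term d z n) = (\<lambda>p.
      ?c * ((\<Sum>k\<le>snd p. (- 1) ^ k / (q + of_nat k)) +
            (\<Sum>k<fst p. (- 1) ^ Suc k / (q - of_nat (Suc k)))))"
    unfolding sum_symmetric_int_interval t1 t2
    by (simp add: fun_eq_iff sum_distrib_left distrib_left)
  have "csc_kernel d z = ?c * (P + Q)"
  proof -
    have "of_real (pi / (2 * d)) * z = of_real pi * q"
      using d by (simp add: q_def)
    then show ?thesis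
      unfolding PQ csc_kernel_def by (simp add: field_simps)
  qed
  then show ?thesis
    unfolding sum_eq using filterlim_compose[OF PQ(1) filterlim_snd]
      filterlim_compose[OF PQ(2) filterlim_fst] by (simp only:) (intro tendsto_intros)
qed

text \<open>A real translation commutes with slice extension, so each term of the series is the extension of the
corresponding scalar term. The hypothesis on the real parts keeps all denominators away from zero.\<close>

lemma szego_term_slice:
  assumes I: "I \<in> imag_sphere" and J: "J \<in> imag_sphere" and d: "0 < d"
    and zw: "0 < Re z + Re w" "Re z + Re w < 2 * d"
  shows "szego_term d (slice_emb J z) (slice_emb I w) n =
    slice_emb I ((csc_term d (z + cnj w) n + csc_term d (cnj z + cnj w) n) / 2) +
    J \<odot> slice_emb I (\<i> * (csc_term d (cnj z + cnj w) n - csc_term d (z + cnj w) n) / 2)"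
proof -
  let ?r = "of_real (2 * d * of_int n) :: complex"
  have Re_nz: "Re z + 2 * d * of_int n + Re w \<noteq> 0"
  proof
    assume "Re z + 2 * d * of_int n + Re w = 0"
    then have *: "0 < 2 * d * (of_int n + 1)" "0 < 2 * d * (- of_int n)"
      using zw by (simp_all add: algebra_simps)
    have "0 < (of_int n + 1 :: real)"
      by (rule zero_less_mult_pos[OF *(1)]) (use d in simp)
    moreover have "0 < (- of_int n :: real)"
      by (rule zero_less_mult_pos[OF *(2)]) (use d in simp)
    ultimately have "-1 < n" "n < 0"
      by linarith+
    then show False
      by simp
  qed
  have nz: "z + ?r + cnj w \<noteq> 0" "cnj (z + ?r) + cnj w \<noteq> 0"
    using Re_nz by (simp_all add: complex_eq_iff)
  have powi: "slice_emb I ((- 1) powi n * a) = ((- 1) powi n) *\<^sub>R slice_emb I a" for a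
    using slice_emb_linear_simps(5)[of I "(- 1) powi n" a] by (simp add: scaleR_conv_of_real)
  have shift: "slice_emb J z + oreal (2 * d * of_int n) = slice_emb J (z + ?r)"
    by (simp add: slice_emb_linear_simps slice_emb_of_real del: of_real_mult)
  have e: "csc_term d (\<zeta> + cnj w) n = (- 1) powi n * (1 / (2 * of_real pi * (\<zeta> + ?r + cnj w)))" for \<zeta>
    by (simp add: csc_term_def add_ac)
  have "szego_term d (slice_emb J z) (slice_emb I w) n = ((- 1) powi n) *\<^sub>R
    slice_ext I (\<lambda>z. slice_emb I (1 / (2 * of_real pi * (z + cnj w)))) J (z + ?r)"
    unfolding szego_term_def shift using szego_k_slice[OF I J nz] by simp
  also have "\<dots> = slice_ext I (\<lambda>z. slice_emb I ((- 1) powi n * (1 / (2 * of_real pi * (z + cnj w))))) J (z + ?r)"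
    unfolding powi slice_ext_def
    by (simp add: omult.scaleR_right omult.diff_right scaleR_add_right scaleR_diff_right mult.commute)
  finally show ?thesis
    unfolding slice_ext_slice_emb[OF I] e by simp
qed

lemma bisums_unique: "bisums a s \<Longrightarrow> (THE s. bisums a s) = s"
  unfolding bisums_def
proof (rule the_equality)
  have "sequentially \<times>\<^sub>F sequentially \<noteq> (bot :: (nat \<times> nat) filter)"
    by (simp add: prod_filter_eq_bot)
  then show "s' = s"
    if "((\<lambda>(M, N). \<Sum>n\<in>{- int M..int N}. a n) \<longlongrightarrow> s) (sequentially \<times>\<^sub>F sequentially)"
      "((\<lambda>(M, N). \<Sum>n\<in>{- int M..int N}. a n) \<longlongrightarrow> s') (sequentially \<times>\<^sub>F sequentially)" for s'
    using tendsto_unique that by blast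
qed

text \<open>Slice extension is linear and continuous in the two scalar values that it combines, so the scalar
expansion of the cosecant may be summed inside it.\<close>

lemma szego_strip_bisums:
  assumes I: "I \<in> imag_sphere" and J: "J \<in> imag_sphere" and d: "0 < d"
    and z: "0 \<le> Re z" "Re z \<le> d" and w: "0 < Re w" "Re w < d"
  shows "bisums (szego_term d (slice_emb J z) (slice_emb I w))
    (slice_ext I (\<lambda>z. slice_emb I (csc_kernel d (z + cnj w))) J z)"
proof -
  let ?S = "\<lambda>\<zeta> p. case p of (M, N) \<Rightarrow> \<Sum>n\<in>{- int M..int N}. csc_term d \<zeta> n"
  have lim: "(?S (z + cnj w) \<longlongrightarrow> csc_kernel d (z + cnj w)) (sequentially \<times>\<^sub>F sequentially)"
    "(?S (cnj z + cnj w) \<longlongrightarrow> csc_kernel d (cnj z + cnj w)) (sequentially \<times>\<^sub>F sequentially)"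
    using z w d by (auto intro!: csc_bisums)
  have part: "(\<Sum>n\<in>A. szego_term d (slice_emb J z) (slice_emb I w) n) =
      slice_emb I (((\<Sum>n\<in>A. csc_term d (z + cnj w) n) + (\<Sum>n\<in>A. csc_term d (cnj z + cnj w) n)) / 2) +
      J \<odot> slice_emb I (\<i> * ((\<Sum>n\<in>A. csc_term d (cnj z + cnj w) n) -
        (\<Sum>n\<in>A. csc_term d (z + cnj w) n)) / 2)" for A
  proof -
    have "0 < Re z + Re w" "Re z + Re w < 2 * d"
      using z w by auto
    from szego_term_slice[OF I J d this] show ?thesis
      by (simp add: sum.distrib omult.sum_right[symmetric] sum_divide_distrib[symmetric]
          sum_distrib_left[symmetric] sum_subtractf
          linear_sum[OF bounded_linear.linear[OF bounded_linear_slice_emb], symmetric])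
  qed
  have eq: "(\<lambda>(M, N). \<Sum>n\<in>{- int M..int N}. szego_term d (slice_emb J z) (slice_emb I w) n) =
    (\<lambda>p. slice_emb I ((?S (z + cnj w) p + ?S (cnj z + cnj w) p) / 2) +
      J \<odot> slice_emb I (\<i> * (?S (cnj z + cnj w) p - ?S (z + cnj w) p) / 2))"
    by (rule ext) (simp add: part split: prod.split)
  show ?thesis
    unfolding bisums_def slice_ext_slice_emb[OF I] eq
    by (intro tendsto_add tendsto_divide tendsto_diff tendsto_mult tendsto_const omult.tendsto
        bounded_linear.tendsto[OF bounded_linear_slice_emb] lim) simp_all
qed

lemma szego_strip_slice:
  assumes "I \<in> imag_sphere" "J \<in> imag_sphere" "0 < d" "0 \<le> Re z" "Re z \<le> d" "0 < Re w" "Re w < d"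
  shows "szego_strip d (slice_emb J z) (slice_emb I w) =
    slice_ext I (\<lambda>z. slice_emb I (csc_kernel d (z + cnj w))) J z"
  unfolding szego_strip_def by (rule bisums_unique) (rule szego_strip_bisums[OF assms])

text \<open>With \<open>P = G(z + cnj w)\<close> and \<open>Q = G(z + w)\<close>, the two values of the cosecant kernel \<open>G\<close> that occur
up to conjugation, the kernel is a combination of \<open>1\<close>, \<open>I\<close>, \<open>J\<close> and \<open>J \<odot> I\<close> with coefficients
\<open>Re (P + Q) / 2\<close>, \<open>Im (P - Q) / 2\<close>, \<open>Im (P + Q) / 2\<close> and \<open>Re (Q - P) / 2\<close>. Exchanging the arguments
replaces \<open>P\<close> by its conjugate, keeps \<open>Q\<close> and swaps \<open>I\<close> with \<open>J\<close>, just as octonionic conjugation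
does.\<close>

lemma szego_strip_hermitian:
  assumes I: "I \<in> imag_sphere" and J: "J \<in> imag_sphere" and d: "0 < d"
    and z: "0 < Re z" "Re z < d" and w: "0 < Re w" "Re w < d"
  shows "ocnj (szego_strip d (slice_emb J z) (slice_emb I w)) =
    szego_strip d (slice_emb I w) (slice_emb J z)"
proof -
  define P Q where "P = csc_kernel d (z + cnj w)" and "Q = csc_kernel d (z + w)"
  have e: "csc_kernel d (cnj z + cnj w) = cnj Q" "csc_kernel d (w + cnj z) = cnj P"
    "csc_kernel d (cnj w + cnj z) = cnj Q"
    by (simp_all add: P_def Q_def cnj_csc_kernel add.commute)
  have yx: "szego_strip d (slice_emb J z) (slice_emb I w) =
    slice_emb I ((P + cnj Q) / 2) + J \<odot> slice_emb I (\<i> * (cnj Q - P) / 2)"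
    using I J d z w by (simp add: szego_strip_slice slice_ext_slice_emb e P_def)
  have xy: "szego_strip d (slice_emb I w) (slice_emb J z) =
    slice_emb J ((cnj P + cnj Q) / 2) + I \<odot> slice_emb J (\<i> * (cnj Q - cnj P) / 2)"
    using I J d z w by (simp add: szego_strip_slice slice_ext_slice_emb e)
  have o1: "ocnj (oreal 1) = oreal 1"
    by (simp add: oreal_def ocnj_def axis_def vec_eq_iff)
  show ?thesis
    unfolding yx xy unfolding slice_emb_eq using I J
    by (simp add: ocnj_linear_simps ocnj_omult omult.add_right omult.add_left omult.diff_right omult.diff_left
        omult.scaleR_right omult.scaleR_left ocnj_imag_sphere omult.minus_left omult.minus_right o1 algebra_simps
        diff_divide_distrib add_divide_distrib)
qed

section \<open>Monogenicity of the kernel\<close>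

lemma left_slice_monogenic_szego_strip:
  assumes I: "I \<in> imag_sphere" and d: "0 < d" and w: "0 < Re w" "Re w < d"
  shows "left_slice_monogenic_on (octo_strip d) (\<lambda>y. szego_strip d y (slice_emb I w))"
proof (rule left_slice_monogenic_on_slice_ext[OF I, where W = "{z. 0 < Re z \<and> Re z < d}"
      and F = "\<lambda>z. slice_emb I (csc_kernel d (z + cnj w))"])
  show "open {z. 0 < Re z \<and> Re z < d}"
    by (rule open_complex_strip)
  show "z \<in> {z. 0 < Re z \<and> Re z < d}" if "J \<in> imag_sphere" "slice_emb J z \<in> octo_strip d" for J z
    using that by (simp add: slice_emb_in_octo_strip_iff)
  show "\<exists>D. has_slice_derivative I (\<lambda>z. slice_emb I (csc_kernel d (z + cnj w))) D z"
    if "z \<in> {z. 0 < Re z \<and> Re z < d}" for z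
  proof -
    have "z + cnj w \<in> {z. 0 < Re z \<and> Re z < 2 * d}"
      using that w by auto
    then have "(csc_kernel d has_field_derivative deriv (csc_kernel d) (z + cnj w)) (at (z + cnj w))"
      by (rule holomorphic_derivI[OF csc_kernel_holomorphic[OF d] open_complex_strip])
    then have "((\<lambda>z. csc_kernel d (z + cnj w)) has_field_derivative deriv (csc_kernel d) (z + cnj w)) (at z)"
      by (simp add: DERIV_shift)
    from has_slice_derivative_slice_emb[OF I this] show ?thesis ..
  qed
  show "szego_strip d (slice_emb J z) (slice_emb I w) =
      slice_ext I (\<lambda>z. slice_emb I (csc_kernel d (z + cnj w))) J z"
    if "J \<in> imag_sphere" "z \<in> {z. 0 < Re z \<and> Re z < d}" for J z
    using that by (intro szego_strip_slice I d w) auto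
qed auto

text \<open>Conjugating argument and value reflects each slice and reverses products, and so turns the left
Cauchy-Riemann equation into the right one.\<close>

lemma right_slice_monogenic_ocnj:
  assumes f: "left_slice_monogenic_on U f" and U: "open U" "\<And>w. w \<in> V \<Longrightarrow> ocnj w \<in> U"
    and V: "open V" and g: "\<And>w. w \<in> V \<Longrightarrow> g w = ocnj (f (ocnj w))"
  shows "right_slice_monogenic_on V g"
  unfolding right_slice_monogenic_on_def
proof (intro conjI ballI allI impI)
  have "g differentiable (at w)" if w: "w \<in> V" for w
  proof -
    have "f differentiable (at (ocnj w))"
      using f U w unfolding left_slice_monogenic_on_def
      by (metis at_within_open differentiable_on_def)
    then obtain f' where "(f has_derivative f') (at (ocnj w))"
      by (auto simp: differentiable_def)
    then have "((\<lambda>w. ocnj (f (ocnj w))) has_derivative (\<lambda>h. ocnj (f' (ocnj h)))) (at w)"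
      by (intro bounded_linear.has_derivative[OF bounded_linear_ocnj]
          has_derivative_compose[of ocnj ocnj w UNIV f f']
          bounded_linear_imp_has_derivative bounded_linear_ocnj)
    then have "(g has_derivative (\<lambda>h. ocnj (f' (ocnj h)))) (at w)"
      by (rule has_derivative_transform_within_open[of _ _ _ UNIV V]) (use V w g in auto)
    then show ?thesis
      by (auto simp: differentiable_def)
  qed
  then show "g differentiable_on V"
    by (simp add: differentiable_at_imp_differentiable_on)
next
  fix J u v assume J: "J \<in> imag_sphere" and uv: "slice_pt J u v \<in> V"
  define z where "z = Complex u v"
  have z: "slice_emb J z \<in> V"
    using uv by (simp add: z_def slice_pt_eq_slice_emb)
  then have "slice_emb J (cnj z) \<in> U"
    using U(2)[OF z] J by (simp add: ocnj_slice_emb)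
  then obtain D where "has_slice_derivative J (\<lambda>z. f (slice_emb J z)) D (cnj z)"
    using left_slice_monogenic_onD[OF f U(1) J] by blast
  then have "((\<lambda>z. f (slice_emb J z)) has_derivative (\<lambda>h. slice_emb J h \<odot> D)) (at (cnj z))"
    by (simp add: has_slice_derivative_def)
  then have "((\<lambda>z. ocnj (f (slice_emb J (cnj z)))) has_derivative
      (\<lambda>h. ocnj (slice_emb J (cnj h) \<odot> D))) (at z)"
    by (intro bounded_linear.has_derivative[OF bounded_linear_ocnj]
        has_derivative_compose[of cnj cnj z UNIV "\<lambda>z. f (slice_emb J z)" "\<lambda>h. slice_emb J h \<odot> D"]
        bounded_linear_imp_has_derivative bounded_linear_cnj)
  moreover have "open (slice_emb J -` V)"
    using V linear_continuous_on[OF bounded_linear_slice_emb] by (simp add: open_vimage)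
  ultimately have "((\<lambda>z. g (slice_emb J z)) has_derivative
      (\<lambda>h. ocnj (slice_emb J (cnj h) \<odot> D))) (at z)"
    by (elim has_derivative_transform_within_open[of _ _ _ UNIV "slice_emb J -` V"])
       (use z g J in \<open>auto simp: ocnj_slice_emb\<close>)
  then have "((\<lambda>z. g (slice_emb J z)) has_derivative (\<lambda>h. ocnj D \<odot> slice_emb J h)) (at (Complex u v))"
    using J by (simp add: ocnj_omult ocnj_slice_emb z_def)
  from has_derivative_imp_vector_derivatives[OF this, THEN vector_derivative_at]
  have "vector_derivative (\<lambda>s. g (slice_pt J s v)) (at u) = ocnj D"
    "vector_derivative (\<lambda>t. g (slice_pt J u t)) (at v) = ocnj D \<odot> J"
    by (simp_all add: slice_pt_eq_slice_emb)
  moreover have "ocnj D \<odot> J \<odot> J = - ocnj D"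
  proof -
    have "ocnj D \<odot> J \<odot> J = ocnj (ocnj J \<odot> (ocnj J \<odot> D))"
      by (simp add: ocnj_omult)
    also have "\<dots> = - ocnj D"
      using J by (simp add: ocnj_imag_sphere omult.minus_left omult.minus_right
          imag_sphere_omult_omult ocnj_linear_simps)
    finally show ?thesis .
  qed
  ultimately show "(1/2) *\<^sub>R (vector_derivative (\<lambda>s. g (slice_pt J s v)) (at u)
                 + vector_derivative (\<lambda>t. g (slice_pt J u t)) (at v) \<odot> J) = 0"
    by simp
qed

section \<open>The kernel belongs to the Hardy space\<close>

lemma szego_strip_continuous:
  assumes I: "I \<in> imag_sphere" and J: "J \<in> imag_sphere" and d: "0 < d" and w: "0 < Re w" "Re w < d"
  shows "continuous_on {z. 0 \<le> Re z \<and> Re z \<le> d} (\<lambda>z. szego_strip d (slice_emb J z) (slice_emb I w))"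
proof -
  have c: "continuous_on {z. 0 \<le> Re z \<and> Re z \<le> d} (\<lambda>z. csc_kernel d (g z))"
    if "continuous_on {z. 0 \<le> Re z \<and> Re z \<le> d} g" "\<And>z. Re (g z) = Re z + Re w" for g
    by (rule continuous_on_compose2[OF holomorphic_on_imp_continuous_on[OF
          csc_kernel_holomorphic[OF d]] that(1)]) (use that(2) w in auto)
  have "continuous_on {z. 0 \<le> Re z \<and> Re z \<le> d}
      (slice_ext I (\<lambda>z. slice_emb I (csc_kernel d (z + cnj w))) J)"
    unfolding slice_ext_def[abs_def]
    by (intro continuous_intros omult.continuous_on c
        bounded_linear.continuous_on[OF bounded_linear_slice_emb]) auto
  then show ?thesis
    by (rule continuous_on_eq) (use I J d w in \<open>auto simp: szego_strip_slice\<close>)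
qed

text \<open>One majorant serves all slices and all vertical lines of the closed strip: the real parts of
\<open>z + cnj w\<close> and \<open>cnj z + cnj w\<close> stay in \<open>[Re w, Re w + d]\<close>, away from the poles. Hence all limits
in the definition of the Hardy space follow by dominated convergence.\<close>

lemma szego_strip_line_bound:
  assumes I: "I \<in> imag_sphere" and d: "0 < d" and w: "0 < Re w" "Re w < d"
  obtains D where "integrable lborel D"
    "\<And>J u v. J \<in> imag_sphere \<Longrightarrow> u \<in> {0..d} \<Longrightarrow>
       (norm (szego_strip d (slice_pt J u v) (slice_emb I w)))\<^sup>2 \<le> D v"
proof -
  have "Re w + d < 2 * d"
    using w by simp
  then obtain C where C: "\<And>z. Re w \<le> Re z \<Longrightarrow> Re z \<le> Re w + d \<Longrightarrow>
      (norm (csc_kernel d z))\<^sup>2 \<le> C / (1 + (Im z)\<^sup>2)"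
    using csc_kernel_bound[OF d w(1)] by metis
  let ?D = "\<lambda>v. 2 * (C / (1 + (v - Im w)\<^sup>2)) + 2 * (C / (1 + (v - (- Im w))\<^sup>2))"
  show ?thesis
  proof
    show "integrable lborel ?D"
      by (intro Bochner_Integration.integrable_add integrable_mult_right integrable_cauchy_density)
    fix J u v assume J: "J \<in> imag_sphere" and u: "u \<in> {0..d}"
    let ?z = "Complex u v"
    let ?P = "csc_kernel d (?z + cnj w)" and ?Q = "csc_kernel d (cnj ?z + cnj w)"
    have "norm (szego_strip d (slice_pt J u v) (slice_emb I w)) \<le> norm ?P + norm ?Q"
      using norm_slice_ext_le[OF I J, of "\<lambda>z. slice_emb I (csc_kernel d (z + cnj w))" ?z] I J d w u
      by (simp add: slice_pt_eq_slice_emb szego_strip_slice)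
    then have "(norm (szego_strip d (slice_pt J u v) (slice_emb I w)))\<^sup>2 \<le> (norm ?P + norm ?Q)\<^sup>2"
      by (rule power_mono) simp
    also have "\<dots> \<le> 2 * (norm ?P)\<^sup>2 + 2 * (norm ?Q)\<^sup>2"
      using sum_squares_bound[of "norm ?P" "norm ?Q"] by (simp add: power2_sum)
    also have "\<dots> \<le> ?D v"
    proof (intro add_mono mult_left_mono)
      show "(norm ?P)\<^sup>2 \<le> C / (1 + (v - Im w)\<^sup>2)"
        using C[of "?z + cnj w"] u by simp
      have "(- v - Im w)\<^sup>2 = (v - (- Im w))\<^sup>2"
        by (simp add: power2_eq_square algebra_simps)
      then show "(norm ?Q)\<^sup>2 \<le> C / (1 + (v - (- Im w))\<^sup>2)"
        using C[of "cnj ?z + cnj w"] u by simp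
    qed auto
    finally show "(norm (szego_strip d (slice_pt J u v) (slice_emb I w)))\<^sup>2 \<le> ?D v" .
  qed
qed

lemma szego_strip_in_hardy_core:
  assumes I: "I \<in> imag_sphere" and d: "0 < d" and w: "0 < Re w" "Re w < d"
  shows "(\<lambda>y. szego_strip d y (slice_emb I w)) \<in> hardy_core d"
proof -
  let ?S = "\<lambda>y. szego_strip d y (slice_emb I w)"
  obtain D where D: "integrable lborel D"
    "\<And>J u v. J \<in> imag_sphere \<Longrightarrow> u \<in> {0..d} \<Longrightarrow> (norm (?S (slice_pt J u v)))\<^sup>2 \<le> D v"
    using szego_strip_line_bound[OF I d w] by blast
  have meas: "(\<lambda>v. ?S (slice_pt J u v)) \<in> borel_measurable lborel"
    if "J \<in> imag_sphere" "u \<in> {0..d}" for J u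
  proof -
    have "continuous_on UNIV (\<lambda>v. ?S (slice_emb J (Complex u v)))"
      using that by (intro continuous_on_compose2[OF szego_strip_continuous[OF I _ d w]
            continuous_on_Complex_vertical]) auto
    then show ?thesis
      by (simp add: slice_pt_eq_slice_emb borel_measurable_continuous_onI)
  qed
  have L2: "L2_line (\<lambda>v. ?S (slice_pt J u v))" if "J \<in> imag_sphere" "u \<in> {0..d}" for J u
    unfolding L2_line_def
    using meas[OF that] integrable_dominated_square[OF meas[OF that] D(1) D(2)[OF that]] by blast
  have bound: "L2_sq (\<lambda>v. ?S (slice_pt J u v)) \<le> (LINT v|lborel. D v)"
    if "J \<in> imag_sphere" "u \<in> {0..d}" for J u
    unfolding L2_sq_def using L2[OF that] D(1) D(2)[OF that]
    by (intro integral_mono) (auto simp: L2_line_def)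
  have lim: "(\<lambda>n. L2_sq (\<lambda>v. ?S (slice_pt J (X n) v) - ?S (slice_pt J u v))) \<longlonglongrightarrow> 0"
    if J: "J \<in> imag_sphere" and X: "\<And>n. X n \<in> {0..d}" "X \<longlonglongrightarrow> u" and u: "u \<in> {0..d}" for J X u
  proof -
    have "(\<lambda>n. LINT v|lborel. (norm (?S (slice_pt J (X n) v) - ?S (slice_pt J u v)))\<^sup>2)
        \<longlonglongrightarrow> (LINT v::real|lborel. (0::real))"
    proof (rule integral_dominated_convergence)
      show "integrable lborel (\<lambda>v. 4 * D v)"
        using D by simp
      show "(\<lambda>v. (norm (?S (slice_pt J (X n) v) - ?S (slice_pt J u v)))\<^sup>2) \<in> borel_measurable lborel" for n
        using meas[OF J X(1), of n] meas[OF J u] by measurable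
      show "AE v in lborel. (\<lambda>n. (norm (?S (slice_pt J (X n) v) - ?S (slice_pt J u v)))\<^sup>2) \<longlonglongrightarrow> 0"
      proof (rule AE_I2)
        fix v
        have "(\<lambda>n. Complex (X n) v) \<longlonglongrightarrow> Complex u v"
          unfolding Complex_eq by (intro tendsto_intros X)
        then have "(\<lambda>n. ?S (slice_emb J (Complex (X n) v))) \<longlonglongrightarrow> ?S (slice_emb J (Complex u v))"
          using X(1) u by (intro continuous_on_tendsto_compose[OF szego_strip_continuous[OF I J d w]])
            (auto intro!: always_eventually)
        then have "(\<lambda>n. (norm (?S (slice_pt J (X n) v) - ?S (slice_pt J u v)))\<^sup>2) \<longlonglongrightarrow>
            (norm (?S (slice_pt J u v) - ?S (slice_pt J u v)))\<^sup>2"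
          unfolding slice_pt_eq_slice_emb by (intro tendsto_intros)
        then show "(\<lambda>n. (norm (?S (slice_pt J (X n) v) - ?S (slice_pt J u v)))\<^sup>2) \<longlonglongrightarrow> 0"
          by simp
      qed
      show "AE v in lborel. norm ((norm (?S (slice_pt J (X n) v) - ?S (slice_pt J u v)))\<^sup>2) \<le> 4 * D v" for n
      proof (rule AE_I2)
        fix v
        let ?a = "?S (slice_pt J (X n) v)" and ?b = "?S (slice_pt J u v)"
        have "(norm (?a - ?b))\<^sup>2 \<le> (norm ?a + norm ?b)\<^sup>2"
          by (intro power_mono norm_triangle_ineq4) simp
        also have "\<dots> \<le> 2 * (norm ?a)\<^sup>2 + 2 * (norm ?b)\<^sup>2"
          using sum_squares_bound[of "norm ?a" "norm ?b"] by (simp add: power2_sum)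
        also have "\<dots> \<le> 4 * D v"
          using D(2)[OF J X(1), of n v] D(2)[OF J u, of v] by simp
        finally show "norm ((norm (?a - ?b))\<^sup>2) \<le> 4 * D v"
          by simp
      qed
    qed simp
    then show ?thesis
      by (simp add: L2_sq_def)
  qed
  show ?thesis
    unfolding hardy_core_def
  proof (intro CollectI conjI ballI)
    show "left_slice_monogenic_on (octo_strip d) ?S"
      by (rule left_slice_monogenic_szego_strip[OF I d w])
    fix J assume J: "J \<in> imag_sphere"
    show "L2_line (\<lambda>v. ?S (slice_pt J u v))" if "u \<in> {0..d}" for u
      using L2[OF J that] .
    show "\<exists>C. \<forall>u\<in>{0<..<d}. L2_sq (\<lambda>v. ?S (slice_pt J u v)) \<le> C"
      using bound[OF J] by (intro exI[of _ "LINT v|lborel. D v"]) auto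
    show "((\<lambda>u. L2_sq (\<lambda>v. ?S (slice_pt J u v) - ?S (slice_pt J 0 v))) \<longlongrightarrow> 0) (at_right 0)"
    proof (rule tendsto_at_right_sequentially[of 0 d])
      fix X :: "nat \<Rightarrow> real" assume "\<And>n. 0 < X n" "\<And>n. X n < d" "X \<longlonglongrightarrow> 0"
      then show "(\<lambda>n. L2_sq (\<lambda>v. ?S (slice_pt J (X n) v) - ?S (slice_pt J 0 v))) \<longlonglongrightarrow> 0"
        using d by (intro lim[OF J]) (auto intro: less_imp_le)
    qed (use d in simp)
    show "((\<lambda>u. L2_sq (\<lambda>v. ?S (slice_pt J u v) - ?S (slice_pt J d v))) \<longlongrightarrow> 0) (at_left d)"
    proof (rule tendsto_at_left_sequentially[of 0 d])
      fix X :: "nat \<Rightarrow> real" assume "\<And>n. X n < d" "\<And>n. 0 < X n" "X \<longlonglongrightarrow> d"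
      then show "(\<lambda>n. L2_sq (\<lambda>v. ?S (slice_pt J (X n) v) - ?S (slice_pt J d v))) \<longlonglongrightarrow> 0"
        using d by (intro lim[OF J]) (auto intro: less_imp_le)
    qed (use d in simp)
  qed
qed

lemma hardy_core_subset_hardy2:
  assumes "f \<in> hardy_core d" "0 \<le> d"
  shows "f \<in> hardy2 d"
  unfolding hardy2_def
proof (intro CollectI conjI exI[of _ "\<lambda>_. f"] ballI allI)
  show "L2_line (\<lambda>v. f (slice_pt I u v))" if "I \<in> imag_sphere" "u \<in> {0, d}" for I u
    using assms that by (auto simp: hardy_core_def)
qed (use assms in \<open>auto simp: L2_sq_def\<close>)

section \<open>The reproducing property\<close>

lemma L2_line_bounded_linear:
  fixes T :: "octonion \<Rightarrow> complex"
  assumes T: "bounded_linear T" and g: "L2_line g"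
  shows "(\<lambda>v. T (g v)) \<in> borel_measurable lborel" "integrable lborel (\<lambda>v. (norm (T (g v)))\<^sup>2)"
    and "(\<And>x. norm (T x) \<le> norm x * K) \<Longrightarrow>
      (LINT v|lborel. (norm (T (g v)))\<^sup>2) \<le> K\<^sup>2 * L2_sq g"
proof -
  have g': "g \<in> borel_measurable lborel" "integrable lborel (\<lambda>v. (norm (g v))\<^sup>2)"
    using g by (auto simp: L2_line_def)
  show m: "(\<lambda>v. T (g v)) \<in> borel_measurable lborel"
    using measurable_compose[OF g'(1) borel_measurable_continuous_onI[OF linear_continuous_on[OF T]]] .
  have sq: "(norm (T (g v)))\<^sup>2 \<le> K\<^sup>2 * (norm (g v))\<^sup>2" if "\<And>x. norm (T x) \<le> norm x * K" for v K
  proof -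
    have "(norm (T (g v)))\<^sup>2 \<le> (norm (g v) * K)\<^sup>2"
      using that by (intro power_mono) auto
    then show ?thesis
      by (simp add: power_mult_distrib mult.commute)
  qed
  obtain K0 where "\<And>x. norm (T x) \<le> norm x * K0"
    using bounded_linear.bounded[OF T] by blast
  from sq[OF this] show i: "integrable lborel (\<lambda>v. (norm (T (g v)))\<^sup>2)"
    using g' by (intro integrable_dominated_square[OF m, of "\<lambda>v. K0\<^sup>2 * (norm (g v))\<^sup>2"]) auto
  show "(LINT v|lborel. (norm (T (g v)))\<^sup>2) \<le> K\<^sup>2 * L2_sq g" if "\<And>x. norm (T x) \<le> norm x * K"
  proof -
    have "(LINT v|lborel. (norm (T (g v)))\<^sup>2) \<le> (LINT v|lborel. K\<^sup>2 * (norm (g v))\<^sup>2)"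
      using i g' sq[OF that] by (intro integral_mono) auto
    then show ?thesis
      by (simp add: L2_sq_def)
  qed
qed

lemma L2_line_diff: "L2_line f \<Longrightarrow> L2_line g \<Longrightarrow> L2_line (\<lambda>v. f v - g v)"
  unfolding L2_line_def using integrable_square_diff[of f g] by auto

lemma functional_L2_tendsto:
  fixes T :: "octonion \<Rightarrow> complex"
  assumes T: "bounded_linear T" and L2: "eventually (\<lambda>n. L2_line (\<lambda>v. f n v - g v)) F"
    and lim: "((\<lambda>n. L2_sq (\<lambda>v. f n v - g v)) \<longlongrightarrow> 0) F"
  shows "((\<lambda>n. LINT v|lborel. (norm (T (f n v) - T (g v)))\<^sup>2) \<longlongrightarrow> 0) F"
proof -
  obtain K where K: "\<And>x. norm (T x) \<le> norm x * K"
    using bounded_linear.bounded[OF T] by blast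
  show ?thesis
  proof (rule tendsto_sandwich[OF _ _ tendsto_const])
    show "\<forall>\<^sub>F n in F. 0 \<le> (LINT v|lborel. (norm (T (f n v) - T (g v)))\<^sup>2)"
      by (rule always_eventually) (auto intro: integral_nonneg_AE)
    show "\<forall>\<^sub>F n in F. (LINT v|lborel. (norm (T (f n v) - T (g v)))\<^sup>2) \<le> K\<^sup>2 * L2_sq (\<lambda>v. f n v - g v)"
      using L2
    proof eventually_elim
      case (elim n)
      from L2_line_bounded_linear(3)[OF T elim K] show ?case
        by (simp add: linear_diff[OF bounded_linear.linear[OF T]])
    qed
    show "((\<lambda>n. K\<^sup>2 * L2_sq (\<lambda>v. f n v - g v)) \<longlongrightarrow> 0) F"
      using tendsto_mult_left[OF lim, of "K\<^sup>2"] by simp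
  qed
qed

text \<open>After applying the functional, the restriction to the slice is a scalar holomorphic function with
\<open>L\<^sup>2\<close> boundary values in the sense required by Cauchy's formula on the strip.\<close>

lemma hardy_core_cauchy_formula:
  assumes f: "f \<in> hardy_core d" and d: "0 < d" and I: "I \<in> imag_sphere" and x: "0 < Re x" "Re x < d"
    and T_def: "T = slice_functional I W"
  shows "T (f (slice_emb I x)) =
     (LINT v|lborel. csc_kernel d (x - Complex 0 v) * T (f (slice_pt I 0 v))) +
     (LINT v|lborel. csc_kernel d (Complex d v - x) * T (f (slice_pt I d v)))"
proof -
  have T: "bounded_linear T"
    unfolding T_def by (rule bounded_linear_slice_functional)
  have mono: "left_slice_monogenic_on (octo_strip d) f"
    and L2: "\<And>u. u \<in> {0..d} \<Longrightarrow> L2_line (\<lambda>v. f (slice_pt I u v))"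
    and lim0: "((\<lambda>u. L2_sq (\<lambda>v. f (slice_pt I u v) - f (slice_pt I 0 v))) \<longlongrightarrow> 0) (at_right 0)"
    and limd: "((\<lambda>u. L2_sq (\<lambda>v. f (slice_pt I u v) - f (slice_pt I d v))) \<longlongrightarrow> 0) (at_left d)"
    using f I by (auto simp: hardy_core_def)
  obtain C where C: "\<And>u. u \<in> {0<..<d} \<Longrightarrow> L2_sq (\<lambda>v. f (slice_pt I u v)) \<le> C"
    using f I unfolding hardy_core_def mem_Collect_eq by meson
  obtain K where K: "\<And>x. norm (T x) \<le> norm x * K"
    using bounded_linear.bounded[OF T] by blast
  define h where "h = (\<lambda>z. T (f (slice_emb I z)))"
  have h_pt: "h (Complex u v) = T (f (slice_pt I u v))" for u v
    by (simp add: h_def slice_pt_eq_slice_emb)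
  have "h field_differentiable (at z)" if z: "0 < Re z \<and> Re z < d" for z
  proof -
    obtain D where "has_slice_derivative I (\<lambda>z. f (slice_emb I z)) D z"
      using left_slice_monogenic_onD[OF mono open_octo_strip I, of z] I z
      by (auto simp: slice_emb_in_octo_strip_iff)
    from has_slice_derivative_functional[OF I this] show ?thesis
      unfolding h_def T_def field_differentiable_def by blast
  qed
  then have hol: "h holomorphic_on {z. 0 < Re z \<and> Re z < d}"
    by (auto simp: holomorphic_on_def intro: field_differentiable_at_within)
  have ev: "eventually (\<lambda>u. u \<in> {0<..<d}) (at_right 0)" "eventually (\<lambda>u. u \<in> {0<..<d}) (at_left d)"
    using eventually_at_right_real[OF d] eventually_at_left_real[OF d] by auto
  have "h x = (LINT v|lborel. csc_kernel d (x - Complex 0 v) * T (f (slice_pt I 0 v))) +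
     (LINT v|lborel. csc_kernel d (Complex d v - x) * T (f (slice_pt I d v)))"
  proof (rule csc_cauchy_formula_boundary[OF d hol, where C = "K\<^sup>2 * C"])
    fix u assume u: "0 < u" "u < d"
    then have "u \<in> {0..d}" "u \<in> {0<..<d}"
      by auto
    show "integrable lborel (\<lambda>v. (norm (h (Complex u v)))\<^sup>2)"
      unfolding h_pt by (rule L2_line_bounded_linear(2)[OF T L2[OF \<open>u \<in> {0..d}\<close>]])
    have "(LINT v|lborel. (norm (h (Complex u v)))\<^sup>2) \<le> K\<^sup>2 * L2_sq (\<lambda>v. f (slice_pt I u v))"
      unfolding h_pt by (rule L2_line_bounded_linear(3)[OF T L2[OF \<open>u \<in> {0..d}\<close>] K])
    also have "\<dots> \<le> K\<^sup>2 * C"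
      using C[OF \<open>u \<in> {0<..<d}\<close>] by (rule mult_left_mono) simp
    finally show "(LINT v|lborel. (norm (h (Complex u v)))\<^sup>2) \<le> K\<^sup>2 * C" .
  next
    show "((\<lambda>u. LINT v|lborel. (norm (h (Complex u v) - T (f (slice_pt I 0 v))))\<^sup>2) \<longlongrightarrow> 0) (at_right 0)"
      unfolding h_pt
      by (rule functional_L2_tendsto[OF T _ lim0])
         (use ev(1) d in \<open>auto elim!: eventually_mono intro!: L2_line_diff L2\<close>)
    show "((\<lambda>u. LINT v|lborel. (norm (h (Complex u v) - T (f (slice_pt I d v))))\<^sup>2) \<longlongrightarrow> 0) (at_left d)"
      unfolding h_pt
      by (rule functional_L2_tendsto[OF T _ limd])
         (use ev(2) d in \<open>auto elim!: eventually_mono intro!: L2_line_diff L2\<close>)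
  qed (use L2_line_bounded_linear(1,2)[OF T L2] d x in auto)
  then show ?thesis
    by (simp add: h_def)
qed

lemma csc_boundary_L2:
  assumes d: "0 < d" and x: "0 < Re x" "Re x < d"
  shows "(\<lambda>v. csc_kernel d (x - Complex 0 v)) \<in> borel_measurable lborel"
    "integrable lborel (\<lambda>v. (norm (csc_kernel d (x - Complex 0 v)))\<^sup>2)"
    "(\<lambda>v. csc_kernel d (Complex d v - x)) \<in> borel_measurable lborel"
    "integrable lborel (\<lambda>v. (norm (csc_kernel d (Complex d v - x)))\<^sup>2)"
proof -
  have c: "continuous_on UNIV (\<lambda>v. x - Complex 0 v)" "continuous_on UNIV (\<lambda>v. Complex d v - x)"
    by (intro continuous_intros continuous_on_Complex_vertical)+
  have "Re x < 2 * d" "0 < d - Re x" "d - Re x < 2 * d"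
    using x by auto
  note 1 = csc_line_L2[OF d x(1) this(1) c(1), of "Im x"]
    and 2 = csc_line_L2[OF d this(2,3) c(2), of "Im x"]
  show "(\<lambda>v. csc_kernel d (x - Complex 0 v)) \<in> borel_measurable lborel"
    "integrable lborel (\<lambda>v. (norm (csc_kernel d (x - Complex 0 v)))\<^sup>2)"
    by (rule 1; simp add: power2_commute)+
  show "(\<lambda>v. csc_kernel d (Complex d v - x)) \<in> borel_measurable lborel"
    "integrable lborel (\<lambda>v. (norm (csc_kernel d (Complex d v - x)))\<^sup>2)"
    by (rule 2; simp)+
qed

text \<open>Both sides of the formula are continuous along the sequences that define the closure: the left one by
the pointwise convergence inside, the right one by the \<open>L\<^sup>2\<close> convergence on the boundary.\<close>

lemma hardy2_cauchy_formula:
  assumes f: "f \<in> hardy2 d" and d: "0 < d" and I: "I \<in> imag_sphere" and x: "0 < Re x" "Re x < d"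
    and T_def: "T = slice_functional I W"
  shows "T (f (slice_emb I x)) =
     (LINT v|lborel. csc_kernel d (x - Complex 0 v) * T (f (slice_pt I 0 v))) +
     (LINT v|lborel. csc_kernel d (Complex d v - x) * T (f (slice_pt I d v)))"
proof -
  have T: "bounded_linear T"
    unfolding T_def by (rule bounded_linear_slice_functional)
  obtain F where F: "\<And>n. F n \<in> hardy_core d" "\<And>x. x \<in> octo_strip d \<Longrightarrow> (\<lambda>n. F n x) \<longlonglongrightarrow> f x"
    "\<And>u. u \<in> {0, d} \<Longrightarrow> (\<lambda>n. L2_sq (\<lambda>v. F n (slice_pt I u v) - f (slice_pt I u v))) \<longlonglongrightarrow> 0"
    using f I unfolding hardy2_def by fast
  have fL2: "L2_line (\<lambda>v. f (slice_pt I u v))" if "u \<in> {0, d}" for u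
    using f I that by (auto simp: hardy2_def)
  have FL2: "L2_line (\<lambda>v. F n (slice_pt I u v))" if "u \<in> {0, d}" for n u
    using F(1)[of n] I that d by (auto simp: hardy_core_def)
  have lim: "(\<lambda>n. LINT v|lborel. c v * T (F n (slice_pt I u v))) \<longlonglongrightarrow>
      (LINT v|lborel. c v * T (f (slice_pt I u v)))"
    if u: "u \<in> {0, d}" and c: "c \<in> borel_measurable lborel" "integrable lborel (\<lambda>v. (norm (c v))\<^sup>2)"
    for u and c :: "real \<Rightarrow> complex"
  proof (rule L2_pairing_tendsto[where D = "\<lambda>v. (norm (c v))\<^sup>2"])
    show "(\<lambda>n. LINT v|lborel. (norm (T (F n (slice_pt I u v)) - T (f (slice_pt I u v))))\<^sup>2) \<longlonglongrightarrow> 0"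
      by (rule functional_L2_tendsto[OF T _ F(3)[OF u]])
         (use u in \<open>auto intro!: always_eventually L2_line_diff fL2 FL2\<close>)
  qed (use c L2_line_bounded_linear(1,2)[OF T fL2[OF u]] L2_line_bounded_linear(1,2)[OF T FL2[OF u]]
      in auto)
  have "(\<lambda>n. T (F n (slice_emb I x))) \<longlonglongrightarrow>
     (LINT v|lborel. csc_kernel d (x - Complex 0 v) * T (f (slice_pt I 0 v))) +
     (LINT v|lborel. csc_kernel d (Complex d v - x) * T (f (slice_pt I d v)))"
    unfolding hardy_core_cauchy_formula[OF F(1) d I x T_def]
    by (intro tendsto_add lim csc_boundary_L2[OF d x]) auto
  moreover have "(\<lambda>n. T (F n (slice_emb I x))) \<longlonglongrightarrow> T (f (slice_emb I x))"
    using F(2)[of "slice_emb I x"] I x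
    by (intro bounded_linear.tendsto[OF T]) (simp add: slice_emb_in_octo_strip_iff)
  ultimately show ?thesis
    by (rule LIMSEQ_unique[symmetric])
qed

text \<open>The tangent \<open>\<plusminus>I\<close> lies in the same plane \<open>\<complex>\<^sub>I\<close> as the values of the kernel, so it cancels although
the values of \<open>f\<close> lie elsewhere.\<close>

lemma hardy_integrand:
  assumes I: "I \<in> imag_sphere" and g: "g z = slice_emb I c"
  shows "(let t = strip_tangent I z in ocnj (t \<odot> g z) \<odot> (t \<odot> f z)) = slice_emb I (cnj c) \<odot> f z"
proof -
  have t: "strip_tangent I z = slice_emb I (- \<i>) \<or> strip_tangent I z = slice_emb I \<i>"
    by (auto simp: strip_tangent_def slice_emb_linear_simps)
  have "ocnj (slice_emb I a \<odot> slice_emb I c) \<odot> (slice_emb I a \<odot> f z) = slice_emb I (cnj c) \<odot> f z"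
    if "cnj a * a = 1" for a
    using that I by (simp add: slice_emb_mult ocnj_slice_emb slice_emb_mult_omult)
       (metis (no_types, lifting) mult.commute mult.left_commute mult.right_neutral)
  from this[of \<i>] this[of "- \<i>"] t show ?thesis
    unfolding Let_def g by auto
qed

lemma integrable_slice_emb_omult:
  assumes I: "I \<in> imag_sphere"
    and c: "c \<in> borel_measurable lborel" "integrable lborel (\<lambda>v. (norm (c v))\<^sup>2)" and g: "L2_line g"
  shows "integrable lborel (\<lambda>v. slice_emb I (c v) \<odot> g v)"
proof (rule Bochner_Integration.integrable_bound)
  have g': "g \<in> borel_measurable lborel" "integrable lborel (\<lambda>v. (norm (g v))\<^sup>2)"
    using g by (auto simp: L2_line_def)
  show "integrable lborel (\<lambda>v. ((norm (c v))\<^sup>2 + (norm (g v))\<^sup>2) / 2)"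
    using c g' by simp
  have Ig: "(\<lambda>v. I \<odot> g v) \<in> borel_measurable lborel"
    using measurable_compose[OF g'(1) borel_measurable_continuous_onI[OF
          linear_continuous_on[OF omult.bounded_linear_right]]] .
  show "(\<lambda>v. slice_emb I (c v) \<odot> g v) \<in> borel_measurable lborel"
    unfolding slice_emb_omult_eq using Ig g' c by measurable
  show "AE v in lborel. norm (slice_emb I (c v) \<odot> g v) \<le> norm (((norm (c v))\<^sup>2 + (norm (g v))\<^sup>2) / 2)"
    using mult_le_half_squares I by (intro AE_I2) (simp add: norm_omult)
qed

text \<open>On the two boundary lines the conjugated kernel is, by the symmetries of the cosecant, the kernel of
the Cauchy formula with its pole at \<open>x\<close>. Integrals of octonions are compared by complex linear
functionals.\<close>

lemma szego_strip_reproducing: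
  assumes f: "f \<in> hardy2 d" and d: "0 < d" and I: "I \<in> imag_sphere" and x: "0 < Re x" "Re x < d"
  shows "hardy_inner d I f (\<lambda>y. szego_strip d y (slice_emb I x)) = f (slice_emb I x)"
proof -
  let ?S = "\<lambda>y. szego_strip d y (slice_emb I x)"
  have fL2: "L2_line (\<lambda>v. f (slice_pt I u v))" if "u \<in> {0, d}" for u
    using f I that by (auto simp: hardy2_def)
  have S: "?S (slice_pt I u v) = slice_emb I (csc_kernel d (Complex u v + cnj x))"
    if "u \<in> {0, d}" for u v
    using that I d x by (auto simp: slice_pt_eq_slice_emb szego_strip_slice slice_ext_self)
  have c0: "cnj (csc_kernel d (Complex 0 v + cnj x)) = csc_kernel d (x - Complex 0 v)" for v
  proof -
    have "cnj (Complex 0 v + cnj x) = x - Complex 0 v"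
      by (simp add: complex_eq_iff)
    then show ?thesis
      by (simp only: cnj_csc_kernel)
  qed
  have cd: "cnj (csc_kernel d (Complex d v + cnj x)) = csc_kernel d (Complex d v - x)" for v
  proof -
    have "cnj (Complex d v + cnj x) = of_real (2 * d) - (Complex d v - x)"
      by (simp add: complex_eq_iff)
    then show ?thesis
      using d by (simp only: cnj_csc_kernel) (rule csc_kernel_reflect, simp)
  qed
  let ?A = "\<lambda>v. slice_emb I (csc_kernel d (x - Complex 0 v)) \<odot> f (slice_pt I 0 v)"
  let ?B = "\<lambda>v. slice_emb I (csc_kernel d (Complex d v - x)) \<odot> f (slice_pt I d v)"
  note integrand = hardy_integrand[OF I, of ?S "slice_pt I u v" "csc_kernel d (Complex u v + cnj x)" f for u v]
  have inner: "hardy_inner d I f ?S = (LINT v|lborel. ?A v) + (LINT v|lborel. ?B v)"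
  proof -
    have "(let z = slice_pt I 0 v; t = strip_tangent I z in ocnj (t \<odot> ?S z) \<odot> (t \<odot> f z)) = ?A v" for v
      using integrand[of 0 v] S[of 0 v] by (simp add: Let_def c0)
    moreover have "(let z = slice_pt I d v; t = strip_tangent I z in ocnj (t \<odot> ?S z) \<odot> (t \<odot> f z)) = ?B v" for v
      using integrand[of d v] S[of d v] by (simp add: Let_def cd)
    ultimately show ?thesis
      using d by (simp add: hardy_inner_def)
  qed
  have iA: "integrable lborel ?A" and iB: "integrable lborel ?B"
    by (intro integrable_slice_emb_omult I csc_boundary_L2[OF d x] fL2; simp)+
  \<comment> \<open>As in the Representation Formula, the difference is tested with its own functional.\<close>
  define W where "W = hardy_inner d I f ?S - f (slice_emb I x)"
  define T where "T = slice_functional I W"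
  have T: "bounded_linear T"
    unfolding T_def by (rule bounded_linear_slice_functional)
  have TA: "T (LINT v|lborel. ?A v) =
      (LINT v|lborel. csc_kernel d (x - Complex 0 v) * T (f (slice_pt I 0 v)))"
    using integral_bounded_linear[OF T iA] I by (simp add: T_def slice_functional_omult)
  have TB: "T (LINT v|lborel. ?B v) =
      (LINT v|lborel. csc_kernel d (Complex d v - x) * T (f (slice_pt I d v)))"
    using integral_bounded_linear[OF T iB] I by (simp add: T_def slice_functional_omult)
  have "T (hardy_inner d I f ?S) = T (f (slice_emb I x))"
    unfolding inner linear_add[OF bounded_linear.linear[OF T]] TA TB
    by (rule hardy2_cauchy_formula[OF f d I x T_def, symmetric])
  then have "T W = 0"
    unfolding W_def linear_diff[OF bounded_linear.linear[OF T]] by simp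
  then have "inner W W = 0"
    by (metis Re_slice_functional T_def zero_complex.sel(1))
  then show ?thesis
    by (simp add: W_def)
qed

section \<open>Uniqueness of the kernel\<close>

lemma ocnj_hardy_inner: "ocnj (hardy_inner d I f g) = hardy_inner d I g f"
proof -
  have int: "ocnj (LINT v|lborel. \<phi> v) = (LINT v|lborel. ocnj (\<phi> v))" for \<phi> :: "real \<Rightarrow> octonion"
    by (rule integral_bounded_linear'[OF bounded_linear_ocnj bounded_linear_ocnj, symmetric]) simp
  show ?thesis
    unfolding hardy_inner_def linear_sum[OF bounded_linear.linear[OF bounded_linear_ocnj]] int Let_def
    by (simp add: ocnj_omult)
qed

lemma hardy2_representation_formula:
  assumes f: "f \<in> hardy2 d" and IJ: "I \<in> imag_sphere" "J \<in> imag_sphere" and z: "0 < Re z" "Re z < d"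
  shows "f (slice_emb J z) = slice_ext I (\<lambda>z. f (slice_emb I z)) J z"
proof -
  obtain F where F: "\<And>n. F n \<in> hardy_core d" "\<And>x. x \<in> octo_strip d \<Longrightarrow> (\<lambda>n. F n x) \<longlonglongrightarrow> f x"
    using f IJ unfolding hardy2_def by fast
  have lim: "(\<lambda>n. F n (slice_emb K \<zeta>)) \<longlonglongrightarrow> f (slice_emb K \<zeta>)"
    if "K \<in> imag_sphere" "Re \<zeta> = Re z" for K \<zeta>
    using F(2) that z by (simp add: slice_emb_in_octo_strip_iff)
  have "F n (slice_emb J z) = slice_ext I (\<lambda>z. F n (slice_emb I z)) J z" for n
    using F(1)[of n] by (intro representation_formula[OF _ IJ z]) (simp add: hardy_core_def)
  moreover have "(\<lambda>n. slice_ext I (\<lambda>z. F n (slice_emb I z)) J z) \<longlonglongrightarrow>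
      slice_ext I (\<lambda>z. f (slice_emb I z)) J z"
    unfolding slice_ext_def by (intro tendsto_intros omult.tendsto lim IJ) simp_all
  ultimately have "(\<lambda>n. F n (slice_emb J z)) \<longlonglongrightarrow> slice_ext I (\<lambda>z. f (slice_emb I z)) J z"
    by (simp only:)
  then show ?thesis
    using lim[OF IJ(2), of z] LIMSEQ_unique by blast
qed

lemma octo_strip_cases:
  assumes "x \<in> octo_strip d"
  obtains I w where "I \<in> imag_sphere" "x = slice_emb I w" "0 < Re w" "Re w < d"
  using slice_emb_cases[of x] assms unfolding octo_strip_def by (metis mem_Collect_eq)

lemma szego_strip_is_kernel:
  assumes d: "0 < d"
  shows "is_slice_szego_kernel d (szego_strip d)"
  unfolding is_slice_szego_kernel_def
proof (intro conjI ballI)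
  fix x assume "x \<in> octo_strip d"
  then show "(\<lambda>y. szego_strip d y x) \<in> hardy2 d"
    using szego_strip_in_hardy_core[OF _ d] d
    by (elim octo_strip_cases) (auto intro!: hardy_core_subset_hardy2)
next
  fix f I x assume f: "f \<in> hardy2 d" and I: "I \<in> imag_sphere"
    and x: "x \<in> octo_strip d \<inter> slice_plane I"
  then obtain u v where "x = slice_emb I (Complex u v)"
    by (auto simp: slice_plane_def slice_pt_eq_slice_emb)
  moreover from this have "0 < u" "u < d"
    using x I by (auto simp: slice_emb_in_octo_strip_iff)
  ultimately show "hardy_inner d I f (\<lambda>y. szego_strip d y x) = f x"
    using szego_strip_reproducing[OF f d I, of "Complex u v"] by simp
qed

text \<open>For \<open>y\<close> on the slice of \<open>x\<close> this is the usual argument for reproducing kernels: each kernel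
reproduces the other one, and the inner product is Hermitian. The reproducing property says nothing
directly about other \<open>y\<close>; these are reached by the Representation Formula, which survives the
pointwise limits in the definition of the Hardy space.\<close>

lemma slice_szego_kernel_unique:
  assumes d: "0 < d" and K: "is_slice_szego_kernel d K"
    and y: "y \<in> octo_strip d" and x: "x \<in> octo_strip d"
  shows "K y x = szego_strip d y x"
proof -
  obtain I w where I: "I \<in> imag_sphere" and w: "x = slice_emb I w" "0 < Re w" "Re w < d"
    using octo_strip_cases[OF x] by metis
  obtain J z where J: "J \<in> imag_sphere" and z: "y = slice_emb J z" "0 < Re z" "Re z < d"
    using octo_strip_cases[OF y] by metis
  note S = szego_strip_is_kernel[OF d]
  have hK: "(\<lambda>y. K y x) \<in> hardy2 d" and hS: "(\<lambda>y. szego_strip d y x) \<in> hardy2 d"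
    using K S x by (simp_all add: is_slice_szego_kernel_def)
  have same: "K (slice_emb I \<zeta>) x = szego_strip d (slice_emb I \<zeta>) x" if \<zeta>: "0 < Re \<zeta>" "Re \<zeta> < d" for \<zeta>
  proof -
    let ?x' = "slice_emb I \<zeta>"
    have in_plane: "slice_emb I a \<in> slice_plane I" for a
      by (auto simp: slice_plane_def slice_emb_def)
    have x': "?x' \<in> octo_strip d"
      using \<zeta> I by (simp add: slice_emb_in_octo_strip_iff)
    have hS': "(\<lambda>y. szego_strip d y ?x') \<in> hardy2 d"
      using S x' by (simp add: is_slice_szego_kernel_def)
    have "K ?x' x = hardy_inner d I (\<lambda>y. K y x) (\<lambda>y. szego_strip d y ?x')"
      using S hK I x' in_plane by (simp add: is_slice_szego_kernel_def)
    also have "\<dots> = ocnj (hardy_inner d I (\<lambda>y. szego_strip d y ?x') (\<lambda>y. K y x))"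
      by (simp only: ocnj_hardy_inner)
    also have "hardy_inner d I (\<lambda>y. szego_strip d y ?x') (\<lambda>y. K y x) = szego_strip d x ?x'"
      using K hS' I x in_plane[of w] w by (simp add: is_slice_szego_kernel_def)
    also have "ocnj (szego_strip d x ?x') = szego_strip d ?x' x"
      using szego_strip_hermitian[OF I I d w(2,3) \<zeta>] w by simp
    finally show ?thesis .
  qed
  have "K y x = slice_ext I (\<lambda>z. K (slice_emb I z) x) J z"
    using hardy2_representation_formula[OF hK I J z(2,3)] z by simp
  also have "\<dots> = slice_ext I (\<lambda>z. szego_strip d (slice_emb I z) x) J z"
    using z by (simp add: slice_ext_def same)
  also have "\<dots> = szego_strip d y x"
    using hardy2_representation_formula[OF hS I J z(2,3)] z by simp
  finally show ?thesis .
qed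

section \<open>The Szego kernel of the strip\<close>

lemma closure_octo_strip_subset: "closure (octo_strip d) \<subseteq> {x. 0 \<le> oRe x \<and> oRe x \<le> d}"
proof (rule closure_minimal)
  have "{x. 0 \<le> oRe x \<and> oRe x \<le> d} = oRe -` {0..d}"
    by auto
  then show "closed {x. 0 \<le> oRe x \<and> oRe x \<le> d}"
    using linear_continuous_on[OF bounded_linear_oRe] by (simp add: closed_vimage)
qed (auto simp: octo_strip_def)

theorem proposition4p13:
  fixes d :: real
  assumes "0 < d"
  shows "(\<forall>x\<in>octo_strip d. \<forall>y\<in>closure (octo_strip d).
            bisums (szego_term d y x) (szego_strip d y x))
       \<and> is_slice_szego_kernel d (szego_strip d)
       \<and> (\<forall>K. is_slice_szego_kernel d K \<longrightarrow>
            (\<forall>y\<in>octo_strip d. \<forall>x\<in>octo_strip d. K y x = szego_strip d y x))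
       \<and> (\<forall>x\<in>octo_strip d. left_slice_monogenic_on (octo_strip d) (\<lambda>y. szego_strip d y x))
       \<and> (\<forall>y\<in>octo_strip d.
            right_slice_monogenic_on (ocnj ` octo_strip d) (\<lambda>w. szego_strip d y (ocnj w)))
       \<and> (\<forall>x\<in>octo_strip d. \<forall>y\<in>octo_strip d.
            ocnj (szego_strip d y x) = szego_strip d x y)"
proof (intro conjI ballI allI impI)
  fix x y assume x: "x \<in> octo_strip d" and y: "y \<in> closure (octo_strip d)"
  obtain I w where I: "I \<in> imag_sphere" and w: "x = slice_emb I w" "0 < Re w" "Re w < d"
    using octo_strip_cases[OF x] by metis
  obtain J z where J: "J \<in> imag_sphere" and z: "y = slice_emb J z" "Re z = oRe y"
    using slice_emb_cases[of y] by metis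
  have "0 \<le> Re z" "Re z \<le> d"
    using closure_octo_strip_subset y z by auto
  then show "bisums (szego_term d y x) (szego_strip d y x)"
    unfolding z(1) w(1) using szego_strip_bisums[OF I J assms] szego_strip_slice[OF I J assms] w by simp
next
  show "is_slice_szego_kernel d (szego_strip d)"
    by (rule szego_strip_is_kernel[OF assms])
next
  fix K y x assume "is_slice_szego_kernel d K" "y \<in> octo_strip d" "x \<in> octo_strip d"
  then show "K y x = szego_strip d y x"
    by (rule slice_szego_kernel_unique[OF assms])
next
  fix x assume "x \<in> octo_strip d"
  then show "left_slice_monogenic_on (octo_strip d) (\<lambda>y. szego_strip d y x)"
    by (elim octo_strip_cases) (auto intro: left_slice_monogenic_szego_strip[OF _ assms])
next
  fix x y assume "x \<in> octo_strip d" "y \<in> octo_strip d"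
  then show "ocnj (szego_strip d y x) = szego_strip d x y"
    by (elim octo_strip_cases) (auto intro: szego_strip_hermitian[OF _ _ assms])
next
  fix y assume y: "y \<in> octo_strip d"
  then obtain I w where I: "I \<in> imag_sphere" and w: "y = slice_emb I w" "0 < Re w" "Re w < d"
    using octo_strip_cases by metis
  have conj: "ocnj w \<in> octo_strip d \<longleftrightarrow> w \<in> octo_strip d" for w
    by (simp add: octo_strip_def oRe_def ocnj_def)
  have img: "ocnj ` octo_strip d = octo_strip d"
  proof
    show "octo_strip d \<subseteq> ocnj ` octo_strip d"
      using conj by (metis image_eqI ocnj_ocnj subsetI)
  qed (use conj in auto)
  show "right_slice_monogenic_on (ocnj ` octo_strip d) (\<lambda>w. szego_strip d y (ocnj w))"
    unfolding img
  proof (rule right_slice_monogenic_ocnj[OF left_slice_monogenic_szego_strip[OF I assms w(2,3)]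
        open_octo_strip _ open_octo_strip])
    fix x assume "x \<in> octo_strip d"
    then have "ocnj x \<in> octo_strip d"
      using conj by simp
    then show "szego_strip d y (ocnj x) = ocnj (szego_strip d (ocnj x) (slice_emb I w))"
      unfolding w(1) using w(2,3) I
      by (elim octo_strip_cases) (auto simp: szego_strip_hermitian[OF _ _ assms])
  qed (use conj in auto)
qed

end
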